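(* Suppose that $\Lambda$ is a row-finite $k$-graph with no sources, $\eta:\Lambda\to G$ is a functor from $\Lambda$ into a group $G$, and $B$ is the Fell bundle over $G$ with fibres $B_g=\overline{\operatorname{span}}\{s_\lambda s_\mu^*:\eta(\lambda)\eta(\mu)^{-1}=g\}\subset C^*(\Lambda)$. Suppose that $\sigma\in Z^2(G,\mathbb{T})$ is a cocycle. Suppose there is a representation $\rho=\{\rho_g\}$ of the deformed Fell bundle $B(\sigma)$ in a multiplier algebra $M(A)$, and that there is a strictly continuous action $\alpha$ of $\mathbb{T}^k$ on $M(A)$ such that $\rho_g\circ\beta_z=\alpha_z\circ\rho_g$ for all $z\in\mathbb{T}^k$ and $g\in G$, where $\beta$ is the gauge action. If $\rho_e(p_v)\neq0$ for every $v\in\Lambda^0$, then the corresponding representation $\rho$ of $C^*(B(\sigma))$ is faithful.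
   Context: All groups $G$ are discrete. A $k$-graph is a countable small category $\Lambda$ with a functor $d:\Lambda\to\mathbb{N}^k$ satisfying the factorisation property: if $d(\lambda)=m+n$, there are unique $\mu,\nu$ with $\lambda=\mu\nu$, $d(\mu)=m$, $d(\nu)=n$. Range and source (codomain and domain) are written $r,s$, so $\lambda\mu$ is defined exactly when $s(\lambda)=r(\mu)$. $\Lambda^n:=d^{-1}(n)$, $\Lambda^0$ is identified with the set of objects, $v\Lambda^n:=\{\lambda\in\Lambda^n:r(\lambda)=v\}$. Row-finite with no sources means every $v\Lambda^n$ is finite and nonempty. $C^*(\Lambda)$ is the universal $C^*$-algebra generated by a Cuntz--Krieger family $\{s_\lambda\}$: the $p_v:=s_v$ ($v\in\Lambda^0$) are mutually orthogonal projections; $s_\lambda s_\mu=s_{\lambda\mu}$ if $s(\lambda)=r(\mu)$; $s_\lambda^*s_\lambda=p_{s(\lambda)}$; $p_v=\sum_{\lambda\in v\Lambda^n}s_\lambda s_\lambda^*$. A functor $\eta:\Lambda\to G$ is a map with $\eta(\lambda\mu)=\eta(\lambda)\eta(\mu)$ for composable $\lambda,\mu$ and $\eta(v)=e$ for $v\in\Lambda^0$. A Fell bundle over $G$ is a set $B$ with a map $p:B\to G$ whose fibres $B_g=p^{-1}(g)$ are complex Banach spaces, with an associative multiplication and an involution such that: $p(bc)=p(b)p(c)$; multiplication is bilinear $B_g\times B_h\to B_{gh}$ with $\|bc\|\le\|b\|\,\|c\|$; $b\mapsto b^*$ is conjugate linear $B_g\to B_{g^{-1}}$ with $(bc)^*=c^*b^*$,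 $\|b^*b\|=\|b\|^2$ (so $B_e$ is a $C^*$-algebra); and $b^*b\ge0$ in $B_e$. The subspaces $B_g\subset C^*(\Lambda)$ of the claim form such a bundle with the operations and norm of $C^*(\Lambda)$. $Z^2(G,\mathbb{T})$ is the set of $\sigma:G\times G\to\mathbb{T}$ with $\sigma(e,g)=\sigma(g,e)=1$ and $\sigma(g,h)\sigma(gh,k)=\sigma(g,hk)\sigma(h,k)$. The deformed bundle $B(\sigma)$ is the Fell bundle with the same set, projection and Banach space fibres as $B$, and operations $b\cdot_\sigma c=\sigma(g,h)bc$, $b^{*_\sigma}=\overline{\sigma(g,g^{-1})}b^*$ for $b\in B_g$, $c\in B_h$. A representation of a Fell bundle $B$ consists of linear maps $\pi_g$ on $B_g$ with $\pi_{gh}(bc)=\pi_g(b)\pi_h(c)$, $\pi_g(b)^*=\pi_{g^{-1}}(b^* )$ and $\pi_e$ nondegenerate (for maps into $M(A)$: $\pi_e(B_e)A$ spans a dense subspace of $A$). $C^*(B)$ is the $C^*$-algebra generated by a universal representation of $B$; a representation $\rho=\{\rho_g\}$ of $B$ induces a homomorphism, also written $\rho$, of $C^*(B)$. The gauge action $\beta$ of $\mathbb{T}^k$ on $C^*(B(\sigma))$ is the continuous action determined on the (isometric) images of the fibres $B_g$ by $\beta_z(s_\lambda s_\mu^* )=z^{d(\lambda)-d(\mu)}s_\lambda s_\mu^*$; in $\rho_g\circ\beta_z$ it is viewed as a map $B_g\to B_g$. Here $A$ is a $C^*$-algebra with multiplier algebra $M(A)$; a strictly continuous action $\alpha$ on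 $M(A)$ is a homomorphism $z\mapsto\alpha_z$ into the automorphism group of $M(A)$ such that $z\mapsto\alpha_z(m)$ is continuous for the strict topology for each $m\in M(A)$. *)

theory Defs
  imports "HOL-Analysis.Analysis" "HOL-Algebra.Ring"
begin

section \<open>C*-algebras\<close>

text \<open>C*-algebras are carrier-based and not necessarily unital; the record field \<open>one\<close> inherited
  from \<^typ>\<open>'a ring\<close> is not constrained by the axioms below.\<close>

record 'a cstar = "'a ring" +
  cscale :: "complex \<Rightarrow> 'a \<Rightarrow> 'a"
  cadj :: "'a \<Rightarrow> 'a"
  cnorm :: "'a \<Rightarrow> real"

text \<open>The value 0 outside the carrier is there because \<^locale>\<open>Metric_space\<close> wants
  nonnegativity and symmetry of the distance on the whole type.\<close>

definition cdist :: "'a cstar \<Rightarrow> 'a \<Rightarrow> 'a \<Rightarrow> real" where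
  "cdist A x y = (if x \<in> carrier A \<and> y \<in> carrier A then cnorm A (x \<ominus>\<^bsub>A\<^esub> y) else 0)"

definition ctopology :: "'a cstar \<Rightarrow> 'a topology" where
  "ctopology A = Metric_space.mtopology (carrier A) (cdist A)"

locale cstar_algebra = abelian_group A for A :: "'a cstar" (structure) +
  assumes mult_closed: "\<lbrakk>x \<in> carrier A; y \<in> carrier A\<rbrakk> \<Longrightarrow> x \<otimes> y \<in> carrier A"
    and mult_assoc: "\<lbrakk>x \<in> carrier A; y \<in> carrier A; z \<in> carrier A\<rbrakk> \<Longrightarrow> (x \<otimes> y) \<otimes> z = x \<otimes> (y \<otimes> z)"
    and distrib_right: "\<lbrakk>x \<in> carrier A; y \<in> carrier A; z \<in> carrier A\<rbrakk> \<Longrightarrow> (x \<oplus> y) \<otimes> z = x \<otimes> z \<oplus> y \<otimes> z"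
    and distrib_left: "\<lbrakk>x \<in> carrier A; y \<in> carrier A; z \<in> carrier A\<rbrakk> \<Longrightarrow> z \<otimes> (x \<oplus> y) = z \<otimes> x \<oplus> z \<otimes> y"
    and scale_closed: "x \<in> carrier A \<Longrightarrow> cscale A c x \<in> carrier A"
    and scale_add: "\<lbrakk>x \<in> carrier A; y \<in> carrier A\<rbrakk> \<Longrightarrow> cscale A c (x \<oplus> y) = cscale A c x \<oplus> cscale A c y"
    and add_scale: "x \<in> carrier A \<Longrightarrow> cscale A (b + c) x = cscale A b x \<oplus> cscale A c x"
    and scale_scale: "x \<in> carrier A \<Longrightarrow> cscale A b (cscale A c x) = cscale A (b * c) x"
    and scale_one: "x \<in> carrier A \<Longrightarrow> cscale A 1 x = x"
    and scale_mult_left: "\<lbrakk>x \<in> carrier A; y \<in> carrier A\<rbrakk> \<Longrightarrow> cscale A c x \<otimes> y = cscale A c (x \<otimes> y)"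
    and scale_mult_right: "\<lbrakk>x \<in> carrier A; y \<in> carrier A\<rbrakk> \<Longrightarrow> x \<otimes> cscale A c y = cscale A c (x \<otimes> y)"
    and adj_closed: "x \<in> carrier A \<Longrightarrow> cadj A x \<in> carrier A"
    and adj_adj: "x \<in> carrier A \<Longrightarrow> cadj A (cadj A x) = x"
    and adj_add: "\<lbrakk>x \<in> carrier A; y \<in> carrier A\<rbrakk> \<Longrightarrow> cadj A (x \<oplus> y) = cadj A x \<oplus> cadj A y"
    and adj_scale: "x \<in> carrier A \<Longrightarrow> cadj A (cscale A c x) = cscale A (cnj c) (cadj A x)"
    and adj_mult: "\<lbrakk>x \<in> carrier A; y \<in> carrier A\<rbrakk> \<Longrightarrow> cadj A (x \<otimes> y) = cadj A y \<otimes> cadj A x"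
    and norm_nonneg: "x \<in> carrier A \<Longrightarrow> 0 \<le> cnorm A x"
    and norm_eq_0: "x \<in> carrier A \<Longrightarrow> cnorm A x = 0 \<longleftrightarrow> x = \<zero>"
    and norm_triangle: "\<lbrakk>x \<in> carrier A; y \<in> carrier A\<rbrakk> \<Longrightarrow> cnorm A (x \<oplus> y) \<le> cnorm A x + cnorm A y"
    and norm_scale: "x \<in> carrier A \<Longrightarrow> cnorm A (cscale A c x) = cmod c * cnorm A x"
    and norm_mult: "\<lbrakk>x \<in> carrier A; y \<in> carrier A\<rbrakk> \<Longrightarrow> cnorm A (x \<otimes> y) \<le> cnorm A x * cnorm A y"
    and norm_adj_mult: "x \<in> carrier A \<Longrightarrow> cnorm A (cadj A x \<otimes> x) = (cnorm A x)\<^sup>2"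
    and complete: "Metric_space.mcomplete (carrier A) (cdist A)"

lemma (in cstar_algebra) scale_zero:
  assumes x: "x \<in> carrier A" shows "cscale A 0 x = \<zero>"
  using norm_scale[OF x, of 0] norm_eq_0[OF scale_closed[OF x, of 0]] by simp

lemma (in cstar_algebra) scale_minus_one:
  assumes x: "x \<in> carrier A" shows "cscale A (-1) x = \<ominus> x"
proof -
  have "cscale A (-1) x \<oplus> x = cscale A (-1 + 1) x"
    using x by (simp only: add_scale scale_one)
  then have "cscale A (-1) x \<oplus> x = \<zero>"
    using scale_zero[OF x] by simp
  then show ?thesis
    using x scale_closed by (metis minus_equality)
qed

lemma (in cstar_algebra) Metric_space_cdist: "Metric_space (carrier A) (cdist A)"
proof
  have sym: "cnorm A (x \<ominus> y) = cnorm A (y \<ominus> x)" if "x \<in> carrier A" "y \<in> carrier A" for x y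
  proof -
    have "x \<ominus> y = \<ominus> (y \<ominus> x)"
      using that by (simp add: a_minus_def minus_add a_comm)
    also have "\<dots> = cscale A (-1) (y \<ominus> x)"
      using that scale_minus_one by simp
    finally show ?thesis
      using that norm_scale[of "y \<ominus> x" "-1"] by simp
  qed
  show "0 \<le> cdist A x y" for x y
    by (simp add: cdist_def norm_nonneg)
  show "cdist A x y = cdist A y x" for x y
    using sym by (simp add: cdist_def)
  show "cdist A x y = 0 \<longleftrightarrow> x = y" if "x \<in> carrier A" "y \<in> carrier A" for x y
    using that minus_equality[of x "\<ominus> y"] by (auto simp: cdist_def norm_eq_0 minus_eq r_neg)
  show "cdist A x z \<le> cdist A x y + cdist A y z"
    if x: "x \<in> carrier A" and y: "y \<in> carrier A" and z: "z \<in> carrier A" for x y z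
  proof -
    have "x \<ominus> z = (x \<ominus> y) \<oplus> (y \<ominus> z)"
      using x y z by (simp add: a_minus_def a_assoc r_neg1)
    then show ?thesis
      using x y z norm_triangle[of "x \<ominus> y" "y \<ominus> z"] by (simp add: cdist_def)
  qed
qed

definition linear_subspace :: "'a cstar \<Rightarrow> 'a set \<Rightarrow> bool" where
  "linear_subspace A S \<longleftrightarrow> S \<subseteq> carrier A \<and> \<zero>\<^bsub>A\<^esub> \<in> S \<and>
     (\<forall>x\<in>S. \<forall>y\<in>S. x \<oplus>\<^bsub>A\<^esub> y \<in> S) \<and> (\<forall>c. \<forall>x\<in>S. cscale A c x \<in> S)"

definition linear_span :: "'a cstar \<Rightarrow> 'a set \<Rightarrow> 'a set" where
  "linear_span A X = \<Inter> {S. linear_subspace A S \<and> X \<subseteq> S}"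

definition closed_span :: "'a cstar \<Rightarrow> 'a set \<Rightarrow> 'a set" where
  "closed_span A X = ctopology A closure_of linear_span A X"

definition cstar_subalgebra :: "'a cstar \<Rightarrow> 'a set \<Rightarrow> bool" where
  "cstar_subalgebra A S \<longleftrightarrow> linear_subspace A S \<and> closedin (ctopology A) S \<and>
     (\<forall>x\<in>S. \<forall>y\<in>S. x \<otimes>\<^bsub>A\<^esub> y \<in> S) \<and> (\<forall>x\<in>S. cadj A x \<in> S)"

definition cstar_generated :: "'a cstar \<Rightarrow> 'a set \<Rightarrow> 'a set" where
  "cstar_generated A X = \<Inter> {S. cstar_subalgebra A S \<and> X \<subseteq> S}"

definition star_hom :: "'a cstar \<Rightarrow> 'b cstar \<Rightarrow> ('a \<Rightarrow> 'b) \<Rightarrow> bool" where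
  "star_hom A B f \<longleftrightarrow> f \<in> carrier A \<rightarrow> carrier B \<and>
     (\<forall>x\<in>carrier A. \<forall>y\<in>carrier A. f (x \<oplus>\<^bsub>A\<^esub> y) = f x \<oplus>\<^bsub>B\<^esub> f y) \<and>
     (\<forall>c. \<forall>x\<in>carrier A. f (cscale A c x) = cscale B c (f x)) \<and>
     (\<forall>x\<in>carrier A. \<forall>y\<in>carrier A. f (x \<otimes>\<^bsub>A\<^esub> y) = f x \<otimes>\<^bsub>B\<^esub> f y) \<and>
     (\<forall>x\<in>carrier A. f (cadj A x) = cadj B (f x))"

definition star_automorphism :: "'a cstar \<Rightarrow> ('a \<Rightarrow> 'a) \<Rightarrow> bool" where
  "star_automorphism A f \<longleftrightarrow> star_hom A A f \<and> bij_betw f (carrier A) (carrier A)"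

section \<open>Multiplier algebras\<close>

text \<open>A multiplier \<open>m\<close> is the double centraliser \<open>(L, R)\<close> with \<open>L a = m a\<close> and \<open>R a = a m\<close>.\<close>

definition bounded_operator :: "'a cstar \<Rightarrow> ('a \<Rightarrow> 'a) \<Rightarrow> bool" where
  "bounded_operator A T \<longleftrightarrow> T \<in> carrier A \<rightarrow>\<^sub>E carrier A \<and>
     (\<forall>x\<in>carrier A. \<forall>y\<in>carrier A. T (x \<oplus>\<^bsub>A\<^esub> y) = T x \<oplus>\<^bsub>A\<^esub> T y) \<and>
     (\<forall>c. \<forall>x\<in>carrier A. T (cscale A c x) = cscale A c (T x)) \<and>
     (\<exists>K. \<forall>x\<in>carrier A. cnorm A (T x) \<le> K * cnorm A x)"

definition double_centralisers :: "'a cstar \<Rightarrow> (('a \<Rightarrow> 'a) \<times> ('a \<Rightarrow> 'a)) set" where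
  "double_centralisers A = {(L, R). bounded_operator A L \<and> bounded_operator A R \<and>
     (\<forall>a\<in>carrier A. \<forall>b\<in>carrier A.
        L (a \<otimes>\<^bsub>A\<^esub> b) = L a \<otimes>\<^bsub>A\<^esub> b \<and> R (a \<otimes>\<^bsub>A\<^esub> b) = a \<otimes>\<^bsub>A\<^esub> R b \<and> R a \<otimes>\<^bsub>A\<^esub> b = a \<otimes>\<^bsub>A\<^esub> L b)}"

definition multiplier_algebra :: "'a cstar \<Rightarrow> (('a \<Rightarrow> 'a) \<times> ('a \<Rightarrow> 'a)) cstar" where
  "multiplier_algebra A =
    \<lparr> carrier = double_centralisers A,
      mult = (\<lambda>m n. (\<lambda>a\<in>carrier A. fst m (fst n a), \<lambda>a\<in>carrier A. snd n (snd m a))),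
      one = (\<lambda>a\<in>carrier A. a, \<lambda>a\<in>carrier A. a),
      zero = (\<lambda>a\<in>carrier A. \<zero>\<^bsub>A\<^esub>, \<lambda>a\<in>carrier A. \<zero>\<^bsub>A\<^esub>),
      add = (\<lambda>m n. (\<lambda>a\<in>carrier A. fst m a \<oplus>\<^bsub>A\<^esub> fst n a, \<lambda>a\<in>carrier A. snd m a \<oplus>\<^bsub>A\<^esub> snd n a)),
      cscale = (\<lambda>c m. (\<lambda>a\<in>carrier A. cscale A c (fst m a), \<lambda>a\<in>carrier A. cscale A c (snd m a))),
      cadj = (\<lambda>m. (\<lambda>a\<in>carrier A. cadj A (snd m (cadj A a)), \<lambda>a\<in>carrier A. cadj A (fst m (cadj A a)))),
      cnorm = (\<lambda>m. SUP a\<in>{a \<in> carrier A. cnorm A a \<le> 1}. cnorm A (fst m a)) \<rparr>"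

text \<open>The coarsest topology making \<open>m \<mapsto> m a\<close> and \<open>m \<mapsto> a m\<close> norm-continuous for all \<open>a\<close>.\<close>

definition strict_topology :: "'a cstar \<Rightarrow> (('a \<Rightarrow> 'a) \<times> ('a \<Rightarrow> 'a)) topology" where
  "strict_topology A = topology_generated_by
     ({{m \<in> carrier (multiplier_algebra A). fst m a \<in> U} | a U. a \<in> carrier A \<and> openin (ctopology A) U} \<union>
      {{m \<in> carrier (multiplier_algebra A). snd m a \<in> U} | a U. a \<in> carrier A \<and> openin (ctopology A) U})"

section \<open>Torus actions\<close>

text \<open>The monoid of k-tuples of naturals and the k-torus consist of sequences that are trivial from
  index k on. The torus carries the product topology of \<^typ>\<open>nat \<Rightarrow> complex\<close>.\<close>

definition degrees :: "nat \<Rightarrow> (nat \<Rightarrow> nat) set" where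
  "degrees k = {n. \<forall>i\<ge>k. n i = 0}"

definition torus :: "nat \<Rightarrow> (nat \<Rightarrow> complex) set" where
  "torus k = {z. (\<forall>i<k. cmod (z i) = 1) \<and> (\<forall>i\<ge>k. z i = 1)}"

definition torus_action :: "nat \<Rightarrow> 'a cstar \<Rightarrow> ((nat \<Rightarrow> complex) \<Rightarrow> 'a \<Rightarrow> 'a) \<Rightarrow> bool" where
  "torus_action k A \<alpha> \<longleftrightarrow> (\<forall>z\<in>torus k. star_automorphism A (\<alpha> z)) \<and>
     (\<forall>z\<in>torus k. \<forall>w\<in>torus k. \<forall>x\<in>carrier A. \<alpha> (\<lambda>i. z i * w i) x = \<alpha> z (\<alpha> w x))"

definition continuous_torus_action :: "nat \<Rightarrow> 'a cstar \<Rightarrow> ((nat \<Rightarrow> complex) \<Rightarrow> 'a \<Rightarrow> 'a) \<Rightarrow> bool" where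
  "continuous_torus_action k A \<alpha> \<longleftrightarrow> torus_action k A \<alpha> \<and>
     (\<forall>x\<in>carrier A. continuous_map (top_of_set (torus k)) (ctopology A) (\<lambda>z. \<alpha> z x))"

definition strictly_continuous_torus_action ::
    "nat \<Rightarrow> 'a cstar \<Rightarrow> ((nat \<Rightarrow> complex) \<Rightarrow> ('a \<Rightarrow> 'a) \<times> ('a \<Rightarrow> 'a) \<Rightarrow> ('a \<Rightarrow> 'a) \<times> ('a \<Rightarrow> 'a)) \<Rightarrow> bool" where
  "strictly_continuous_torus_action k A \<alpha> \<longleftrightarrow> torus_action k (multiplier_algebra A) \<alpha> \<and>
     (\<forall>m\<in>carrier (multiplier_algebra A).
        continuous_map (top_of_set (torus k)) (strict_topology A) (\<lambda>z. \<alpha> z m))"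

section \<open>Higher-rank graphs and their C*-algebras\<close>

text \<open>Categories are given by their morphisms; objects are identified with identity morphisms, and
  \<open>kcomp \<Lambda> \<lambda> \<mu>\<close> is meaningful when \<open>ksrc \<Lambda> \<lambda> = krng \<Lambda> \<mu>\<close>. By the factorisation property the
  identity morphisms are exactly the morphisms of degree 0.\<close>

record 'l kgraph =
  kmor :: "'l set"
  krng :: "'l \<Rightarrow> 'l"
  ksrc :: "'l \<Rightarrow> 'l"
  kcomp :: "'l \<Rightarrow> 'l \<Rightarrow> 'l"
  kdeg :: "'l \<Rightarrow> nat \<Rightarrow> nat"

locale higher_rank_graph =
  fixes k :: nat and \<Lambda> :: "'l kgraph"
  assumes countable: "countable (kmor \<Lambda>)"
    and rng_closed: "l \<in> kmor \<Lambda> \<Longrightarrow> krng \<Lambda> l \<in> kmor \<Lambda>"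
    and src_closed: "l \<in> kmor \<Lambda> \<Longrightarrow> ksrc \<Lambda> l \<in> kmor \<Lambda>"
    and rng_rng: "l \<in> kmor \<Lambda> \<Longrightarrow> krng \<Lambda> (krng \<Lambda> l) = krng \<Lambda> l"
    and src_rng: "l \<in> kmor \<Lambda> \<Longrightarrow> ksrc \<Lambda> (krng \<Lambda> l) = krng \<Lambda> l"
    and rng_src: "l \<in> kmor \<Lambda> \<Longrightarrow> krng \<Lambda> (ksrc \<Lambda> l) = ksrc \<Lambda> l"
    and src_src: "l \<in> kmor \<Lambda> \<Longrightarrow> ksrc \<Lambda> (ksrc \<Lambda> l) = ksrc \<Lambda> l"
    and comp_closed: "\<lbrakk>l \<in> kmor \<Lambda>; m \<in> kmor \<Lambda>; ksrc \<Lambda> l = krng \<Lambda> m\<rbrakk> \<Longrightarrow> kcomp \<Lambda> l m \<in> kmor \<Lambda>"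
    and rng_comp: "\<lbrakk>l \<in> kmor \<Lambda>; m \<in> kmor \<Lambda>; ksrc \<Lambda> l = krng \<Lambda> m\<rbrakk> \<Longrightarrow> krng \<Lambda> (kcomp \<Lambda> l m) = krng \<Lambda> l"
    and src_comp: "\<lbrakk>l \<in> kmor \<Lambda>; m \<in> kmor \<Lambda>; ksrc \<Lambda> l = krng \<Lambda> m\<rbrakk> \<Longrightarrow> ksrc \<Lambda> (kcomp \<Lambda> l m) = ksrc \<Lambda> m"
    and comp_assoc: "\<lbrakk>l \<in> kmor \<Lambda>; m \<in> kmor \<Lambda>; n \<in> kmor \<Lambda>; ksrc \<Lambda> l = krng \<Lambda> m; ksrc \<Lambda> m = krng \<Lambda> n\<rbrakk>
        \<Longrightarrow> kcomp \<Lambda> (kcomp \<Lambda> l m) n = kcomp \<Lambda> l (kcomp \<Lambda> m n)"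
    and comp_id_left: "l \<in> kmor \<Lambda> \<Longrightarrow> kcomp \<Lambda> (krng \<Lambda> l) l = l"
    and comp_id_right: "l \<in> kmor \<Lambda> \<Longrightarrow> kcomp \<Lambda> l (ksrc \<Lambda> l) = l"
    and deg_closed: "l \<in> kmor \<Lambda> \<Longrightarrow> kdeg \<Lambda> l \<in> degrees k"
    and deg_id: "l \<in> kmor \<Lambda> \<Longrightarrow> kdeg \<Lambda> (krng \<Lambda> l) = (\<lambda>i. 0)"
    and deg_comp: "\<lbrakk>l \<in> kmor \<Lambda>; m \<in> kmor \<Lambda>; ksrc \<Lambda> l = krng \<Lambda> m\<rbrakk>
        \<Longrightarrow> kdeg \<Lambda> (kcomp \<Lambda> l m) = (\<lambda>i. kdeg \<Lambda> l i + kdeg \<Lambda> m i)"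
    and factorisation: "\<lbrakk>l \<in> kmor \<Lambda>; p \<in> degrees k; q \<in> degrees k; kdeg \<Lambda> l = (\<lambda>i. p i + q i)\<rbrakk>
        \<Longrightarrow> \<exists>!(\<mu>, \<nu>). \<mu> \<in> kmor \<Lambda> \<and> \<nu> \<in> kmor \<Lambda> \<and> ksrc \<Lambda> \<mu> = krng \<Lambda> \<nu> \<and>
              l = kcomp \<Lambda> \<mu> \<nu> \<and> kdeg \<Lambda> \<mu> = p \<and> kdeg \<Lambda> \<nu> = q"

definition kvertices :: "'l kgraph \<Rightarrow> 'l set" where
  "kvertices \<Lambda> = {v \<in> kmor \<Lambda>. kdeg \<Lambda> v = (\<lambda>i. 0)}"

definition kpaths_to :: "'l kgraph \<Rightarrow> 'l \<Rightarrow> (nat \<Rightarrow> nat) \<Rightarrow> 'l set" where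
  "kpaths_to \<Lambda> v n = {l \<in> kmor \<Lambda>. kdeg \<Lambda> l = n \<and> krng \<Lambda> l = v}"

lemma (in higher_rank_graph) kvertices_eq_range: "kvertices \<Lambda> = krng \<Lambda> ` kmor \<Lambda>"
proof (intro equalityI subsetI)
  fix v assume "v \<in> kvertices \<Lambda>"
  then have v: "v \<in> kmor \<Lambda>" and d: "kdeg \<Lambda> v = (\<lambda>i. 0)" by (auto simp: kvertices_def)
  have z: "(\<lambda>i. 0) \<in> degrees k" by (simp add: degrees_def)
  let ?P = "\<lambda>(\<mu>, \<nu>). \<mu> \<in> kmor \<Lambda> \<and> \<nu> \<in> kmor \<Lambda> \<and> ksrc \<Lambda> \<mu> = krng \<Lambda> \<nu> \<and>
              v = kcomp \<Lambda> \<mu> \<nu> \<and> kdeg \<Lambda> \<mu> = (\<lambda>i. 0) \<and> kdeg \<Lambda> \<nu> = (\<lambda>i. 0)"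
  have "\<exists>!x. ?P x" using factorisation[OF v z z] d by simp
  moreover have "?P (krng \<Lambda> v, v)"
    using v d by (simp add: rng_closed src_rng comp_id_left deg_id)
  moreover have "?P (v, ksrc \<Lambda> v)"
    using v d deg_id[OF src_closed[OF v]] by (simp add: src_closed rng_src comp_id_right)
  ultimately have "(krng \<Lambda> v, v) = (v, ksrc \<Lambda> v)" by blast
  then show "v \<in> krng \<Lambda> ` kmor \<Lambda>" using v by (metis Pair_inject imageI)
next
  fix v assume "v \<in> krng \<Lambda> ` kmor \<Lambda>"
  then show "v \<in> kvertices \<Lambda>" by (auto simp: kvertices_def rng_closed deg_id)
qed

definition row_finite_no_sources :: "nat \<Rightarrow> 'l kgraph \<Rightarrow> bool" where
  "row_finite_no_sources k \<Lambda> \<longleftrightarrow>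
     (\<forall>v\<in>kvertices \<Lambda>. \<forall>n\<in>degrees k. finite (kpaths_to \<Lambda> v n) \<and> kpaths_to \<Lambda> v n \<noteq> {})"

definition functor_to_group :: "'l kgraph \<Rightarrow> 'g monoid \<Rightarrow> ('l \<Rightarrow> 'g) \<Rightarrow> bool" where
  "functor_to_group \<Lambda> G \<eta> \<longleftrightarrow> \<eta> \<in> kmor \<Lambda> \<rightarrow> carrier G \<and>
     (\<forall>l\<in>kmor \<Lambda>. \<forall>m\<in>kmor \<Lambda>. ksrc \<Lambda> l = krng \<Lambda> m \<longrightarrow> \<eta> (kcomp \<Lambda> l m) = \<eta> l \<otimes>\<^bsub>G\<^esub> \<eta> m) \<and>
     (\<forall>v\<in>kvertices \<Lambda>. \<eta> v = \<one>\<^bsub>G\<^esub>)"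

definition cuntz_krieger_family :: "nat \<Rightarrow> 'l kgraph \<Rightarrow> 'a cstar \<Rightarrow> ('l \<Rightarrow> 'a) \<Rightarrow> bool" where
  "cuntz_krieger_family k \<Lambda> A s \<longleftrightarrow> s \<in> kmor \<Lambda> \<rightarrow> carrier A \<and>
     (\<forall>v\<in>kvertices \<Lambda>. s v \<otimes>\<^bsub>A\<^esub> s v = s v \<and> cadj A (s v) = s v) \<and>
     (\<forall>v\<in>kvertices \<Lambda>. \<forall>w\<in>kvertices \<Lambda>. v \<noteq> w \<longrightarrow> s v \<otimes>\<^bsub>A\<^esub> s w = \<zero>\<^bsub>A\<^esub>) \<and>
     (\<forall>l\<in>kmor \<Lambda>. \<forall>m\<in>kmor \<Lambda>. ksrc \<Lambda> l = krng \<Lambda> m \<longrightarrow> s l \<otimes>\<^bsub>A\<^esub> s m = s (kcomp \<Lambda> l m)) \<and>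
     (\<forall>l\<in>kmor \<Lambda>. cadj A (s l) \<otimes>\<^bsub>A\<^esub> s l = s (ksrc \<Lambda> l)) \<and>
     (\<forall>v\<in>kvertices \<Lambda>. \<forall>n\<in>degrees k. s v = finsum A (\<lambda>l. s l \<otimes>\<^bsub>A\<^esub> cadj A (s l)) (kpaths_to \<Lambda> v n))"

text \<open>Universal properties quantify over C*-algebras whose elements live in a fixed type. For
  generators indexed by \<^typ>\<open>'x\<close> the type below loses nothing: every element of a C*-algebra
  generated by such a family is the limit of a sequence of noncommutative *-polynomials in the
  generators, and there are at most as many such sequences as elements of this type. So every
  C*-algebra generated by a family indexed by \<^typ>\<open>'x\<close> is isomorphic to one carried by it.\<close>

type_synonym 'x test = "nat \<Rightarrow> 'x \<times> complex"

definition universal_cuntz_krieger_family :: "nat \<Rightarrow> 'l kgraph \<Rightarrow> 'c cstar \<Rightarrow> ('l \<Rightarrow> 'c) \<Rightarrow> bool" where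
  "universal_cuntz_krieger_family k \<Lambda> C s \<longleftrightarrow>
     cstar_algebra C \<and> cuntz_krieger_family k \<Lambda> C s \<and> cstar_generated C (s ` kmor \<Lambda>) = carrier C \<and>
     (\<forall>(T :: 'l test cstar) t. cstar_algebra T \<and> cuntz_krieger_family k \<Lambda> T t \<longrightarrow>
        (\<exists>\<phi>. star_hom C T \<phi> \<and> (\<forall>l\<in>kmor \<Lambda>. \<phi> (s l) = t l)))"

section \<open>Fell bundles, deformations and representations\<close>

text \<open>The bundle is the disjoint union of its fibres, so each operation also takes the base points
  of its arguments. Only the data are recorded here.\<close>

record ('g, 'b) fell_data =
  fib :: "'g \<Rightarrow> 'b set"
  fadd :: "'g \<Rightarrow> 'b \<Rightarrow> 'b \<Rightarrow> 'b"
  fscale :: "'g \<Rightarrow> complex \<Rightarrow> 'b \<Rightarrow> 'b"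
  fnorm :: "'g \<Rightarrow> 'b \<Rightarrow> real"
  fmult :: "'g \<Rightarrow> 'g \<Rightarrow> 'b \<Rightarrow> 'b \<Rightarrow> 'b"
  fadj :: "'g \<Rightarrow> 'b \<Rightarrow> 'b"

definition kgraph_bundle ::
    "'l kgraph \<Rightarrow> 'g monoid \<Rightarrow> ('l \<Rightarrow> 'g) \<Rightarrow> 'c cstar \<Rightarrow> ('l \<Rightarrow> 'c) \<Rightarrow> ('g, 'c) fell_data" where
  "kgraph_bundle \<Lambda> G \<eta> C s =
    \<lparr> fib = (\<lambda>g. closed_span C {s l \<otimes>\<^bsub>C\<^esub> cadj C (s m) | l m.
                l \<in> kmor \<Lambda> \<and> m \<in> kmor \<Lambda> \<and> \<eta> l \<otimes>\<^bsub>G\<^esub> inv\<^bsub>G\<^esub> (\<eta> m) = g}),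
      fadd = (\<lambda>g. add C),
      fscale = (\<lambda>g. cscale C),
      fnorm = (\<lambda>g. cnorm C),
      fmult = (\<lambda>g h. mult C),
      fadj = (\<lambda>g. cadj C) \<rparr>"

definition two_cocycle :: "'g monoid \<Rightarrow> ('g \<Rightarrow> 'g \<Rightarrow> complex) \<Rightarrow> bool" where
  "two_cocycle G \<sigma> \<longleftrightarrow> (\<forall>g\<in>carrier G. \<forall>h\<in>carrier G. cmod (\<sigma> g h) = 1) \<and>
     (\<forall>g\<in>carrier G. \<sigma> \<one>\<^bsub>G\<^esub> g = 1 \<and> \<sigma> g \<one>\<^bsub>G\<^esub> = 1) \<and>
     (\<forall>g\<in>carrier G. \<forall>h\<in>carrier G. \<forall>l\<in>carrier G.
        \<sigma> g h * \<sigma> (g \<otimes>\<^bsub>G\<^esub> h) l = \<sigma> g (h \<otimes>\<^bsub>G\<^esub> l) * \<sigma> h l)"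

definition deformed_bundle ::
    "'g monoid \<Rightarrow> ('g \<Rightarrow> 'g \<Rightarrow> complex) \<Rightarrow> ('g, 'b) fell_data \<Rightarrow> ('g, 'b) fell_data" where
  "deformed_bundle G \<sigma> B = B
    \<lparr> fmult := (\<lambda>g h b c. fscale B (g \<otimes>\<^bsub>G\<^esub> h) (\<sigma> g h) (fmult B g h b c)),
      fadj := (\<lambda>g b. fscale B (inv\<^bsub>G\<^esub> g) (cnj (\<sigma> g (inv\<^bsub>G\<^esub> g))) (fadj B g b)) \<rparr>"

definition bundle_maps :: "'g monoid \<Rightarrow> ('g, 'b) fell_data \<Rightarrow> 'a cstar \<Rightarrow> ('g \<Rightarrow> 'b \<Rightarrow> 'a) \<Rightarrow> bool" where
  "bundle_maps G B M \<pi> \<longleftrightarrow>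
     (\<forall>g\<in>carrier G. \<pi> g \<in> fib B g \<rightarrow> carrier M) \<and>
     (\<forall>g\<in>carrier G. \<forall>b\<in>fib B g. \<forall>c\<in>fib B g. \<pi> g (fadd B g b c) = \<pi> g b \<oplus>\<^bsub>M\<^esub> \<pi> g c) \<and>
     (\<forall>g\<in>carrier G. \<forall>w. \<forall>b\<in>fib B g. \<pi> g (fscale B g w b) = cscale M w (\<pi> g b)) \<and>
     (\<forall>g\<in>carrier G. \<forall>h\<in>carrier G. \<forall>b\<in>fib B g. \<forall>c\<in>fib B h.
        \<pi> (g \<otimes>\<^bsub>G\<^esub> h) (fmult B g h b c) = \<pi> g b \<otimes>\<^bsub>M\<^esub> \<pi> h c) \<and>
     (\<forall>g\<in>carrier G. \<forall>b\<in>fib B g. cadj M (\<pi> g b) = \<pi> (inv\<^bsub>G\<^esub> g) (fadj B g b))"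

definition bundle_rep :: "'g monoid \<Rightarrow> ('g, 'b) fell_data \<Rightarrow> 'a cstar \<Rightarrow> ('g \<Rightarrow> 'b \<Rightarrow> 'a) \<Rightarrow> bool" where
  "bundle_rep G B A \<pi> \<longleftrightarrow> bundle_maps G B A \<pi> \<and>
     closed_span A {\<pi> \<one>\<^bsub>G\<^esub> b \<otimes>\<^bsub>A\<^esub> a | b a. b \<in> fib B \<one>\<^bsub>G\<^esub> \<and> a \<in> carrier A} = carrier A"

definition bundle_multiplier_rep ::
    "'g monoid \<Rightarrow> ('g, 'b) fell_data \<Rightarrow> 'a cstar \<Rightarrow> ('g \<Rightarrow> 'b \<Rightarrow> ('a \<Rightarrow> 'a) \<times> ('a \<Rightarrow> 'a)) \<Rightarrow> bool" where
  "bundle_multiplier_rep G B A \<rho> \<longleftrightarrow> bundle_maps G B (multiplier_algebra A) \<rho> \<and>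
     closed_span A {fst (\<rho> \<one>\<^bsub>G\<^esub> b) a | b a. b \<in> fib B \<one>\<^bsub>G\<^esub> \<and> a \<in> carrier A} = carrier A"

definition integrates ::
    "'g monoid \<Rightarrow> ('g, 'b) fell_data \<Rightarrow> 'd cstar \<Rightarrow> ('g \<Rightarrow> 'b \<Rightarrow> 'd) \<Rightarrow> 'm cstar \<Rightarrow> ('g \<Rightarrow> 'b \<Rightarrow> 'm) \<Rightarrow> ('d \<Rightarrow> 'm) \<Rightarrow> bool" where
  "integrates G B D \<iota> M \<rho> \<phi> \<longleftrightarrow> star_hom D M \<phi> \<and> (\<forall>g\<in>carrier G. \<forall>b\<in>fib B g. \<phi> (\<iota> g b) = \<rho> g b)"

text \<open>For a Fell bundle, a representation in the multipliers of any C*-algebra is also a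
  nondegenerate representation in the C*-algebra generated by its range, so that again nothing is
  lost by restricting the type of the target.\<close>

definition universal_bundle_rep :: "'g monoid \<Rightarrow> ('g, 'b) fell_data \<Rightarrow> 'd cstar \<Rightarrow> ('g \<Rightarrow> 'b \<Rightarrow> 'd) \<Rightarrow> bool" where
  "universal_bundle_rep G B D \<iota> \<longleftrightarrow>
     cstar_algebra D \<and> bundle_rep G B D \<iota> \<and>
     cstar_generated D (\<Union>g\<in>carrier G. \<iota> g ` fib B g) = carrier D \<and>
     (\<forall>(T :: ('g \<times> 'b) test cstar) \<tau>. cstar_algebra T \<and> bundle_multiplier_rep G B T \<tau> \<longrightarrow>
        (\<exists>\<phi>. integrates G B D \<iota> (multiplier_algebra T) \<tau> \<phi>))"

definition gauge_character :: "nat \<Rightarrow> 'l kgraph \<Rightarrow> (nat \<Rightarrow> complex) \<Rightarrow> 'l \<Rightarrow> 'l \<Rightarrow> complex" where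
  "gauge_character k \<Lambda> z l m = (\<Prod>i<k. z i powi (int (kdeg \<Lambda> l i) - int (kdeg \<Lambda> m i)))"

definition gauge_action ::
    "nat \<Rightarrow> 'l kgraph \<Rightarrow> 'g monoid \<Rightarrow> ('l \<Rightarrow> 'g) \<Rightarrow> 'c cstar \<Rightarrow> ('l \<Rightarrow> 'c) \<Rightarrow>
     'd cstar \<Rightarrow> ('g \<Rightarrow> 'c \<Rightarrow> 'd) \<Rightarrow> ((nat \<Rightarrow> complex) \<Rightarrow> 'd \<Rightarrow> 'd) \<Rightarrow> bool" where
  "gauge_action k \<Lambda> G \<eta> C s D \<iota> \<beta> \<longleftrightarrow> continuous_torus_action k D \<beta> \<and>
     (\<forall>z\<in>torus k. \<forall>l\<in>kmor \<Lambda>. \<forall>m\<in>kmor \<Lambda>.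
        \<beta> z (\<iota> (\<eta> l \<otimes>\<^bsub>G\<^esub> inv\<^bsub>G\<^esub> (\<eta> m)) (s l \<otimes>\<^bsub>C\<^esub> cadj C (s m))) =
        cscale D (gauge_character k \<Lambda> z l m) (\<iota> (\<eta> l \<otimes>\<^bsub>G\<^esub> inv\<^bsub>G\<^esub> (\<eta> m)) (s l \<otimes>\<^bsub>C\<^esub> cadj C (s m))))"

text \<open>The map induced on the fibre over \<open>g\<close> by a map of the algebra, the fibre being identified
  with its image under the (isometric) map \<open>\<iota> g\<close>.\<close>

definition on_fibre :: "('g, 'b) fell_data \<Rightarrow> ('g \<Rightarrow> 'b \<Rightarrow> 'd) \<Rightarrow> ('d \<Rightarrow> 'd) \<Rightarrow> 'g \<Rightarrow> 'b \<Rightarrow> 'b" where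
  "on_fibre B \<iota> f g b = inv_into (fib B g) (\<iota> g) (f (\<iota> g b))"

end

theory Submission
  imports Defs "HOL-Library.Real_Mod"
begin

text \<open>The elements of the C*-algebra generated by the range of \<open>\<rho>\<close> are limits of sequences of finite
  sums of images of bundle elements; that algebra therefore has a copy in the test type of the universal
  property, which yields the integrated form \<open>\<phi>\<close>. To see that \<open>\<phi>\<close> is injective, consider the images
  in \<open>D\<close> of the monomials \<open>s l (s m)\<^sup>*\<close>. For paths of one fixed degree they are matrix units up to the
  unimodular values of the cocycle, and each is a sum of the images of \<open>s (l a) (s (m a))\<^sup>*\<close> over the
  paths \<open>a\<close> of any given degree. So every finite combination of gauge degree 0 lies in a
  finite-dimensional *-algebra on which \<open>\<phi>\<close> is bounded below, and two equivalent C*-norms agree. Hence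
  \<open>\<phi>\<close> is isometric on the finite combinations of degree 0 and, by passing to \<open>y\<^sup>* y\<close>, on those of any
  fixed degree. Averaging against a character over the \<open>N\<close>-th roots of unity extracts one homogeneous
  component of a finite combination \<open>y\<close>; as \<open>\<phi>\<close> is equivariant, the norm of that component is at most
  \<open>\<parallel>\<phi> y\<parallel>\<close>. If \<open>y\<close> is close to an element of the kernel, all components of \<open>y\<close> are therefore small,
  hence so are its Fejer means, which are close to \<open>y\<close> by continuity of the gauge action.

  Positivity in a C*-algebra enters only through the orthogonality of the range projections of paths of
  equal degree; it and the contractivity of homomorphisms are derived from square roots of \<open>1 - b\<close>
  with \<open>\<parallel>b\<parallel> < 1\<close>, without spectral theory.\<close>

section \<open>C*-algebras\<close>

definition clim :: "'a cstar \<Rightarrow> (nat \<Rightarrow> 'a) \<Rightarrow> 'a \<Rightarrow> bool" where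
  "clim A f x \<longleftrightarrow> (\<forall>n. f n \<in> carrier A) \<and> x \<in> carrier A \<and> (\<lambda>n. cnorm A (f n \<ominus>\<^bsub>A\<^esub> x)) \<longlonglongrightarrow> 0"

definition cCauchy :: "'a cstar \<Rightarrow> (nat \<Rightarrow> 'a) \<Rightarrow> bool" where
  "cCauchy A f \<longleftrightarrow> (\<forall>n. f n \<in> carrier A) \<and>
     (\<forall>e>0. \<exists>N. \<forall>m\<ge>N. \<forall>n\<ge>N. cnorm A (f m \<ominus>\<^bsub>A\<^esub> f n) < e)"

definition selfadjoint :: "'a cstar \<Rightarrow> 'a \<Rightarrow> bool" where
  "selfadjoint A x \<longleftrightarrow> x \<in> carrier A \<and> cadj A x = x"

definition projection :: "'a cstar \<Rightarrow> 'a \<Rightarrow> bool" where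
  "projection A p \<longleftrightarrow> selfadjoint A p \<and> p \<otimes>\<^bsub>A\<^esub> p = p"

lemma selfadjointD: "selfadjoint A x \<Longrightarrow> x \<in> carrier A" "selfadjoint A x \<Longrightarrow> cadj A x = x"
  by (simp_all add: selfadjoint_def)

lemma projectionD:
  "projection A p \<Longrightarrow> selfadjoint A p" "projection A p \<Longrightarrow> p \<in> carrier A"
  "projection A p \<Longrightarrow> cadj A p = p" "projection A p \<Longrightarrow> p \<otimes>\<^bsub>A\<^esub> p = p"
  by (simp_all add: projection_def selfadjoint_def)

lemma climD: "clim A f x \<Longrightarrow> f n \<in> carrier A" "clim A f x \<Longrightarrow> x \<in> carrier A"
  "clim A f x \<Longrightarrow> (\<lambda>n. cnorm A (f n \<ominus>\<^bsub>A\<^esub> x)) \<longlonglongrightarrow> 0"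
  by (auto simp: clim_def)

context cstar_algebra
begin

subsection \<open>Arithmetic and norm\<close>

declare mult_closed [simp, intro] scale_closed [simp, intro] adj_closed [simp, intro]
  adj_adj [simp] scale_one [simp] scale_scale [simp] scale_zero [simp]

lemma diff_as_scale: "y \<in> carrier A \<Longrightarrow> x \<ominus> y = x \<oplus> cscale A (-1) y"
  by (simp add: a_minus_def scale_minus_one)

lemma norm_zero [simp]: "cnorm A \<zero> = 0"
  by (simp add: norm_eq_0)

lemma scale_zero_right [simp]: "cscale A c \<zero> = \<zero>"
  by (metis norm_eq_0 norm_scale norm_zero mult_zero_right scale_closed zero_closed)

lemma mult_zero_left [simp]: "x \<in> carrier A \<Longrightarrow> \<zero> \<otimes> x = \<zero>"
  using scale_mult_left[of \<zero> x 0] by simp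

lemma mult_zero_right [simp]: "x \<in> carrier A \<Longrightarrow> x \<otimes> \<zero> = \<zero>"
  using scale_mult_right[of x \<zero> 0] by simp

lemma adj_zero [simp]: "cadj A \<zero> = \<zero>"
  using adj_scale[of \<zero> 0] by simp

lemma mult_diff_left: "\<lbrakk>x \<in> carrier A; y \<in> carrier A; z \<in> carrier A\<rbrakk> \<Longrightarrow> (x \<ominus> y) \<otimes> z = x \<otimes> z \<ominus> y \<otimes> z"
  by (simp add: diff_as_scale distrib_right scale_mult_left)

lemma mult_diff_right: "\<lbrakk>x \<in> carrier A; y \<in> carrier A; z \<in> carrier A\<rbrakk> \<Longrightarrow> z \<otimes> (x \<ominus> y) = z \<otimes> x \<ominus> z \<otimes> y"
  by (simp add: diff_as_scale distrib_left scale_mult_right)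

lemma adj_diff: "\<lbrakk>x \<in> carrier A; y \<in> carrier A\<rbrakk> \<Longrightarrow> cadj A (x \<ominus> y) = cadj A x \<ominus> cadj A y"
  by (simp add: diff_as_scale adj_add adj_scale)

lemma scale_diff: "\<lbrakk>x \<in> carrier A; y \<in> carrier A\<rbrakk> \<Longrightarrow> cscale A c (x \<ominus> y) = cscale A c x \<ominus> cscale A c y"
  by (simp add: diff_as_scale scale_add mult.commute)

lemma diff_self [simp]: "x \<in> carrier A \<Longrightarrow> x \<ominus> x = \<zero>"
  by (simp add: a_minus_def r_neg)

lemma diff_zero [simp]: "x \<in> carrier A \<Longrightarrow> x \<ominus> \<zero> = x"
  by (simp add: diff_as_scale)

lemma diff_eq_zero_iff: "\<lbrakk>x \<in> carrier A; y \<in> carrier A\<rbrakk> \<Longrightarrow> x \<ominus> y = \<zero> \<longleftrightarrow> x = y"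
  using minus_equality[of x "\<ominus> y"] by (auto simp: minus_eq r_neg)

lemma add_diff_cancel: "\<lbrakk>x \<in> carrier A; y \<in> carrier A\<rbrakk> \<Longrightarrow> (x \<oplus> y) \<ominus> y = x"
  by (simp add: a_minus_def a_assoc r_neg)

lemma diff_add_cancel: "\<lbrakk>x \<in> carrier A; y \<in> carrier A\<rbrakk> \<Longrightarrow> (x \<ominus> y) \<oplus> y = x"
  by (simp add: a_minus_def a_assoc l_neg)

lemma add_diff_cancel_left: "\<lbrakk>x \<in> carrier A; y \<in> carrier A\<rbrakk> \<Longrightarrow> x \<oplus> (y \<ominus> x) = y"
  by (metis a_comm diff_add_cancel minus_closed)

lemma diff_add_diff:
  "\<lbrakk>x \<in> carrier A; y \<in> carrier A; z \<in> carrier A\<rbrakk> \<Longrightarrow> (x \<ominus> y) \<oplus> (y \<ominus> z) = x \<ominus> z"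
  by (simp add: a_minus_def a_assoc r_neg1)

lemma add_diff_add:
  "\<lbrakk>x \<in> carrier A; y \<in> carrier A; u \<in> carrier A; v \<in> carrier A\<rbrakk>
    \<Longrightarrow> (x \<oplus> y) \<ominus> (u \<oplus> v) = (x \<ominus> u) \<oplus> (y \<ominus> v)"
  by (simp add: diff_as_scale scale_add a_ac)

lemma norm_minus_commute:
  assumes "x \<in> carrier A" "y \<in> carrier A" shows "cnorm A (x \<ominus> y) = cnorm A (y \<ominus> x)"
  using assms Metric_space.commute[OF Metric_space_cdist, of x y] by (simp add: cdist_def)

lemma norm_diff_triangle:
  "\<lbrakk>x \<in> carrier A; y \<in> carrier A; z \<in> carrier A\<rbrakk> \<Longrightarrow> cnorm A (x \<ominus> z) \<le> cnorm A (x \<ominus> y) + cnorm A (y \<ominus> z)"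
  by (metis diff_add_diff minus_closed norm_triangle)

lemma norm_triangle_diff: "\<lbrakk>x \<in> carrier A; y \<in> carrier A\<rbrakk> \<Longrightarrow> cnorm A (x \<ominus> y) \<le> cnorm A x + cnorm A y"
  using norm_triangle[of x "cscale A (-1) y"] by (simp add: diff_as_scale norm_scale)

lemma norm_le_add_diff: "\<lbrakk>x \<in> carrier A; y \<in> carrier A\<rbrakk> \<Longrightarrow> cnorm A x \<le> cnorm A y + cnorm A (x \<ominus> y)"
  using norm_triangle[of y "x \<ominus> y"] by (simp add: add_diff_cancel_left)

lemma norm_scale_real: "x \<in> carrier A \<Longrightarrow> cnorm A (cscale A (of_real r) x) = \<bar>r\<bar> * cnorm A x"
  by (simp add: norm_scale)

lemma norm_adj [simp]:
  assumes "x \<in> carrier A" shows "cnorm A (cadj A x) = cnorm A x"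
proof -
  have bound: "cnorm A y \<le> cnorm A (cadj A y)" if y: "y \<in> carrier A" for y
  proof (cases "cnorm A y = 0")
    case False
    have "cnorm A y * cnorm A y \<le> cnorm A (cadj A y) * cnorm A y"
      using norm_adj_mult[OF y] norm_mult[of "cadj A y" y] y by (simp add: power2_eq_square)
    then show ?thesis
      using False norm_nonneg[OF y] by (simp add: mult_le_cancel_right)
  qed (use y norm_nonneg[of "cadj A y"] in auto)
  show ?thesis
    using bound[OF assms] bound[of "cadj A x"] assms by simp
qed

lemma norm_selfadjoint_square: "selfadjoint A x \<Longrightarrow> cnorm A (x \<otimes> x) = (cnorm A x)\<^sup>2"
  using norm_adj_mult[of x] by (simp add: selfadjoint_def)

lemma norm_projection_le_1:
  assumes "projection A p" shows "cnorm A p \<le> 1"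
proof -
  have "cnorm A p = (cnorm A p)\<^sup>2"
    using norm_selfadjoint_square[of p] assms by (simp add: projection_def)
  then have "cnorm A p = 0 \<or> cnorm A p = 1"
    by (simp add: power2_eq_square)
  then show ?thesis
    by auto
qed

lemma norm_projection_compression_le:
  assumes p: "projection A p" and q: "projection A q" and x: "x \<in> carrier A"
  shows "cnorm A (p \<otimes> (x \<otimes> q)) \<le> cnorm A x"
proof -
  note p' = projectionD(2)[OF p] and q' = projectionD(2)[OF q]
  have "cnorm A (p \<otimes> (x \<otimes> q)) \<le> cnorm A p * (cnorm A x * cnorm A q)"
    using norm_mult[of p "x \<otimes> q"] mult_left_mono[OF norm_mult[OF x q'] norm_nonneg[OF p']] p' q' x by simp
  also have "\<dots> \<le> 1 * (cnorm A x * 1)"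
    using norm_projection_le_1[OF p] norm_projection_le_1[OF q] p' q' x
    by (intro mult_mono mult_left_mono norm_nonneg mult_nonneg_nonneg) auto
  finally show ?thesis
    by simp
qed

lemma scale_eq_zero_iff: "x \<in> carrier A \<Longrightarrow> cscale A c x = \<zero> \<longleftrightarrow> c = 0 \<or> x = \<zero>"
  using norm_eq_0[of "cscale A c x"] norm_eq_0[of x] norm_scale[of x c] by simp

lemma eq_zero_if_norm_le_all:
  assumes x: "x \<in> carrier A" and bound: "\<And>e. 0 < e \<Longrightarrow> cnorm A x \<le> e" shows "x = \<zero>"
  using field_le_epsilon[of "cnorm A x" 0] bound norm_nonneg[OF x] norm_eq_0[OF x] by simp

lemma lipschitz_mult_right:
  "\<lbrakk>x \<in> carrier A; y \<in> carrier A; z \<in> carrier A\<rbrakk>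
    \<Longrightarrow> cnorm A (x \<otimes> z \<ominus> y \<otimes> z) \<le> cnorm A z * cnorm A (x \<ominus> y)"
  using norm_mult[of "x \<ominus> y" z] by (simp add: mult_diff_left mult.commute)

lemma lipschitz_mult_left:
  "\<lbrakk>x \<in> carrier A; y \<in> carrier A; z \<in> carrier A\<rbrakk>
    \<Longrightarrow> cnorm A (z \<otimes> x \<ominus> z \<otimes> y) \<le> cnorm A z * cnorm A (x \<ominus> y)"
  using norm_mult[of z "x \<ominus> y"] by (simp add: mult_diff_right)

lemma lipschitz_adj:
  "\<lbrakk>x \<in> carrier A; y \<in> carrier A\<rbrakk> \<Longrightarrow> cnorm A (cadj A x \<ominus> cadj A y) \<le> 1 * cnorm A (x \<ominus> y)"
  by (simp add: adj_diff[symmetric])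

subsection \<open>Finite sums\<close>

lemma finsum_mult_right:
  "\<lbrakk>finite F; f \<in> F \<rightarrow> carrier A; x \<in> carrier A\<rbrakk> \<Longrightarrow> finsum A f F \<otimes> x = finsum A (\<lambda>i. f i \<otimes> x) F"
  by (induction F rule: finite_induct) (auto simp: Pi_def distrib_right)

lemma finsum_mult_left:
  "\<lbrakk>finite F; f \<in> F \<rightarrow> carrier A; x \<in> carrier A\<rbrakk> \<Longrightarrow> x \<otimes> finsum A f F = finsum A (\<lambda>i. x \<otimes> f i) F"
  by (induction F rule: finite_induct) (auto simp: Pi_def distrib_left)

lemma finsum_scale:
  "\<lbrakk>finite F; f \<in> F \<rightarrow> carrier A\<rbrakk> \<Longrightarrow> cscale A c (finsum A f F) = finsum A (\<lambda>i. cscale A c (f i)) F"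
  by (induction F rule: finite_induct) (auto simp: Pi_def scale_add)

lemma finsum_scale_sum:
  "\<lbrakk>finite F; x \<in> carrier A\<rbrakk> \<Longrightarrow> finsum A (\<lambda>i. cscale A (f i) x) F = cscale A (sum f F) x"
  by (induction F rule: finite_induct) (auto simp: Pi_def add_scale)

lemma finsum_diff:
  "\<lbrakk>finite F; f \<in> F \<rightarrow> carrier A; g \<in> F \<rightarrow> carrier A\<rbrakk>
    \<Longrightarrow> finsum A f F \<ominus> finsum A g F = finsum A (\<lambda>i. f i \<ominus> g i) F"
  by (induction F rule: finite_induct) (auto simp: Pi_iff add_diff_add)

lemma norm_finsum:
  "\<lbrakk>finite F; f \<in> F \<rightarrow> carrier A\<rbrakk> \<Longrightarrow> cnorm A (finsum A f F) \<le> (\<Sum>i\<in>F. cnorm A (f i))"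
proof (induction F rule: finite_induct)
  case (insert i F)
  then have "cnorm A (finsum A f (insert i F)) \<le> cnorm A (f i) + cnorm A (finsum A f F)"
    by (simp add: Pi_def norm_triangle)
  then show ?case
    using insert by (auto simp: Pi_def)
qed simp

lemma finsum_single:
  assumes "finite F" "i \<in> F" "f i \<in> carrier A" "\<And>j. j \<in> F \<Longrightarrow> j \<noteq> i \<Longrightarrow> f j = \<zero>"
  shows "finsum A f F = f i"
proof -
  have "finsum A f F = finsum A (\<lambda>j. if i = j then f j else \<zero>) F"
    using assms by (intro finsum_cong') auto
  also have "\<dots> = f i"
    using assms by (intro finsum_singleton) (metis (no_types) Pi_I zero_closed)+
  finally show ?thesis .
qed

lemma finsum_swap:
  assumes "finite F" "finite H" "\<And>i j. i \<in> F \<Longrightarrow> j \<in> H \<Longrightarrow> f i j \<in> carrier A"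
  shows "finsum A (\<lambda>i. finsum A (f i) H) F = finsum A (\<lambda>j. finsum A (\<lambda>i. f i j) F) H"
  using assms(1,3)
proof (induction F rule: finite_induct)
  case (insert i F)
  then have "finsum A (\<lambda>i. finsum A (f i) H) (insert i F)
      = finsum A (f i) H \<oplus> finsum A (\<lambda>j. finsum A (\<lambda>i. f i j) F) H"
    by (subst finsum_insert) (auto intro!: finsum_closed)
  also have "\<dots> = finsum A (\<lambda>j. f i j \<oplus> finsum A (\<lambda>i. f i j) F) H"
    using insert by (subst finsum_addf) (auto intro!: finsum_closed)
  also have "\<dots> = finsum A (\<lambda>j. finsum A (\<lambda>i. f i j) (insert i F)) H"
    using insert by (intro finsum_cong') (auto intro!: finsum_closed simp: Pi_def)
  finally show ?case .
qed simp

subsection \<open>Limits of sequences\<close>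

lemma clim_unique:
  assumes "clim A f x" "clim A f y" shows "x = y"
proof -
  note limits = climD[OF assms(1)] climD[OF assms(2)]
  have "(\<lambda>n. cnorm A (f n \<ominus> x) + cnorm A (f n \<ominus> y)) \<longlonglongrightarrow> 0 + 0"
    using limits by (intro tendsto_add)
  moreover have "cnorm A (x \<ominus> y) \<le> cnorm A (f n \<ominus> x) + cnorm A (f n \<ominus> y)" for n
    using norm_diff_triangle[of x "f n" y] norm_minus_commute[of x "f n"] limits by simp
  ultimately have "cnorm A (x \<ominus> y) \<le> 0"
    by (intro LIMSEQ_le_const) auto
  then show ?thesis
    using limits norm_nonneg[of "x \<ominus> y"] norm_eq_0[of "x \<ominus> y"] by (simp add: diff_eq_zero_iff)
qed

lemma climI_bound:
  assumes f: "\<And>n. f n \<in> carrier A" and x: "x \<in> carrier A"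
    and bound: "\<And>n. cnorm A (f n \<ominus> x) \<le> b n" and b: "b \<longlonglongrightarrow> 0"
  shows "clim A f x"
proof -
  have "(\<lambda>n. cnorm A (f n \<ominus> x)) \<longlonglongrightarrow> 0"
    using f x by (intro tendsto_sandwich[OF _ _ tendsto_const b] always_eventually allI bound norm_nonneg) simp
  then show ?thesis
    using f x by (simp add: clim_def)
qed

lemma clim_add:
  assumes "clim A f x" "clim A g y" shows "clim A (\<lambda>n. f n \<oplus> g n) (x \<oplus> y)"
proof (rule climI_bound)
  note limits = climD[OF assms(1)] climD[OF assms(2)]
  show "f n \<oplus> g n \<in> carrier A" "x \<oplus> y \<in> carrier A" for n
    using limits by simp_all
  show "cnorm A ((f n \<oplus> g n) \<ominus> (x \<oplus> y)) \<le> cnorm A (f n \<ominus> x) + cnorm A (g n \<ominus> y)" for n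
    using limits by (simp add: add_diff_add norm_triangle)
  show "(\<lambda>n. cnorm A (f n \<ominus> x) + cnorm A (g n \<ominus> y)) \<longlonglongrightarrow> 0"
    using tendsto_add[OF limits(3) limits(6)] by simp
qed

lemma clim_lipschitz:
  assumes B: "cstar_algebra B" and f: "clim A f x" and g: "\<And>x. x \<in> carrier A \<Longrightarrow> g x \<in> carrier B"
    and lip: "\<And>x y. x \<in> carrier A \<Longrightarrow> y \<in> carrier A \<Longrightarrow> cnorm B (g x \<ominus>\<^bsub>B\<^esub> g y) \<le> K * cnorm A (x \<ominus> y)"
  shows "clim B (\<lambda>n. g (f n)) (g x)"
  using climD[OF f] g lip tendsto_mult_right_zero
  by (intro cstar_algebra.climI_bound[OF B, where b = "\<lambda>n. K * cnorm A (f n \<ominus> x)"]) auto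

lemma clim_scale: "clim A f x \<Longrightarrow> clim A (\<lambda>n. cscale A c (f n)) (cscale A c x)"
  by (rule clim_lipschitz[where K = "cmod c"])
    (auto simp: scale_diff[symmetric] norm_scale intro: cstar_algebra_axioms)

lemma clim_mult_left: "clim A f x \<Longrightarrow> a \<in> carrier A \<Longrightarrow> clim A (\<lambda>n. a \<otimes> f n) (a \<otimes> x)"
  by (rule clim_lipschitz[where K = "cnorm A a"]) (auto intro: cstar_algebra_axioms lipschitz_mult_left)

lemma clim_mult_right: "clim A f x \<Longrightarrow> a \<in> carrier A \<Longrightarrow> clim A (\<lambda>n. f n \<otimes> a) (x \<otimes> a)"
  by (rule clim_lipschitz[where K = "cnorm A a"]) (auto intro: cstar_algebra_axioms lipschitz_mult_right)

lemma clim_norm_diff_le: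
  assumes f: "clim A f x" and y: "y \<in> carrier A" and bound: "\<And>n. n \<ge> N \<Longrightarrow> cnorm A (y \<ominus> f n) \<le> K"
  shows "cnorm A (y \<ominus> x) \<le> K"
proof -
  note limits = climD[OF f]
  have "(\<lambda>n. K + cnorm A (f n \<ominus> x)) \<longlonglongrightarrow> K + 0"
    by (intro tendsto_intros limits)
  moreover have "cnorm A (y \<ominus> x) \<le> K + cnorm A (f n \<ominus> x)" if "n \<ge> N" for n
    using norm_diff_triangle[of y "f n" x] limits y bound[OF that] by simp
  ultimately show ?thesis
    by (intro LIMSEQ_le_const) auto
qed

lemma clim_norm_le:
  assumes f: "clim A f x" and bound: "\<And>n. n \<ge> N \<Longrightarrow> cnorm A (f n) \<le> K" shows "cnorm A x \<le> K"
  using clim_norm_diff_le[OF f zero_closed, of N K] climD[OF f] bound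
  by (simp add: norm_minus_commute[of \<zero>])

lemma clim_iff_limitin:
  "clim A f x \<longleftrightarrow> range f \<subseteq> carrier A \<and> limitin (ctopology A) f x sequentially"
proof -
  interpret m: Metric_space "carrier A" "cdist A"
    by (rule Metric_space_cdist)
  show ?thesis
    unfolding ctopology_def m.limitin_metric_dist_null
    by (auto simp: clim_def cdist_def image_subset_iff cong: conj_cong)
qed

lemma cCauchy_iff_MCauchy: "cCauchy A f \<longleftrightarrow> Metric_space.MCauchy (carrier A) (cdist A) f"
  unfolding Metric_space.MCauchy_def[OF Metric_space_cdist] cCauchy_def
  by (auto simp: cdist_def image_subset_iff cong: conj_cong)

lemma cCauchy_converges:
  assumes "cCauchy A f" obtains x where "clim A f x"
proof -
  interpret m: Metric_space "carrier A" "cdist A"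
    by (rule Metric_space_cdist)
  obtain x where "limitin m.mtopology f x sequentially"
    using assms complete unfolding cCauchy_iff_MCauchy m.mcomplete_def by blast
  then show ?thesis
    using that assms by (auto simp: clim_iff_limitin ctopology_def cCauchy_def)
qed

lemma clim_imp_cCauchy: "clim A f x \<Longrightarrow> cCauchy A f"
  unfolding cCauchy_iff_MCauchy clim_iff_limitin ctopology_def
  using Metric_space.convergent_imp_MCauchy[OF Metric_space_cdist] by blast

subsection \<open>Closed sets\<close>

lemma in_closure_iff:
  assumes "S \<subseteq> carrier A"
  shows "x \<in> ctopology A closure_of S \<longleftrightarrow> x \<in> carrier A \<and> (\<forall>e>0. \<exists>y\<in>S. cnorm A (x \<ominus> y) < e)"
proof -
  interpret m: Metric_space "carrier A" "cdist A"
    by (rule Metric_space_cdist)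
  have "m.mtopology closure_of S = {x \<in> carrier A. \<forall>e>0. \<exists>y\<in>S. cnorm A (x \<ominus> y) < e}"
    using assms unfolding m.metric_closure_of by (fastforce simp: cdist_def)
  then show ?thesis
    by (simp add: ctopology_def)
qed

lemma in_closure_obtains_clim:
  assumes S: "S \<subseteq> carrier A" and x: "x \<in> ctopology A closure_of S"
  obtains f where "\<And>n. f n \<in> S" "clim A f x"
proof -
  have x_closed: "x \<in> carrier A" and ex: "\<And>e. e > 0 \<Longrightarrow> \<exists>y\<in>S. cnorm A (x \<ominus> y) < e"
    using assms by (auto simp: in_closure_iff)
  have "\<exists>y\<in>S. cnorm A (x \<ominus> y) < inverse (real (Suc n))" for n
    by (intro ex) simp
  then obtain f where f: "\<And>n. f n \<in> S" "\<And>n. cnorm A (x \<ominus> f n) < inverse (real (Suc n))"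
    by metis
  have f_closed: "f n \<in> carrier A" for n
    using f(1) S by blast
  have "clim A f x"
    using f(2) f_closed x_closed LIMSEQ_inverse_real_of_nat
    by (intro climI_bound) (auto simp: norm_minus_commute[of _ x] less_imp_le)
  then show ?thesis
    using that f(1) by blast
qed

lemma clim_in_closure:
  assumes S: "S \<subseteq> carrier A" and f: "\<And>n. f n \<in> S" and lim: "clim A f x"
  shows "x \<in> ctopology A closure_of S"
  unfolding in_closure_iff[OF S]
proof (intro conjI allI impI)
  show x_closed: "x \<in> carrier A"
    using lim by (rule climD)
  fix e :: real assume "e > 0"
  then obtain n where "cnorm A (f n \<ominus> x) < e"
    using order_tendstoD(2)[OF climD(3)[OF lim]] eventually_happens by force
  then show "\<exists>y\<in>S. cnorm A (x \<ominus> y) < e"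
    using f x_closed climD(1)[OF lim] norm_minus_commute by metis
qed

lemma closedin_iff_clim:
  "closedin (ctopology A) S \<longleftrightarrow> S \<subseteq> carrier A \<and> (\<forall>f x. (\<forall>n. f n \<in> S) \<longrightarrow> clim A f x \<longrightarrow> x \<in> S)"
proof -
  interpret m: Metric_space "carrier A" "cdist A"
    by (rule Metric_space_cdist)
  show ?thesis
    unfolding ctopology_def m.metric_closedin_iff_sequentially_closed
    by (auto simp: clim_iff_limitin ctopology_def image_subset_iff) blast
qed

lemma closedin_clim: "\<lbrakk>closedin (ctopology A) S; \<And>n. f n \<in> S; clim A f x\<rbrakk> \<Longrightarrow> x \<in> S"
  unfolding closedin_iff_clim by blast

lemma closedin_subset_carrier: "closedin (ctopology A) S \<Longrightarrow> S \<subseteq> carrier A"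
  by (simp add: closedin_iff_clim)

lemma subset_closure: "S \<subseteq> carrier A \<Longrightarrow> S \<subseteq> ctopology A closure_of S"
  by (force simp: in_closure_iff)

lemma closedin_lipschitz_preimage:
  assumes B: "cstar_algebra B" and S: "closedin (ctopology B) S"
    and f: "\<And>x. x \<in> carrier A \<Longrightarrow> f x \<in> carrier B"
    and lip: "\<And>x y. x \<in> carrier A \<Longrightarrow> y \<in> carrier A \<Longrightarrow> cnorm B (f x \<ominus>\<^bsub>B\<^esub> f y) \<le> K * cnorm A (x \<ominus> y)"
  shows "closedin (ctopology A) {x \<in> carrier A. f x \<in> S}"
  unfolding closedin_iff_clim
proof (intro conjI allI impI)
  fix u x assume u: "\<forall>n. u n \<in> {x \<in> carrier A. f x \<in> S}" and x: "clim A u x"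
  have lim: "clim B (\<lambda>n. f (u n)) (f x)"
    using B x f lip by (rule clim_lipschitz)
  have "f x \<in> S"
    using u by (intro cstar_algebra.closedin_clim[OF B S _ lim]) simp
  then show "x \<in> {x \<in> carrier A. f x \<in> S}"
    using climD(2)[OF x] by simp
qed auto

lemma closedin_equaliser:
  assumes f: "\<And>x. x \<in> carrier A \<Longrightarrow> f x \<in> carrier A" and g: "\<And>x. x \<in> carrier A \<Longrightarrow> g x \<in> carrier A"
    and lipschitz_f: "\<And>x y. x \<in> carrier A \<Longrightarrow> y \<in> carrier A \<Longrightarrow> cnorm A (f x \<ominus> f y) \<le> K * cnorm A (x \<ominus> y)"
    and lipschitz_g: "\<And>x y. x \<in> carrier A \<Longrightarrow> y \<in> carrier A \<Longrightarrow> cnorm A (g x \<ominus> g y) \<le> L * cnorm A (x \<ominus> y)"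
  shows "closedin (ctopology A) {x \<in> carrier A. f x = g x}"
  unfolding closedin_iff_clim
proof (intro conjI allI impI)
  fix u x assume u: "\<forall>n. u n \<in> {x \<in> carrier A. f x = g x}" and x: "clim A u x"
  have "clim A (\<lambda>n. f (u n)) (f x)" "clim A (\<lambda>n. g (u n)) (g x)"
    using clim_lipschitz[OF cstar_algebra_axioms x] f g lipschitz_f lipschitz_g by blast+
  then have "f x = g x"
    using u by (simp add: clim_unique)
  then show "x \<in> {x \<in> carrier A. f x = g x}"
    using climD(2)[OF x] by simp
qed auto

lemma closedin_norm_le: "closedin (ctopology A) {x \<in> carrier A. cnorm A x \<le> r}"
  unfolding closedin_iff_clim
proof (intro conjI allI impI)
  fix f x assume f: "\<forall>n. f n \<in> {x \<in> carrier A. cnorm A x \<le> r}" and x: "clim A f x"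
  then have "cnorm A x \<le> r"
    by (intro clim_norm_le[OF x, of 0]) simp
  then show "x \<in> {x \<in> carrier A. cnorm A x \<le> r}"
    using climD(2)[OF x] by simp
qed auto

lemma contraction_fixpoint:
  assumes S: "closedin (ctopology A) S" "S \<noteq> {}" and f: "\<And>x. x \<in> S \<Longrightarrow> f x \<in> S" and r: "r < 1"
    and contr: "\<And>x y. x \<in> S \<Longrightarrow> y \<in> S \<Longrightarrow> cnorm A (f x \<ominus> f y) \<le> r * cnorm A (x \<ominus> y)"
  obtains x where "x \<in> S" "f x = x"
proof -
  have S_subset: "S \<subseteq> carrier A"
    using S(1) by (rule closedin_subset_carrier)
  interpret m: Metric_space "carrier A" "cdist A"
    by (rule Metric_space_cdist)
  interpret Submetric "carrier A" "cdist A" S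
    using S_subset by unfold_locales
  have "sub.mcomplete"
    using S(1) complete by (intro closedin_mcomplete_imp_mcomplete) (auto simp: ctopology_def)
  moreover have "cdist A (f x) (f y) \<le> r * cdist A x y" if "x \<in> S" "y \<in> S" for x y
    using contr[OF that] that f S_subset by (simp add: cdist_def subset_iff)
  moreover have "f \<in> S \<rightarrow> S"
    using f by blast
  ultimately show ?thesis
    using sub.Banach_fixedpoint_thm[OF _ S(2) _ r] that by blast
qed

subsection \<open>Linear spans\<close>

lemma subspaceD:
  assumes "linear_subspace A S"
  shows "S \<subseteq> carrier A" "\<zero> \<in> S" "\<And>x y. x \<in> S \<Longrightarrow> y \<in> S \<Longrightarrow> x \<oplus> y \<in> S"
    "\<And>c x. x \<in> S \<Longrightarrow> cscale A c x \<in> S"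
  using assms by (auto simp: linear_subspace_def)

lemma subspace_diff:
  assumes S: "linear_subspace A S" and "x \<in> S" "y \<in> S" shows "x \<ominus> y \<in> S"
proof -
  have "x \<oplus> cscale A (-1) y \<in> S"
    using assms by (intro subspaceD)
  then show ?thesis
    using subsetD[OF subspaceD(1)[OF S] assms(3)] by (simp add: diff_as_scale)
qed

lemma linear_subspace_carrier: "linear_subspace A (carrier A)"
  by (simp add: linear_subspace_def)

lemma linear_span_subspace: "X \<subseteq> carrier A \<Longrightarrow> linear_subspace A (linear_span A X)"
  unfolding linear_span_def linear_subspace_def by blast

lemma subset_linear_span: "X \<subseteq> linear_span A X"
  by (auto simp: linear_span_def)

lemma linear_span_minimal: "linear_subspace A S \<Longrightarrow> X \<subseteq> S \<Longrightarrow> linear_span A X \<subseteq> S"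
  by (auto simp: linear_span_def)

lemma linear_span_mono: "X \<subseteq> Y \<Longrightarrow> linear_span A X \<subseteq> linear_span A Y"
  by (auto simp: linear_span_def)

lemma linear_span_subset_carrier: "X \<subseteq> carrier A \<Longrightarrow> linear_span A X \<subseteq> carrier A"
  using linear_span_minimal linear_subspace_carrier by blast

lemma linear_span_induct [consumes 2, case_names base zero add scale]:
  assumes "x \<in> linear_span A X" "X \<subseteq> carrier A"
    and "\<And>x. x \<in> X \<Longrightarrow> P x" "P \<zero>"
    and "\<And>x y. x \<in> linear_span A X \<Longrightarrow> y \<in> linear_span A X \<Longrightarrow> P x \<Longrightarrow> P y \<Longrightarrow> P (x \<oplus> y)"
    and "\<And>c x. x \<in> linear_span A X \<Longrightarrow> P x \<Longrightarrow> P (cscale A c x)"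
  shows "P x"
proof -
  note span = subspaceD[OF linear_span_subspace[OF assms(2)]]
  have "linear_subspace A {x \<in> linear_span A X. P x}"
    unfolding linear_subspace_def using span assms(4-6) by auto
  then have "linear_span A X \<subseteq> {x \<in> linear_span A X. P x}"
    by (rule linear_span_minimal) (use assms(3) subset_linear_span in auto)
  then show ?thesis
    using assms(1) by blast
qed

lemma finsum_in_subspace:
  assumes S: "linear_subspace A S" and "finite F" "f \<in> F \<rightarrow> S" shows "finsum A f F \<in> S"
  using assms(2,3)
proof (induction F rule: finite_induct)
  case (insert i F)
  then have "f \<in> F \<rightarrow> carrier A" "f i \<in> carrier A"
    using subspaceD(1)[OF S] by auto
  then show ?case
    using insert subspaceD(3)[OF S] by (simp add: Pi_def)
qed (use subspaceD(2)[OF S] in simp)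

lemma finsum_mult_finsum_in_subspace:
  assumes S: "linear_subspace A S" and F: "finite F" "f \<in> F \<rightarrow> carrier A"
    and H: "finite H" "g \<in> H \<rightarrow> carrier A" and mem: "\<And>i j. i \<in> F \<Longrightarrow> j \<in> H \<Longrightarrow> f i \<otimes> g j \<in> S"
  shows "finsum A f F \<otimes> finsum A g H \<in> S"
proof -
  have "finsum A f F \<otimes> finsum A g H = finsum A (\<lambda>i. f i \<otimes> finsum A g H) F"
    using F H by (intro finsum_mult_right finsum_closed) auto
  also have "\<dots> \<in> S"
  proof (rule finsum_in_subspace[OF S F(1)], rule Pi_I)
    fix i assume i: "i \<in> F"
    then have "f i \<otimes> finsum A g H = finsum A (\<lambda>j. f i \<otimes> g j) H"
      using F H by (intro finsum_mult_left) auto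
    then show "f i \<otimes> finsum A g H \<in> S"
      using finsum_in_subspace[OF S H(1)] mem[OF i] by simp
  qed
  finally show ?thesis .
qed

lemma linear_span_mult:
  assumes X: "X \<subseteq> carrier A" and Y: "Y \<subseteq> carrier A" and S: "linear_subspace A S"
    and XY: "\<And>x y. x \<in> X \<Longrightarrow> y \<in> Y \<Longrightarrow> x \<otimes> y \<in> S"
    and x: "x \<in> linear_span A X" and y: "y \<in> linear_span A Y"
  shows "x \<otimes> y \<in> S"
proof -
  note span = linear_span_subset_carrier[OF X] linear_span_subset_carrier[OF Y]
  have x_mult: "x \<otimes> b \<in> S" if b: "b \<in> Y" for b
    using x X
  proof (induction rule: linear_span_induct)
    case (add u v) then show ?case using subspaceD[OF S] span Y b by (simp add: distrib_right subset_iff)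
  next
    case (scale c u) then show ?case using subspaceD[OF S] span Y b by (simp add: scale_mult_left subset_iff)
  qed (use XY b subspaceD[OF S] Y in auto)
  show ?thesis
    using y Y
  proof (induction rule: linear_span_induct)
    case (add u v) then show ?case using subspaceD[OF S] span x by (simp add: distrib_left subset_iff)
  next
    case (scale c u) then show ?case using subspaceD[OF S] span x by (simp add: scale_mult_right subset_iff)
  qed (use x_mult subspaceD[OF S] x span in auto)
qed

lemma linear_span_adj:
  assumes X: "X \<subseteq> carrier A" and S: "linear_subspace A S"
    and "\<And>x. x \<in> X \<Longrightarrow> cadj A x \<in> S" and x: "x \<in> linear_span A X"
  shows "cadj A x \<in> S"
  using x X
proof (induction rule: linear_span_induct)
  case (add u v) then show ?case
    using subspaceD[OF S] linear_span_subset_carrier[OF X] by (simp add: adj_add subset_iff)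
next
  case (scale c u) then show ?case
    using subspaceD[OF S] linear_span_subset_carrier[OF X] by (simp add: adj_scale subset_iff)
qed (use assms subspaceD[OF S] in auto)

lemma linear_combinations_subspace:
  assumes F: "finite F" and T: "T \<in> F \<rightarrow> carrier A"
  shows "linear_subspace A (range (\<lambda>c. finsum A (\<lambda>i. cscale A (c i) (T i)) F))"
proof -
  define comb where "comb c = finsum A (\<lambda>i. cscale A (c i) (T i)) F" for c
  have terms: "(\<lambda>i. cscale A (c i) (T i)) \<in> F \<rightarrow> carrier A" for c
    using T by (auto simp: Pi_iff)
  have comb_zero: "\<zero> = comb (\<lambda>_. 0)"
    unfolding comb_def using T by (intro add.finprod_one_eqI[symmetric]) (auto simp: Pi_iff)
  have comb_scale: "cscale A c (comb a) = comb (\<lambda>i. c * a i)" for a c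
    unfolding comb_def finsum_scale[OF F terms[of a]]
    using T by (intro finsum_cong') (auto simp: Pi_iff)
  have comb_add: "comb a \<oplus> comb b = comb (\<lambda>i. a i + b i)" for a b
    unfolding comb_def finsum_addf[OF terms[of a] terms[of b], symmetric]
    using T by (intro finsum_cong') (auto simp: add_scale Pi_iff)
  have "comb c \<in> carrier A" for c
    unfolding comb_def using terms by (rule finsum_closed)
  then have "linear_subspace A (range comb)"
    unfolding linear_subspace_def using comb_zero comb_scale comb_add by auto
  then show ?thesis
    by (simp add: comb_def[abs_def])
qed

lemma in_linear_span_finite_image:
  assumes F: "finite F" and T: "T \<in> F \<rightarrow> carrier A" and x: "x \<in> linear_span A (T ` F)"
  obtains c where "x = finsum A (\<lambda>i. cscale A (c i) (T i)) F"
proof -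
  have "T ` F \<subseteq> range (\<lambda>c. finsum A (\<lambda>i. cscale A (c i) (T i)) F)"
  proof (rule image_subsetI)
    fix i assume i: "i \<in> F"
    have "finsum A (\<lambda>j. cscale A (of_bool (j = i)) (T j)) F = cscale A (of_bool (i = i)) (T i)"
      using F T i by (intro finsum_single) (auto simp: Pi_iff)
    then have "T i = finsum A (\<lambda>j. cscale A (of_bool (j = i)) (T j)) F"
      using i T by (auto simp: Pi_iff)
    then show "T i \<in> range (\<lambda>c. finsum A (\<lambda>i. cscale A (c i) (T i)) F)"
      by (intro range_eqI[where x = "\<lambda>j. of_bool (j = i)"])
  qed
  then show ?thesis
    using linear_span_minimal[OF linear_combinations_subspace[OF F T]] x that by blast
qed

lemma closure_subspace:
  assumes S: "linear_subspace A S" shows "linear_subspace A (ctopology A closure_of S)"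
proof -
  note closure = clim_in_closure[OF subspaceD(1)[OF S]]
    and approximated = in_closure_obtains_clim[OF subspaceD(1)[OF S]]
  have "x \<oplus> y \<in> ctopology A closure_of S"
    if x: "x \<in> ctopology A closure_of S" and y: "y \<in> ctopology A closure_of S" for x y
  proof -
    obtain f where f: "\<And>n. f n \<in> S" "clim A f x"
      using approximated[OF x] by blast
    obtain g where g: "\<And>n. g n \<in> S" "clim A g y"
      using approximated[OF y] by blast
    show ?thesis
      using f g by (intro closure[OF _ clim_add] subspaceD(3)[OF S])
  qed
  moreover have "cscale A c x \<in> ctopology A closure_of S" if x: "x \<in> ctopology A closure_of S" for c x
  proof -
    obtain f where f: "\<And>n. f n \<in> S" "clim A f x"
      using approximated[OF x] by blast
    then show ?thesis
      by (intro closure[OF _ clim_scale] subspaceD(4)[OF S])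
  qed
  ultimately show ?thesis
    using subset_closure[OF subspaceD(1)[OF S]] subspaceD(2)[OF S] closedin_subset_carrier[OF closedin_closure_of]
    unfolding linear_subspace_def by blast
qed

lemma closed_span_subspace: "X \<subseteq> carrier A \<Longrightarrow> linear_subspace A (closed_span A X)"
  unfolding closed_span_def by (intro closure_subspace linear_span_subspace)

lemma closed_span_closed: "closedin (ctopology A) (closed_span A X)"
  unfolding closed_span_def by (rule closedin_closure_of)

lemma closed_span_subset_carrier: "closed_span A X \<subseteq> carrier A"
  using closed_span_closed closedin_subset_carrier by blast

lemma linear_span_subset_closed_span: "X \<subseteq> carrier A \<Longrightarrow> linear_span A X \<subseteq> closed_span A X"
  unfolding closed_span_def by (intro subset_closure linear_span_subset_carrier)

lemma subset_closed_span: "X \<subseteq> carrier A \<Longrightarrow> X \<subseteq> closed_span A X"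
  using linear_span_subset_closed_span subset_linear_span by blast

lemma closed_span_minimal:
  "linear_subspace A S \<Longrightarrow> closedin (ctopology A) S \<Longrightarrow> X \<subseteq> S \<Longrightarrow> closed_span A X \<subseteq> S"
  unfolding closed_span_def by (intro closure_of_minimal linear_span_minimal)

lemma closed_span_approx:
  assumes "x \<in> closed_span A X" "X \<subseteq> carrier A" "e > 0"
  obtains y where "y \<in> linear_span A X" "cnorm A (x \<ominus> y) < e"
  using assms linear_span_subset_carrier[OF assms(2)] unfolding closed_span_def
  by (auto simp: in_closure_iff)

lemma closed_span_mult:
  assumes X: "X \<subseteq> carrier A" and Y: "Y \<subseteq> carrier A"
    and S: "linear_subspace A S" "closedin (ctopology A) S"
    and XY: "\<And>x y. x \<in> X \<Longrightarrow> y \<in> Y \<Longrightarrow> x \<otimes> y \<in> S"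
    and x: "x \<in> closed_span A X" and y: "y \<in> closed_span A Y"
  shows "x \<otimes> y \<in> S"
proof -
  have x_closed: "x \<in> carrier A"
    using x closed_span_subset_carrier by blast
  have "closed_span A X \<subseteq> {u \<in> carrier A. u \<otimes> b \<in> S}" if b: "b \<in> Y" for b
  proof (rule closed_span_minimal)
    have b_closed: "b \<in> carrier A"
      using b Y by blast
    then show "linear_subspace A {u \<in> carrier A. u \<otimes> b \<in> S}"
      unfolding linear_subspace_def using subspaceD[OF S(1)] by (auto simp: distrib_right scale_mult_left)
    show "closedin (ctopology A) {u \<in> carrier A. u \<otimes> b \<in> S}"
      using b_closed lipschitz_mult_right
      by (intro closedin_lipschitz_preimage[OF cstar_algebra_axioms S(2), where K = "cnorm A b"]) auto
  qed (use X XY b in auto)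
  then have x_mult: "x \<otimes> b \<in> S" if "b \<in> Y" for b
    using x that by blast
  have "closed_span A Y \<subseteq> {u \<in> carrier A. x \<otimes> u \<in> S}"
  proof (rule closed_span_minimal)
    show "linear_subspace A {u \<in> carrier A. x \<otimes> u \<in> S}"
      unfolding linear_subspace_def using subspaceD[OF S(1)] x_closed by (auto simp: distrib_left scale_mult_right)
    show "closedin (ctopology A) {u \<in> carrier A. x \<otimes> u \<in> S}"
      using x_closed lipschitz_mult_left
      by (intro closedin_lipschitz_preimage[OF cstar_algebra_axioms S(2), where K = "cnorm A x"]) auto
  qed (use Y x_mult in auto)
  then show ?thesis
    using y by blast
qed

lemma closed_span_adj:
  assumes X: "X \<subseteq> carrier A" and S: "linear_subspace A S" "closedin (ctopology A) S"
    and "\<And>x. x \<in> X \<Longrightarrow> cadj A x \<in> S" and x: "x \<in> closed_span A X"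
  shows "cadj A x \<in> S"
proof -
  have "closed_span A X \<subseteq> {u \<in> carrier A. cadj A u \<in> S}"
  proof (rule closed_span_minimal)
    show "linear_subspace A {u \<in> carrier A. cadj A u \<in> S}"
      unfolding linear_subspace_def using subspaceD[OF S(1)] by (auto simp: adj_add adj_scale)
    show "closedin (ctopology A) {u \<in> carrier A. cadj A u \<in> S}"
      using lipschitz_adj
      by (intro closedin_lipschitz_preimage[OF cstar_algebra_axioms S(2), where K = 1]) auto
  qed (use X assms in auto)
  then show ?thesis
    using x by blast
qed

end

section \<open>Square roots and positivity without spectral theory\<close>

context cstar_algebra
begin

text \<open>Both \<open>y + i w\<close> and \<open>y - i w\<close> have squared norm \<open>\<parallel>y\<^sup>* y + w\<^sup>* w\<parallel>\<close>, and \<open>y\<close> is their mean.\<close>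

lemma norm_le_norm_sum_squares:
  assumes y: "y \<in> carrier A" and w: "w \<in> carrier A" and yw: "cadj A y \<otimes> w = cadj A w \<otimes> y"
  shows "(cnorm A y)\<^sup>2 \<le> cnorm A (cadj A y \<otimes> y \<oplus> cadj A w \<otimes> w)"
proof -
  define u where "u c = y \<oplus> cscale A c w" for c
  have u_closed: "u c \<in> carrier A" for c
    using y w by (simp add: u_def)
  have norm_u: "cnorm A (u c) = sqrt (cnorm A (cadj A y \<otimes> y \<oplus> cadj A w \<otimes> w))"
    if c: "c * cnj c = 1" "cnj c = - c" for c
  proof -
    let ?z = "cadj A w \<otimes> y"
    have "cadj A (u c) \<otimes> u c
        = (cadj A y \<otimes> y \<oplus> cscale A c ?z) \<oplus> (cscale A (- c) ?z \<oplus> cadj A w \<otimes> w)"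
      using y w c by (simp add: u_def adj_add adj_scale distrib_left distrib_right scale_mult_left
          scale_mult_right scale_add yw mult.commute a_ac)
    also have "\<dots> = cadj A y \<otimes> y \<oplus> ((cscale A c ?z \<oplus> cscale A (- c) ?z) \<oplus> cadj A w \<otimes> w)"
      using y w by (simp add: a_assoc)
    also have "cscale A c ?z \<oplus> cscale A (- c) ?z = \<zero>"
      using y w by (simp flip: add_scale)
    finally have "(cnorm A (u c))\<^sup>2 = cnorm A (cadj A y \<otimes> y \<oplus> cadj A w \<otimes> w)"
      using norm_adj_mult[OF u_closed[of c]] y w by simp
    then show ?thesis
      using norm_nonneg[OF u_closed[of c]] by (metis real_sqrt_unique)
  qed
  have "u \<i> \<oplus> u (- \<i>) = (y \<oplus> y) \<oplus> (cscale A \<i> w \<oplus> cscale A (- \<i>) w)"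
    using y w by (simp add: u_def a_ac)
  also have "\<dots> = cscale A 2 y"
    using y w add_scale[OF y, of 1 1] by (simp flip: add_scale)
  finally have "2 * cnorm A y \<le> cnorm A (u \<i>) + cnorm A (u (- \<i>))"
    using norm_scale[OF y, of 2] norm_triangle[OF u_closed u_closed, of \<i> "- \<i>"] by simp
  then have "cnorm A y \<le> sqrt (cnorm A (cadj A y \<otimes> y \<oplus> cadj A w \<otimes> w))"
    by (simp add: norm_u)
  then show ?thesis
    using norm_nonneg[OF y] y w real_le_rsqrt sqrt_ge_absD by (metis abs_of_nonneg)
qed

subsection \<open>Square roots near the unit\<close>

definition bicommutant_ball :: "'a \<Rightarrow> 'a set" where
  "bicommutant_ball b = {x. selfadjoint A x \<and> cnorm A x \<le> cnorm A b \<and>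
     (\<forall>y\<in>carrier A. y \<otimes> b = b \<otimes> y \<longrightarrow> y \<otimes> x = x \<otimes> y)}"

lemma closedin_bicommutant_ball:
  assumes b: "b \<in> carrier A" shows "closedin (ctopology A) (bicommutant_ball b)"
proof -
  define Y where "Y = {y \<in> carrier A. y \<otimes> b = b \<otimes> y}"
  have "closedin (ctopology A) {x \<in> carrier A. cadj A x = x}"
    by (rule closedin_equaliser[where K = 1 and L = 1]) (use lipschitz_adj in auto)
  moreover have "closedin (ctopology A) {x \<in> carrier A. y \<otimes> x = x \<otimes> y}" if "y \<in> Y" for y
    by (rule closedin_equaliser[where K = "cnorm A y" and L = "cnorm A y"])
      (use that lipschitz_mult_left lipschitz_mult_right in \<open>auto simp: Y_def\<close>)
  moreover have "b \<in> Y"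
    using b by (simp add: Y_def)
  ultimately have "closedin (ctopology A) ({x \<in> carrier A. cadj A x = x} \<inter>
      {x \<in> carrier A. cnorm A x \<le> cnorm A b} \<inter> (\<Inter>y\<in>Y. {x \<in> carrier A. y \<otimes> x = x \<otimes> y}))"
    using closedin_norm_le by (intro closedin_Int closedin_INT) auto
  moreover have "bicommutant_ball b = {x \<in> carrier A. cadj A x = x} \<inter>
      {x \<in> carrier A. cnorm A x \<le> cnorm A b} \<inter> (\<Inter>y\<in>Y. {x \<in> carrier A. y \<otimes> x = x \<otimes> y})"
    using b by (auto simp: bicommutant_ball_def selfadjoint_def Y_def)
  ultimately show ?thesis
    by simp
qed

lemma half_add_square_in_bicommutant_ball:
  assumes b: "selfadjoint A b" "cnorm A b \<le> 1" and x: "x \<in> bicommutant_ball b"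
  shows "cscale A (1/2) (b \<oplus> x \<otimes> x) \<in> bicommutant_ball b"
proof -
  have b_closed: "b \<in> carrier A" "cadj A b = b"
    using selfadjointD[OF b(1)] .
  have x_closed: "x \<in> carrier A" "cadj A x = x" "cnorm A x \<le> cnorm A b"
    and comm: "\<And>y. y \<in> carrier A \<Longrightarrow> y \<otimes> b = b \<otimes> y \<Longrightarrow> y \<otimes> x = x \<otimes> y"
    using x by (auto simp: bicommutant_ball_def selfadjoint_def)
  have "selfadjoint A (cscale A (1/2) (b \<oplus> x \<otimes> x))"
    using b_closed x_closed by (simp add: selfadjoint_def adj_scale adj_add adj_mult)
  moreover have "cnorm A (cscale A (1/2) (b \<oplus> x \<otimes> x)) \<le> cnorm A b"
  proof -
    have "cnorm A (x \<otimes> x) \<le> cnorm A x * cnorm A x"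
      using x_closed(1) by (intro norm_mult)
    also have "\<dots> \<le> cnorm A b * 1"
      using x_closed b(2) norm_nonneg[OF x_closed(1)] by (intro mult_mono) auto
    finally show ?thesis
      using b_closed x_closed norm_triangle[of b "x \<otimes> x"] by (simp add: norm_scale)
  qed
  moreover have "y \<otimes> cscale A (1/2) (b \<oplus> x \<otimes> x) = cscale A (1/2) (b \<oplus> x \<otimes> x) \<otimes> y"
    if y: "y \<in> carrier A" "y \<otimes> b = b \<otimes> y" for y
  proof -
    have "y \<otimes> (x \<otimes> x) = (x \<otimes> x) \<otimes> y"
      using x_closed(1) y comm[OF y] by (metis mult_assoc)
    then show ?thesis
      using b_closed x_closed y by (simp add: scale_mult_left scale_mult_right distrib_left distrib_right)
  qed
  ultimately show ?thesis
    by (simp add: bicommutant_ball_def)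
qed

lemma lipschitz_half_add_square:
  assumes b: "b \<in> carrier A" and x: "x \<in> carrier A" "cnorm A x \<le> r" and y: "y \<in> carrier A" "cnorm A y \<le> r"
  shows "cnorm A (cscale A (1/2) (b \<oplus> x \<otimes> x) \<ominus> cscale A (1/2) (b \<oplus> y \<otimes> y)) \<le> r * cnorm A (x \<ominus> y)"
proof -
  have "cscale A (1/2) (b \<oplus> x \<otimes> x) \<ominus> cscale A (1/2) (b \<oplus> y \<otimes> y) = cscale A (1/2) (x \<otimes> x \<ominus> y \<otimes> y)"
    using b x y by (simp add: scale_diff[symmetric] add_diff_add)
  moreover have "cnorm A (x \<otimes> x \<ominus> y \<otimes> y) \<le> cnorm A (x \<otimes> x \<ominus> x \<otimes> y) + cnorm A (x \<otimes> y \<ominus> y \<otimes> y)"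
    using x y by (intro norm_diff_triangle) auto
  moreover have "cnorm A (x \<otimes> x \<ominus> x \<otimes> y) \<le> r * cnorm A (x \<ominus> y)"
    using lipschitz_mult_left[OF x(1) y(1) x(1)] mult_right_mono[OF x(2), of "cnorm A (x \<ominus> y)"]
      norm_nonneg[of "x \<ominus> y"] x y by simp
  moreover have "cnorm A (x \<otimes> y \<ominus> y \<otimes> y) \<le> r * cnorm A (x \<ominus> y)"
    using lipschitz_mult_right[OF x(1) y(1) y(1)] mult_right_mono[OF y(2), of "cnorm A (x \<ominus> y)"]
      norm_nonneg[of "x \<ominus> y"] x y by simp
  ultimately show ?thesis
    using x y by (simp add: norm_scale)
qed

text \<open>With a formal unit, \<open>(1 - d)\<^sup>2 = 1 - b\<close>.\<close>

lemma selfadjoint_sqrt: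
  assumes b: "selfadjoint A b" "cnorm A b < 1"
  obtains d where "selfadjoint A d" "cscale A 2 d = b \<oplus> d \<otimes> d"
    "\<And>y. y \<in> carrier A \<Longrightarrow> y \<otimes> b = b \<otimes> y \<Longrightarrow> y \<otimes> d = d \<otimes> y"
proof -
  note b_closed = selfadjointD(1)[OF b(1)]
  define f where "f x = cscale A (1/2) (b \<oplus> x \<otimes> x)" for x
  obtain d where d: "d \<in> bicommutant_ball b" "f d = d"
  proof (rule contraction_fixpoint[OF closedin_bicommutant_ball[OF b_closed]])
    have "\<zero> \<in> bicommutant_ball b"
      using norm_nonneg[OF b_closed] by (simp add: bicommutant_ball_def selfadjoint_def)
    then show "bicommutant_ball b \<noteq> {}"
      by blast
    show "f x \<in> bicommutant_ball b" if "x \<in> bicommutant_ball b" for x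
      unfolding f_def using b that by (intro half_add_square_in_bicommutant_ball) auto
    show "cnorm A (f x \<ominus> f y) \<le> cnorm A b * cnorm A (x \<ominus> y)"
      if "x \<in> bicommutant_ball b" "y \<in> bicommutant_ball b" for x y
      unfolding f_def using that b_closed
      by (intro lipschitz_half_add_square) (auto simp: bicommutant_ball_def selfadjoint_def)
  qed (use b in auto)
  have d_selfadjoint: "selfadjoint A d" and comm: "\<And>y. y \<in> carrier A \<Longrightarrow> y \<otimes> b = b \<otimes> y \<Longrightarrow> y \<otimes> d = d \<otimes> y"
    using d(1) by (auto simp: bicommutant_ball_def)
  have "cscale A 2 (f d) = b \<oplus> d \<otimes> d"
    using b_closed selfadjointD(1)[OF d_selfadjoint] by (simp add: f_def)
  then have "cscale A 2 d = b \<oplus> d \<otimes> d"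
    by (simp only: d(2))
  then show ?thesis
    using d_selfadjoint comm that by blast
qed

lemma one_minus_sqrt_square:
  assumes d: "d \<in> carrier A" "cscale A 2 d = b \<oplus> d \<otimes> d" and b: "b \<in> carrier A"
    and x: "x \<in> carrier A" and y: "y \<in> carrier A"
  shows "(y \<ominus> y \<otimes> d) \<otimes> (x \<ominus> d \<otimes> x) = y \<otimes> x \<ominus> y \<otimes> (b \<otimes> x)"
proof -
  let ?dx = "y \<otimes> (d \<otimes> x)" and ?ddx = "y \<otimes> (d \<otimes> (d \<otimes> x))" and ?bx = "y \<otimes> (b \<otimes> x)"
  have "cscale A 2 ?dx = y \<otimes> (cscale A 2 d \<otimes> x)"
    by (simp only: scale_mult_left scale_mult_right d(1) x y mult_closed)
  also have "\<dots> = ?bx \<oplus> ?ddx"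
    using d b x y by (simp only: d(2)) (simp add: distrib_left distrib_right mult_assoc)
  finally have two_dx: "cscale A 2 ?dx = ?bx \<oplus> ?ddx" .
  have "(y \<ominus> y \<otimes> d) \<otimes> (x \<ominus> d \<otimes> x)
      = y \<otimes> x \<oplus> ((cscale A (-1) ?dx \<oplus> cscale A (-1) ?dx) \<oplus> ?ddx)"
    using d x y
    by (simp add: diff_as_scale distrib_left distrib_right scale_add scale_mult_left scale_mult_right
        mult_assoc a_assoc)
  also have "cscale A (-1) ?dx \<oplus> cscale A (-1) ?dx = cscale A (-1) (cscale A 2 ?dx)"
    using d x y by (simp flip: add_scale)
  also have "\<dots> \<oplus> ?ddx = cscale A (-1) ?bx \<oplus> (cscale A (-1) ?ddx \<oplus> cscale A 1 ?ddx)"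
    unfolding two_dx using d b x y by (simp add: scale_add a_assoc)
  also have "\<dots> = cscale A (-1) ?bx"
    using d b x y by (simp del: scale_one flip: add_scale)
  finally show ?thesis
    using d b x y by (simp add: diff_as_scale)
qed

text \<open>With a formal unit, \<open>a = h (1 - b)\<^bsup>1/2\<^esup>\<close>.\<close>

lemma weighted_sqrt:
  assumes h: "selfadjoint A h" and b: "selfadjoint A b" "cnorm A b < 1" and hb: "h \<otimes> b = b \<otimes> h"
  obtains a where "selfadjoint A a" "a \<otimes> a = h \<otimes> h \<ominus> h \<otimes> (b \<otimes> h)"
    "\<And>y. y \<in> carrier A \<Longrightarrow> y \<otimes> h = h \<otimes> y \<Longrightarrow> y \<otimes> b = b \<otimes> y \<Longrightarrow> y \<otimes> a = a \<otimes> y"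
proof -
  obtain d where d: "selfadjoint A d" "cscale A 2 d = b \<oplus> d \<otimes> d"
    and comm: "\<And>y. y \<in> carrier A \<Longrightarrow> y \<otimes> b = b \<otimes> y \<Longrightarrow> y \<otimes> d = d \<otimes> y"
    using selfadjoint_sqrt[OF b] by blast
  note closed = selfadjointD[OF h] selfadjointD[OF b(1)] selfadjointD[OF d(1)]
  have hd: "h \<otimes> d = d \<otimes> h"
    using comm[OF closed(1) hb] .
  show ?thesis
  proof (rule that)
    show "selfadjoint A (h \<ominus> h \<otimes> d)"
      using closed hd by (simp add: selfadjoint_def adj_diff adj_mult)
    show "(h \<ominus> h \<otimes> d) \<otimes> (h \<ominus> h \<otimes> d) = h \<otimes> h \<ominus> h \<otimes> (b \<otimes> h)"
      using one_minus_sqrt_square[OF closed(5) d(2) closed(3) closed(1) closed(1)] hd by simp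
    show "y \<otimes> (h \<ominus> h \<otimes> d) = (h \<ominus> h \<otimes> d) \<otimes> y"
      if y: "y \<in> carrier A" "y \<otimes> h = h \<otimes> y" "y \<otimes> b = b \<otimes> y" for y
    proof -
      have "y \<otimes> (h \<otimes> d) = (h \<otimes> d) \<otimes> y"
        using closed y comm[OF y(1,3)] by (metis mult_assoc)
      then show ?thesis
        using closed y by (simp add: mult_diff_left mult_diff_right)
    qed
  qed
qed

subsection \<open>Extremality of a unit\<close>

lemma weighted_sqrt_cubic:
  assumes h: "selfadjoint A h" and q: "selfadjoint A q" and qh: "q \<otimes> h = h" "h \<otimes> q = h"
    and norm: "cnorm A (q \<ominus> h) \<le> 1" and r: "0 < r" "r < 1"
  obtains a where "selfadjoint A a"
    "a \<otimes> a = cscale A (of_real (1 - r)) (h \<otimes> h) \<oplus> cscale A (of_real r) (h \<otimes> (h \<otimes> h))"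
    "\<And>y. y \<in> carrier A \<Longrightarrow> y \<otimes> h = h \<otimes> y \<Longrightarrow> y \<otimes> q = q \<otimes> y \<Longrightarrow> y \<otimes> a = a \<otimes> y"
proof -
  define b where "b = cscale A (of_real r) (q \<ominus> h)"
  note closed = selfadjointD[OF h] selfadjointD[OF q]
  have b: "selfadjoint A b" "h \<otimes> b = b \<otimes> h"
    using closed qh by (auto simp: b_def selfadjoint_def adj_scale adj_diff scale_mult_left scale_mult_right
        mult_diff_left mult_diff_right)
  have "cnorm A b = r * cnorm A (q \<ominus> h)"
    using r closed norm_scale_real[of "q \<ominus> h" r] by (simp add: b_def)
  also have "\<dots> \<le> r * 1"
    using r norm by (intro mult_left_mono) auto
  finally have "cnorm A b < 1"
    using r by simp
  then obtain a where a: "selfadjoint A a" "a \<otimes> a = h \<otimes> h \<ominus> h \<otimes> (b \<otimes> h)"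
    and comm: "\<And>y. y \<in> carrier A \<Longrightarrow> y \<otimes> h = h \<otimes> y \<Longrightarrow> y \<otimes> b = b \<otimes> y \<Longrightarrow> y \<otimes> a = a \<otimes> y"
    using weighted_sqrt[OF h b(1) _ b(2)] by blast
  show ?thesis
  proof (rule that[OF a(1)])
    have "h \<otimes> (b \<otimes> h) = cscale A (of_real r) (h \<otimes> h) \<ominus> cscale A (of_real r) (h \<otimes> (h \<otimes> h))"
      using closed qh by (simp add: b_def scale_mult_left scale_mult_right mult_diff_left mult_diff_right scale_diff)
    then have "a \<otimes> a = (cscale A 1 (h \<otimes> h) \<oplus> cscale A (- of_real r) (h \<otimes> h))
        \<oplus> cscale A (of_real r) (h \<otimes> (h \<otimes> h))"
      using closed by (simp add: a(2) diff_as_scale scale_add a_assoc)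
    then show "a \<otimes> a = cscale A (of_real (1 - r)) (h \<otimes> h) \<oplus> cscale A (of_real r) (h \<otimes> (h \<otimes> h))"
      using closed by (simp del: scale_one flip: add_scale)
    show "y \<otimes> a = a \<otimes> y" if "y \<in> carrier A" "y \<otimes> h = h \<otimes> y" "y \<otimes> q = q \<otimes> y" for y
      using that closed by (intro comm)
        (simp_all add: b_def scale_mult_left scale_mult_right mult_diff_left mult_diff_right)
  qed
qed

text \<open>The roots of \<open>h\<^sup>2 (1 - r (q - h))\<close> and \<open>h\<^sup>2 (1 - r (q + h))\<close> commute, and their squares
  \<open>(1 - r) h\<^sup>2 + r h\<^sup>3\<close> and \<open>(1 - r) h\<^sup>2 - r h\<^sup>3\<close> sum to \<open>2 (1 - r) h\<^sup>2\<close>.\<close>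

lemma norm_cube_le_norm_square:
  assumes h: "selfadjoint A h" and q: "selfadjoint A q" and qh: "q \<otimes> h = h" "h \<otimes> q = h"
    and norm: "cnorm A (q \<ominus> h) \<le> 1" "cnorm A (q \<oplus> h) \<le> 1" and r: "0 < r" "r < 1"
  shows "r * cnorm A (h \<otimes> (h \<otimes> h)) \<le> 3 * (1 - r) * cnorm A (h \<otimes> h)"
proof -
  note closed = selfadjointD[OF h] selfadjointD[OF q]
  let ?h2 = "h \<otimes> h" and ?h3 = "h \<otimes> (h \<otimes> h)" and ?r = "complex_of_real r"
  let ?n = "cscale A (-1) h"
  obtain a where a: "selfadjoint A a"
      "a \<otimes> a = cscale A (of_real (1 - r)) ?h2 \<oplus> cscale A ?r ?h3"
    and comm_a: "\<And>y. y \<in> carrier A \<Longrightarrow> y \<otimes> h = h \<otimes> y \<Longrightarrow> y \<otimes> q = q \<otimes> y \<Longrightarrow> y \<otimes> a = a \<otimes> y"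
    using weighted_sqrt_cubic[OF h q qh norm(1) r] by blast
  have neg: "selfadjoint A ?n" "q \<otimes> ?n = ?n" "?n \<otimes> q = ?n" "cnorm A (q \<ominus> ?n) \<le> 1"
    using closed qh norm(2) by (simp_all add: selfadjoint_def adj_scale scale_mult_left scale_mult_right diff_as_scale)
  obtain w where w: "selfadjoint A w"
      "w \<otimes> w = cscale A (of_real (1 - r)) (?n \<otimes> ?n) \<oplus> cscale A ?r (?n \<otimes> (?n \<otimes> ?n))"
    and comm_w: "\<And>y. y \<in> carrier A \<Longrightarrow> y \<otimes> ?n = ?n \<otimes> y \<Longrightarrow> y \<otimes> q = q \<otimes> y \<Longrightarrow> y \<otimes> w = w \<otimes> y"
    using weighted_sqrt_cubic[OF neg(1) q neg(2,3,4) r] by blast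
  have a_closed: "a \<in> carrier A" "w \<in> carrier A"
    using a w by (auto simp: selfadjoint_def)
  have "h \<otimes> w = w \<otimes> h" "q \<otimes> w = w \<otimes> q"
    using comm_w[OF closed(1)] comm_w[OF closed(3)] closed qh by (simp_all add: scale_mult_left scale_mult_right)
  then have "a \<otimes> w = w \<otimes> a"
    using comm_a[OF a_closed(2)] by simp
  then have "(cnorm A a)\<^sup>2 \<le> cnorm A (a \<otimes> a \<oplus> w \<otimes> w)"
    using norm_le_norm_sum_squares[OF a_closed] a(1) w(1) by (simp add: selfadjoint_def)
  also have "a \<otimes> a \<oplus> w \<otimes> w = (cscale A (of_real (1 - r)) ?h2 \<oplus> cscale A (of_real (1 - r)) ?h2)
      \<oplus> (cscale A ?r ?h3 \<oplus> cscale A (- ?r) ?h3)"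
    unfolding a(2) w(2) using closed by (simp add: scale_mult_left scale_mult_right a_ac)
  also have "\<dots> = cscale A (of_real (2 * (1 - r))) ?h2"
    using closed by (simp flip: add_scale)
  finally have norm_a: "cnorm A (a \<otimes> a) \<le> 2 * (1 - r) * cnorm A ?h2"
    using norm_selfadjoint_square[OF a(1)] r closed norm_scale_real[of ?h2 "2 * (1 - r)"] by simp
  have "cscale A ?r ?h3 = a \<otimes> a \<ominus> cscale A (of_real (1 - r)) ?h2"
    unfolding a(2) using closed a_comm[of "cscale A (of_real (1 - r)) ?h2"] add_diff_cancel by simp
  then have "r * cnorm A ?h3 \<le> cnorm A (a \<otimes> a) + (1 - r) * cnorm A ?h2"
    using norm_triangle_diff[of "a \<otimes> a" "cscale A (of_real (1 - r)) ?h2"]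
      norm_scale_real[of ?h3 r] norm_scale_real[of ?h2 "1 - r"] r closed a_closed by simp
  then show ?thesis
    using norm_a by (simp add: algebra_simps)
qed

lemma zero_if_norm_unit_plus_minus_le_1:
  assumes h: "selfadjoint A h" and q: "selfadjoint A q" and qh: "q \<otimes> h = h" "h \<otimes> q = h"
    and norm: "cnorm A (q \<ominus> h) \<le> 1" "cnorm A (q \<oplus> h) \<le> 1"
  shows "h = \<zero>"
proof -
  note h_closed = selfadjointD[OF h]
  let ?N2 = "cnorm A (h \<otimes> h)" and ?N3 = "cnorm A (h \<otimes> (h \<otimes> h))"
  have "?N3 + 3 * ?N2 \<le> 3 * ?N2"
  proof (rule field_le_mult_one_interval)
    fix r :: real assume "0 < r" "r < 1"
    then show "r * (?N3 + 3 * ?N2) \<le> 3 * ?N2"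
      using norm_cube_le_norm_square[OF assms, of r] by (simp add: algebra_simps)
  qed
  then have "h \<otimes> (h \<otimes> h) = \<zero>"
    using h_closed norm_nonneg[of "h \<otimes> (h \<otimes> h)"] norm_eq_0[of "h \<otimes> (h \<otimes> h)"] by simp
  then have "(h \<otimes> h) \<otimes> (h \<otimes> h) = \<zero>"
    using h_closed by (simp add: mult_assoc)
  moreover have "selfadjoint A (h \<otimes> h)"
    using h_closed by (simp add: selfadjoint_def adj_mult)
  ultimately have "?N2 = 0"
    using norm_selfadjoint_square[of "h \<otimes> h"] by simp
  then show ?thesis
    using norm_selfadjoint_square[OF h] norm_eq_0[OF h_closed(1)] by simp
qed

lemma zero_if_norm_scaled_unit_plus_minus_le:
  assumes h: "selfadjoint A h" and q: "selfadjoint A q" and qh: "q \<otimes> h = h" "h \<otimes> q = h" and c: "c > 0"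
    and norm: "cnorm A (cscale A (of_real c) q \<ominus> h) \<le> c" "cnorm A (cscale A (of_real c) q \<oplus> h) \<le> c"
  shows "h = \<zero>"
proof -
  note car = selfadjointD[OF h] selfadjointD[OF q]
  let ?g = "cscale A (of_real (1 / c)) h"
  have "q \<ominus> ?g = cscale A (of_real (1 / c)) (cscale A (of_real c) q \<ominus> h)"
    "q \<oplus> ?g = cscale A (of_real (1 / c)) (cscale A (of_real c) q \<oplus> h)"
    using c car by (simp_all add: scale_diff scale_add)
  then have "cnorm A (q \<ominus> ?g) \<le> 1" "cnorm A (q \<oplus> ?g) \<le> 1"
    using c norm car norm_scale_real[of "cscale A (of_real c) q \<ominus> h" "1 / c"]
      norm_scale_real[of "cscale A (of_real c) q \<oplus> h" "1 / c"] by simp_all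
  then have "?g = \<zero>"
    using car q qh by (intro zero_if_norm_unit_plus_minus_le_1[of ?g q])
      (simp_all add: selfadjoint_def adj_scale scale_mult_left scale_mult_right)
  then have "cscale A (of_real c) ?g = \<zero>"
    by simp
  then show ?thesis
    using c car by simp
qed

subsection \<open>Orthogonality of projections\<close>

lemma norm_projection_complement_le:
  assumes p: "projection A p" and x: "x \<in> carrier A"
  shows "cnorm A (x \<ominus> p \<otimes> x) \<le> cnorm A x"
proof -
  let ?y = "x \<ominus> p \<otimes> x"
  note p' = projectionD[OF p]
  have y_closed: "?y \<in> carrier A"
    using p' x by simp
  have "p \<otimes> ?y = \<zero>"
    using p' x mult_assoc[of p p x] by (simp add: mult_diff_right)
  then have "cadj A (p \<otimes> x) \<otimes> ?y = \<zero>"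
    using p' x y_closed by (simp add: adj_mult mult_assoc)
  then have "cadj A ?y \<otimes> ?y = cadj A x \<otimes> ?y"
    using p' x y_closed by (simp add: adj_diff mult_diff_left)
  then have "(cnorm A ?y)\<^sup>2 \<le> cnorm A x * cnorm A ?y"
    using norm_adj_mult[OF y_closed] norm_mult[of "cadj A x" ?y] x y_closed by simp
  then show ?thesis
    using norm_nonneg[OF y_closed] norm_nonneg[OF x] by (cases "cnorm A ?y = 0") (auto simp: power2_eq_square)
qed

lemma norm_projection_diff_compression_le_1:
  assumes p: "projection A p" and q: "projection A q"
  shows "cnorm A (p \<ominus> p \<otimes> (q \<otimes> p)) \<le> 1"
proof -
  note p' = projectionD[OF p] and q' = projectionD[OF q]
  have "cnorm A (p \<otimes> (p \<ominus> q \<otimes> p)) \<le> cnorm A p * cnorm A (p \<ominus> q \<otimes> p)"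
    using p' q' by (intro norm_mult) auto
  also have "\<dots> \<le> 1 * 1"
    using norm_projection_complement_le[OF q p'(2)] norm_projection_le_1[OF p] p' q'
    by (intro mult_mono norm_nonneg) auto
  also have "p \<otimes> (p \<ominus> q \<otimes> p) = p \<ominus> p \<otimes> (q \<otimes> p)"
    using p' q' by (simp add: mult_diff_right)
  finally show ?thesis
    by simp
qed

lemma norm_scaled_plus_le_if_sum_zero:
  assumes q: "q \<in> carrier A" and F: "finite F" "j \<in> F" and h: "h \<in> F \<rightarrow> carrier A"
    and norm: "\<And>i. i \<in> F \<Longrightarrow> cnorm A (q \<ominus> h i) \<le> 1" and sum: "finsum A h F = \<zero>"
  shows "cnorm A (cscale A (of_nat (card (F - {j}))) q \<oplus> h j) \<le> real (card (F - {j}))"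
proof -
  let ?J = "F - {j}" and ?nq = "cscale A (of_nat (card (F - {j}))) q"
  have J: "finite ?J" "j \<notin> ?J" "F = insert j ?J" "h \<in> ?J \<rightarrow> carrier A" "h j \<in> carrier A"
    using F h by blast+
  have "h j \<oplus> finsum A h ?J = \<zero>"
    using sum finsum_insert[OF J(1,2,4,5)] J(3) by simp
  then have "h j = \<ominus> finsum A h ?J"
    using J finsum_closed by (metis minus_equality)
  moreover have "?nq = finsum A (\<lambda>i. q) ?J"
    using finsum_scale_sum[OF J(1) q, of "\<lambda>_. 1"] q by simp
  ultimately have "?nq \<oplus> h j = finsum A (\<lambda>i. q \<ominus> h i) ?J"
    using finsum_diff[OF J(1), of "\<lambda>i. q" h] J q by (simp add: a_minus_def)
  also have "cnorm A \<dots> \<le> (\<Sum>i\<in>?J. cnorm A (q \<ominus> h i))"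
    using J q by (intro norm_finsum) auto
  also have "\<dots> \<le> (\<Sum>i\<in>?J. 1)"
    using norm by (intro sum_mono) auto
  finally show ?thesis
    by simp
qed

text \<open>The condition \<open>\<parallel>q - h i\<parallel> \<le> 1\<close> takes the place of \<open>h i \<ge> 0\<close>.\<close>

lemma zero_if_sum_zero_and_norm_unit_diff_le_1:
  assumes q: "projection A q" and F: "finite F" "j \<in> F" and h: "\<And>i. i \<in> F \<Longrightarrow> selfadjoint A (h i)"
    and qh: "q \<otimes> h j = h j" "h j \<otimes> q = h j"
    and norm: "\<And>i. i \<in> F \<Longrightarrow> cnorm A (q \<ominus> h i) \<le> 1" and sum: "finsum A h F = \<zero>"
  shows "h j = \<zero>"
proof (rule zero_if_norm_scaled_unit_plus_minus_le[OF h[OF F(2)] projectionD(1)[OF q] qh])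
  let ?J = "F - {j}" and ?cq = "cscale A (of_real (real (card F))) q"
  let ?nq = "cscale A (of_nat (card ?J)) q"
  note q' = projectionD[OF q]
  have h_closed: "h \<in> F \<rightarrow> carrier A" "h j \<in> carrier A"
    using h F(2) by (auto simp: selfadjoint_def)
  have card: "card F = Suc (card ?J)"
    using F by (rule card.remove)
  then show "0 < real (card F)"
    by simp
  have split: "?cq = ?nq \<oplus> q"
    using card add_scale[OF q'(2), of "of_nat (card ?J)" 1] q' by (simp add: add.commute)
  have norm_q: "cnorm A q \<le> 1"
    using q by (rule norm_projection_le_1)
  have "cnorm A ?nq \<le> real (card ?J) * 1"
    using norm_scale[OF q'(2), of "of_nat (card ?J)"] norm_q by (simp add: mult_left_le)
  moreover have "?cq \<ominus> h j = ?nq \<oplus> (q \<ominus> h j)"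
    unfolding split using q' h_closed by (simp add: a_minus_def a_assoc)
  ultimately show "cnorm A (?cq \<ominus> h j) \<le> real (card F)"
    using norm_triangle[of ?nq "q \<ominus> h j"] norm[OF F(2)] q' h_closed card by simp
  have "?cq \<oplus> h j = q \<oplus> (?nq \<oplus> h j)"
    unfolding split using q' h_closed by (simp add: a_ac)
  then show "cnorm A (?cq \<oplus> h j) \<le> real (card F)"
    using norm_scaled_plus_le_if_sum_zero[OF q'(2) F h_closed(1) norm sum]
      norm_triangle[of q "?nq \<oplus> h j"] norm_q q' h_closed card by simp
qed

lemma projections_orthogonal:
  assumes F: "finite F" and q: "\<And>i. i \<in> F \<Longrightarrow> projection A (q i)"
    and sum: "\<And>i. i \<in> F \<Longrightarrow> finsum A q F \<otimes> q i = q i"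
    and ij: "i \<in> F" "j \<in> F" "i \<noteq> j"
  shows "q j \<otimes> q i = \<zero>"
proof -
  define h where "h l = q i \<otimes> (q l \<otimes> q i)" for l
  note q' = projectionD[OF q]
  have h: "selfadjoint A (h l)" "q i \<otimes> h l = h l" "h l \<otimes> q i = h l" if "l \<in> F" for l
    using that ij q'(2-4) mult_assoc[of "q i" "q i" "q l \<otimes> q i"]
    by (auto simp: h_def selfadjoint_def adj_mult mult_assoc)
  have h_closed: "h l \<in> carrier A" if "l \<in> F" for l
    using h(1)[OF that] by (rule selfadjointD)
  let ?J = "F - {i}"
  have J: "finite ?J" "i \<notin> ?J" "F = insert i ?J" "j \<in> ?J"
    using F ij by blast+
  have "q i = q i \<otimes> (finsum A q F \<otimes> q i)"
    using sum q' ij by simp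
  also have "\<dots> = finsum A h F"
    using F q' ij by (simp add: finsum_mult_right finsum_mult_left h_def[abs_def] Pi_iff)
  also have "\<dots> = h i \<oplus> finsum A h ?J"
    using finsum_insert[OF J(1,2), of h] J(3) h_closed ij by auto
  also have "h i = q i"
    using q' ij by (simp add: h_def)
  finally have "finsum A h ?J = \<zero>"
    using q' ij h_closed finsum_closed[of h ?J] by simp
  then have "h j = \<zero>"
    using q J ij h by (intro zero_if_sum_zero_and_norm_unit_diff_le_1[of "q i" ?J j h])
      (auto simp: h_def intro: norm_projection_diff_compression_le_1)
  moreover have "cadj A (q j \<otimes> q i) \<otimes> (q j \<otimes> q i) = h j"
    using q' ij mult_assoc[of "q j" "q j" "q i"] by (simp add: h_def adj_mult mult_assoc)
  ultimately show ?thesis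
    using norm_adj_mult[of "q j \<otimes> q i"] norm_eq_0[of "q j \<otimes> q i"] q' ij by simp
qed

end

section \<open>Homomorphisms of C*-algebras\<close>

lemma star_homD:
  assumes "star_hom A B f"
  shows "x \<in> carrier A \<Longrightarrow> f x \<in> carrier B"
    "\<lbrakk>x \<in> carrier A; y \<in> carrier A\<rbrakk> \<Longrightarrow> f (x \<oplus>\<^bsub>A\<^esub> y) = f x \<oplus>\<^bsub>B\<^esub> f y"
    "x \<in> carrier A \<Longrightarrow> f (cscale A c x) = cscale B c (f x)"
    "\<lbrakk>x \<in> carrier A; y \<in> carrier A\<rbrakk> \<Longrightarrow> f (x \<otimes>\<^bsub>A\<^esub> y) = f x \<otimes>\<^bsub>B\<^esub> f y"
    "x \<in> carrier A \<Longrightarrow> f (cadj A x) = cadj B (f x)"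
  using assms by (auto simp: star_hom_def)

lemma star_hom_comp: "star_hom A B f \<Longrightarrow> star_hom B C g \<Longrightarrow> star_hom A C (\<lambda>x. g (f x))"
  by (simp add: star_hom_def Pi_iff)

lemma le_if_powers_le_const_mult_powers:
  fixes x y K :: real
  assumes y: "0 \<le> y" and bound: "\<And>n. x ^ (2 ^ n) \<le> K * y ^ (2 ^ n)"
  shows "x \<le> y"
proof (rule ccontr)
  assume "\<not> x \<le> y"
  then have xy: "y < x"
    by simp
  then have pos: "y > 0"
    using bound[of 0] y by (cases "y = 0") auto
  define q where "q = x / y"
  have q: "q > 1"
    using xy pos by (simp add: q_def)
  then obtain n where n: "K < q ^ n"
    using real_arch_pow by blast
  have "q ^ n \<le> q ^ (2 ^ n)"
    using q by (intro power_increasing) (auto intro: less_imp_le)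
  also have "\<dots> \<le> K"
    using bound[of n] pos by (simp add: q_def power_divide pos_divide_le_eq)
  finally show False
    using n by simp
qed

lemma (in cstar_algebra) iterated_square_selfadjoint:
  assumes "selfadjoint A h"
  shows "selfadjoint A (((\<lambda>x. x \<otimes> x) ^^ n) h)"
    and "cnorm A (((\<lambda>x. x \<otimes> x) ^^ n) h) = cnorm A h ^ (2 ^ n)"
proof (induction n)
  case (Suc n)
  case 1
  then show ?case
    using Suc(1) by (simp add: selfadjoint_def adj_mult)
  case 2
  then show ?case
    using norm_selfadjoint_square[OF Suc(1)] Suc(2) by (simp add: mult.commute flip: power_mult)
qed (use assms in simp_all)

locale cstar_hom = A: cstar_algebra A + B: cstar_algebra B
  for A :: "'a cstar" and B :: "'b cstar" and f :: "'a \<Rightarrow> 'b" +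
  assumes hom: "star_hom A B f"
begin

lemmas hom_closed [simp, intro] = star_homD(1)[OF hom]
lemmas hom_add = star_homD(2)[OF hom]
lemmas hom_scale = star_homD(3)[OF hom]
lemmas hom_mult = star_homD(4)[OF hom]
lemmas hom_adj = star_homD(5)[OF hom]

lemma hom_zero [simp]: "f \<zero>\<^bsub>A\<^esub> = \<zero>\<^bsub>B\<^esub>"
  using hom_scale[of "\<zero>\<^bsub>A\<^esub>" 0] by simp

lemma hom_diff: "\<lbrakk>x \<in> carrier A; y \<in> carrier A\<rbrakk> \<Longrightarrow> f (x \<ominus>\<^bsub>A\<^esub> y) = f x \<ominus>\<^bsub>B\<^esub> f y"
  by (simp add: A.diff_as_scale B.diff_as_scale hom_add hom_scale)

lemma hom_finsum:
  "\<lbrakk>finite F; h \<in> F \<rightarrow> carrier A\<rbrakk> \<Longrightarrow> f (finsum A h F) = finsum B (\<lambda>i. f (h i)) F"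
  by (induction F rule: finite_induct) (auto simp: Pi_iff hom_add)

lemma hom_selfadjoint: "selfadjoint A x \<Longrightarrow> selfadjoint B (f x)"
  using hom_adj[of x] by (simp add: selfadjoint_def)

lemma hom_iterated_square:
  assumes h: "selfadjoint A h"
  shows "f (((\<lambda>x. x \<otimes>\<^bsub>A\<^esub> x) ^^ n) h) = ((\<lambda>x. x \<otimes>\<^bsub>B\<^esub> x) ^^ n) (f h)"
  by (induction n) (simp_all add: hom_mult selfadjointD(1)[OF A.iterated_square_selfadjoint(1)[OF h]])

text \<open>For self-adjoint \<open>a\<close> with \<open>\<parallel>a\<parallel> < 1\<close> the element \<open>a + i sqrt (1 - a\<^sup>2)\<close> is a unitary with real
  part \<open>a\<close>. As the unit is only formal, everything is multiplied by \<open>a\<close>.\<close>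

lemma norm_selfadjoint_le_1:
  assumes a: "selfadjoint A a" "cnorm A a < 1"
  shows "cnorm B (f a) \<le> 1"
proof -
  define y where "y = a \<otimes>\<^bsub>A\<^esub> a"
  note a_closed = selfadjointD[OF a(1)]
  have y: "selfadjoint A y" "a \<otimes>\<^bsub>A\<^esub> y = y \<otimes>\<^bsub>A\<^esub> a"
    using a_closed by (auto simp: y_def selfadjoint_def A.adj_mult A.mult_assoc)
  have "cnorm A y < 1"
    using A.norm_selfadjoint_square[OF a(1)] A.norm_nonneg[OF a_closed(1)] a(2)
    by (simp add: y_def power_less_one_iff)
  then obtain w where w: "selfadjoint A w" "w \<otimes>\<^bsub>A\<^esub> w = a \<otimes>\<^bsub>A\<^esub> a \<ominus>\<^bsub>A\<^esub> a \<otimes>\<^bsub>A\<^esub> (y \<otimes>\<^bsub>A\<^esub> a)"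
    and "\<And>u. u \<in> carrier A \<Longrightarrow> u \<otimes>\<^bsub>A\<^esub> a = a \<otimes>\<^bsub>A\<^esub> u \<Longrightarrow> u \<otimes>\<^bsub>A\<^esub> y = y \<otimes>\<^bsub>A\<^esub> u \<Longrightarrow> u \<otimes>\<^bsub>A\<^esub> w = w \<otimes>\<^bsub>A\<^esub> u"
    using A.weighted_sqrt[OF a(1) y(1) _ y(2)] by blast
  then have yw: "y \<otimes>\<^bsub>A\<^esub> w = w \<otimes>\<^bsub>A\<^esub> y"
    using selfadjointD(1)[OF y(1)] y(2) by simp
  note closed = a_closed selfadjointD[OF y(1)] selfadjointD[OF w(1)]
  have "y \<otimes>\<^bsub>A\<^esub> y = a \<otimes>\<^bsub>A\<^esub> (y \<otimes>\<^bsub>A\<^esub> a)"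
    using closed by (simp add: y_def A.mult_assoc)
  then have sum: "y \<otimes>\<^bsub>A\<^esub> y \<oplus>\<^bsub>A\<^esub> w \<otimes>\<^bsub>A\<^esub> w = a \<otimes>\<^bsub>A\<^esub> a"
    using closed by (simp add: w(2) A.add_diff_cancel_left)
  have "(cnorm B (f y))\<^sup>2 \<le> cnorm B (f y \<otimes>\<^bsub>B\<^esub> f y \<oplus>\<^bsub>B\<^esub> f w \<otimes>\<^bsub>B\<^esub> f w)"
    using B.norm_le_norm_sum_squares[of "f y" "f w"] arg_cong[OF yw, of f] closed
    by (simp add: hom_mult flip: hom_adj)
  also have "\<dots> = (cnorm B (f a))\<^sup>2"
    using arg_cong[OF sum, of f] closed B.norm_selfadjoint_square[OF hom_selfadjoint[OF a(1)]]
    by (simp add: hom_mult hom_add)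
  also have "f y = f a \<otimes>\<^bsub>B\<^esub> f a"
    using closed by (simp add: y_def hom_mult)
  finally have "((cnorm B (f a))\<^sup>2)\<^sup>2 \<le> (cnorm B (f a))\<^sup>2"
    using B.norm_selfadjoint_square[OF hom_selfadjoint[OF a(1)]] by simp
  moreover have "t \<le> 1" if "t\<^sup>2 \<le> t" for t :: real
    using that mult_strict_left_mono[of 1 t t] by (cases "t \<le> 1") (auto simp: power2_eq_square)
  ultimately have "(cnorm B (f a))\<^sup>2 \<le> 1"
    by blast
  then show ?thesis
    using B.norm_nonneg[of "f a"] a_closed by (simp add: power_le_one_iff)
qed

lemma norm_selfadjoint_le:
  assumes a: "selfadjoint A a"
  shows "cnorm B (f a) \<le> cnorm A a"
proof (rule field_le_epsilon)
  fix e :: real assume e: "e > 0"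
  define t where "t = cnorm A a + e"
  define u where "u = cscale A (of_real (1 / t)) a"
  note a_closed = selfadjointD[OF a]
  have t: "t > 0" "cnorm A a < t"
    using e A.norm_nonneg[OF a_closed(1)] by (simp_all add: t_def)
  have "selfadjoint A u"
    using a_closed by (simp add: u_def selfadjoint_def A.adj_scale)
  moreover have "cnorm A u < 1"
    using t a_closed A.norm_scale_real[OF a_closed(1), of "1 / t"] by (simp add: u_def)
  ultimately have "cnorm B (f u) \<le> 1"
    by (rule norm_selfadjoint_le_1)
  then show "cnorm B (f a) \<le> cnorm A a + e"
    using t a_closed B.norm_scale_real[of "f a" "1 / t"] by (simp add: u_def hom_scale t_def)
qed

lemma contractive:
  assumes x: "x \<in> carrier A" shows "cnorm B (f x) \<le> cnorm A x"
proof (rule power2_le_imp_le)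
  have "cnorm B (f (cadj A x \<otimes>\<^bsub>A\<^esub> x)) \<le> cnorm A (cadj A x \<otimes>\<^bsub>A\<^esub> x)"
    using x by (intro norm_selfadjoint_le) (simp add: selfadjoint_def A.adj_mult)
  then show "(cnorm B (f x))\<^sup>2 \<le> (cnorm A x)\<^sup>2"
    using x by (simp add: hom_mult hom_adj B.norm_adj_mult A.norm_adj_mult)
qed (use x A.norm_nonneg in simp)

lemma lipschitz:
  "\<lbrakk>x \<in> carrier A; y \<in> carrier A\<rbrakk> \<Longrightarrow> cnorm B (f x \<ominus>\<^bsub>B\<^esub> f y) \<le> 1 * cnorm A (x \<ominus>\<^bsub>A\<^esub> y)"
  using contractive[of "x \<ominus>\<^bsub>A\<^esub> y"] by (simp add: hom_diff)

text \<open>The \<open>2\<^sup>n\<close>-th powers of \<open>y\<^sup>* y\<close> turn equivalence of the two C*-norms into equality.\<close>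

lemma norm_le_if_bounded_below:
  assumes V: "V \<subseteq> carrier A" "\<And>x y. x \<in> V \<Longrightarrow> y \<in> V \<Longrightarrow> x \<otimes>\<^bsub>A\<^esub> y \<in> V" "\<And>x. x \<in> V \<Longrightarrow> cadj A x \<in> V"
    and K: "\<And>x. x \<in> V \<Longrightarrow> cnorm A x \<le> K * cnorm B (f x)" and y: "y \<in> V"
  shows "cnorm A y \<le> cnorm B (f y)"
proof (rule power2_le_imp_le)
  have y_closed: "y \<in> carrier A"
    using V(1) y by blast
  then show "0 \<le> cnorm B (f y)"
    by (simp add: B.norm_nonneg)
  define h where "h = cadj A y \<otimes>\<^bsub>A\<^esub> y"
  have h: "selfadjoint A h" "h \<in> V"
    using V y y_closed by (auto simp: h_def selfadjoint_def A.adj_mult)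
  have "((\<lambda>x. x \<otimes>\<^bsub>A\<^esub> x) ^^ n) h \<in> V" for n
    by (induction n) (simp_all add: h(2) V(2))
  from K[OF this] have powers: "cnorm A h ^ (2 ^ n) \<le> K * cnorm B (f h) ^ (2 ^ n)" for n
    using A.iterated_square_selfadjoint(2)[OF h(1)] B.iterated_square_selfadjoint(2)[OF hom_selfadjoint[OF h(1)]]
    by (simp add: hom_iterated_square[OF h(1)])
  have "cnorm A h \<le> cnorm B (f h)"
    using selfadjointD(1)[OF h(1)] B.norm_nonneg
    by (intro le_if_powers_le_const_mult_powers[OF _ powers]) simp
  then show "(cnorm A y)\<^sup>2 \<le> (cnorm B (f y))\<^sup>2"
    using y_closed by (simp add: h_def A.norm_adj_mult hom_mult hom_adj B.norm_adj_mult)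
qed

lemma image_subspace:
  assumes S: "linear_subspace A S" shows "linear_subspace B (f ` S)"
proof -
  note S' = A.subspaceD[OF S]
  have "f x \<oplus>\<^bsub>B\<^esub> f y \<in> f ` S" "cscale B c (f x) \<in> f ` S" if "x \<in> S" "y \<in> S" for x y c
    using that S'(3,4) subsetD[OF S'(1)] by (simp_all flip: hom_add hom_scale)
  moreover have "\<zero>\<^bsub>B\<^esub> \<in> f ` S"
    using imageI[OF S'(2), of f] by simp
  moreover have "f ` S \<subseteq> carrier B"
    using S'(1) by auto
  ultimately show ?thesis
    unfolding linear_subspace_def by blast
qed

lemma preimage_subalgebra:
  assumes S: "cstar_subalgebra B S" shows "cstar_subalgebra A {x \<in> carrier A. f x \<in> S}"
proof -
  have "closedin (ctopology A) {x \<in> carrier A. f x \<in> S}"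
    using B.cstar_algebra_axioms S lipschitz
    by (intro A.closedin_lipschitz_preimage[where K = 1]) (auto simp: cstar_subalgebra_def)
  then show ?thesis
    using S by (auto simp: cstar_subalgebra_def linear_subspace_def hom_add hom_scale hom_mult hom_adj)
qed

lemma image_generated_subset:
  assumes X: "X \<subseteq> carrier A" "cstar_generated A X = carrier A"
    and S: "cstar_subalgebra B S" and XS: "f ` X \<subseteq> S"
  shows "f ` carrier A \<subseteq> S"
proof -
  have "cstar_generated A X \<subseteq> {x \<in> carrier A. f x \<in> S}"
    unfolding cstar_generated_def using preimage_subalgebra[OF S] X(1) XS by blast
  then show ?thesis
    using X(2) by blast
qed

end

locale cstar_embedding = cstar_hom A B f
  for A :: "'a cstar" and B :: "'b cstar" and f :: "'a \<Rightarrow> 'b" +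
  assumes isometric: "x \<in> carrier A \<Longrightarrow> cnorm B (f x) = cnorm A x"
begin

lemma norm_diff_image:
  "\<lbrakk>x \<in> carrier A; y \<in> carrier A\<rbrakk> \<Longrightarrow> cnorm B (f x \<ominus>\<^bsub>B\<^esub> f y) = cnorm A (x \<ominus>\<^bsub>A\<^esub> y)"
  using isometric[of "x \<ominus>\<^bsub>A\<^esub> y"] by (simp add: hom_diff)

lemma inj_on_carrier: "inj_on f (carrier A)"
proof (rule inj_onI)
  fix x y assume xy: "x \<in> carrier A" "y \<in> carrier A" "f x = f y"
  then have "cnorm A (x \<ominus>\<^bsub>A\<^esub> y) = 0"
    using norm_diff_image[of x y] by simp
  then show "x = y"
    using xy by (simp add: A.norm_eq_0 A.diff_eq_zero_iff)
qed

lemma closedin_image: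
  assumes S: "closedin (ctopology A) S" shows "closedin (ctopology B) (f ` S)"
  unfolding B.closedin_iff_clim
proof (intro conjI allI impI)
  have S_subset: "S \<subseteq> carrier A"
    using S by (rule A.closedin_subset_carrier)
  then show "f ` S \<subseteq> carrier B"
    by auto
  fix u x assume "\<forall>n. u n \<in> f ` S" and u: "clim B u x"
  then have "\<forall>n. \<exists>a. a \<in> S \<and> u n = f a"
    by blast
  then obtain a where a: "\<And>n. a n \<in> S" "\<And>n. u n = f (a n)"
    by metis
  have a_closed: "a n \<in> carrier A" for n
    using a(1) S_subset by blast
  have "cCauchy A a"
    using B.clim_imp_cCauchy[OF u] a a_closed by (simp add: cCauchy_def norm_diff_image)
  then obtain y where y: "clim A a y"
    by (rule A.cCauchy_converges)
  have "clim B (\<lambda>n. f (a n)) (f y)"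
    using B.cstar_algebra_axioms y hom_closed lipschitz by (rule A.clim_lipschitz)
  then have "clim B u (f y)"
    by (simp only: a(2)[symmetric])
  then have "x = f y"
    by (rule B.clim_unique[OF u])
  then show "x \<in> f ` S"
    using A.closedin_clim[OF S a(1) y] by blast
qed

lemma range_subalgebra: "cstar_subalgebra B (f ` carrier A)"
  unfolding cstar_subalgebra_def
proof (intro conjI ballI)
  show "linear_subspace B (f ` carrier A)"
    using A.linear_subspace_carrier by (rule image_subspace)
  show "closedin (ctopology B) (f ` carrier A)"
    by (rule closedin_image) (simp add: A.closedin_iff_clim climD(2))
qed (auto simp flip: hom_mult hom_adj)

lemma closed_span_eq_carrier:
  assumes X: "X \<subseteq> carrier A" and dense: "f ` carrier A \<subseteq> closed_span B (f ` X)"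
  shows "closed_span A X = carrier A"
proof
  show "closed_span A X \<subseteq> carrier A"
    by (rule A.closed_span_subset_carrier)
  have "closed_span B (f ` X) \<subseteq> f ` closed_span A X"
    using A.subset_closed_span[OF X]
    by (intro B.closed_span_minimal image_subspace closedin_image A.closed_span_subspace X
        A.closed_span_closed image_mono)
  then have "f ` carrier A \<subseteq> f ` closed_span A X"
    using dense by blast
  then show "carrier A \<subseteq> closed_span A X"
    using inj_on_image_subset_iff[OF inj_on_carrier] A.closed_span_subset_carrier by blast
qed

lemma
  shows inv_into_add: "\<lbrakk>x \<in> f ` carrier A; y \<in> f ` carrier A\<rbrakk> \<Longrightarrow>
      inv_into (carrier A) f (x \<oplus>\<^bsub>B\<^esub> y) = inv_into (carrier A) f x \<oplus>\<^bsub>A\<^esub> inv_into (carrier A) f y"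
    and inv_into_mult: "\<lbrakk>x \<in> f ` carrier A; y \<in> f ` carrier A\<rbrakk> \<Longrightarrow>
      inv_into (carrier A) f (x \<otimes>\<^bsub>B\<^esub> y) = inv_into (carrier A) f x \<otimes>\<^bsub>A\<^esub> inv_into (carrier A) f y"
    and inv_into_scale: "x \<in> f ` carrier A \<Longrightarrow>
      inv_into (carrier A) f (cscale B c x) = cscale A c (inv_into (carrier A) f x)"
    and inv_into_adj: "x \<in> f ` carrier A \<Longrightarrow>
      inv_into (carrier A) f (cadj B x) = cadj A (inv_into (carrier A) f x)"
  by (auto simp: inv_into_f_f[OF inj_on_carrier] simp flip: hom_add hom_mult hom_scale hom_adj)

lemma star_hom_inv_into:
  assumes \<psi>: "star_hom D B \<psi>" and range: "\<psi> ` carrier D \<subseteq> f ` carrier A"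
  shows "star_hom D A (\<lambda>x. inv_into (carrier A) f (\<psi> x))"
proof -
  have "\<psi> x \<in> f ` carrier A" if "x \<in> carrier D" for x
    using range that by blast
  then show ?thesis
    using \<psi> by (simp add: star_hom_def Pi_iff inv_into_into inv_into_add inv_into_mult inv_into_scale inv_into_adj)
qed

end

section \<open>Construction of C*-algebras\<close>

lemma Metric_space_cdistI:
  fixes A :: "'a cstar" (structure)
  assumes "abelian_group A"
    and nonneg: "\<And>x. x \<in> carrier A \<Longrightarrow> 0 \<le> cnorm A x"
    and eq_0: "\<And>x. x \<in> carrier A \<Longrightarrow> cnorm A x = 0 \<longleftrightarrow> x = \<zero>"
    and triangle: "\<And>x y. \<lbrakk>x \<in> carrier A; y \<in> carrier A\<rbrakk> \<Longrightarrow> cnorm A (x \<oplus> y) \<le> cnorm A x + cnorm A y"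
    and minus: "\<And>x. x \<in> carrier A \<Longrightarrow> cnorm A (\<ominus> x) = cnorm A x"
  shows "Metric_space (carrier A) (cdist A)"
proof -
  interpret abelian_group A
    by fact
  show ?thesis
  proof
    show "0 \<le> cdist A x y" for x y
      by (simp add: cdist_def nonneg)
    have "cnorm A (x \<ominus> y) = cnorm A (y \<ominus> x)" if "x \<in> carrier A" "y \<in> carrier A" for x y
      using that minus[of "y \<ominus> x"] by (simp add: a_minus_def minus_add a_comm)
    then show "cdist A x y = cdist A y x" for x y
      by (simp add: cdist_def)
    show "cdist A x y = 0 \<longleftrightarrow> x = y" if "x \<in> carrier A" "y \<in> carrier A" for x y
      using that minus_equality[of x "\<ominus> y"] by (auto simp: cdist_def eq_0 minus_eq r_neg)
    show "cdist A x z \<le> cdist A x y + cdist A y z"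
      if x: "x \<in> carrier A" and y: "y \<in> carrier A" and z: "z \<in> carrier A" for x y z
    proof -
      have "x \<ominus> z = (x \<ominus> y) \<oplus> (y \<ominus> z)"
        using x y z by (simp add: a_minus_def a_assoc r_neg1)
      then show ?thesis
        using x y z triangle[of "x \<ominus> y" "y \<ominus> z"] by (simp add: cdist_def)
    qed
  qed
qed

lemma cstar_algebraI:
  fixes A :: "'a cstar" (structure)
  assumes group: "abelian_group A"
    and "\<And>x y. \<lbrakk>x \<in> carrier A; y \<in> carrier A\<rbrakk> \<Longrightarrow> x \<otimes> y \<in> carrier A"
    and "\<And>x y z. \<lbrakk>x \<in> carrier A; y \<in> carrier A; z \<in> carrier A\<rbrakk> \<Longrightarrow> (x \<otimes> y) \<otimes> z = x \<otimes> (y \<otimes> z)"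
    and "\<And>x y z. \<lbrakk>x \<in> carrier A; y \<in> carrier A; z \<in> carrier A\<rbrakk> \<Longrightarrow> (x \<oplus> y) \<otimes> z = x \<otimes> z \<oplus> y \<otimes> z"
    and "\<And>x y z. \<lbrakk>x \<in> carrier A; y \<in> carrier A; z \<in> carrier A\<rbrakk> \<Longrightarrow> z \<otimes> (x \<oplus> y) = z \<otimes> x \<oplus> z \<otimes> y"
    and scale_closed: "\<And>x c. x \<in> carrier A \<Longrightarrow> cscale A c x \<in> carrier A"
    and "\<And>x y c. \<lbrakk>x \<in> carrier A; y \<in> carrier A\<rbrakk> \<Longrightarrow> cscale A c (x \<oplus> y) = cscale A c x \<oplus> cscale A c y"
    and add_scale: "\<And>x b c. x \<in> carrier A \<Longrightarrow> cscale A (b + c) x = cscale A b x \<oplus> cscale A c x"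
    and "\<And>x b c. x \<in> carrier A \<Longrightarrow> cscale A b (cscale A c x) = cscale A (b * c) x"
    and scale_one: "\<And>x. x \<in> carrier A \<Longrightarrow> cscale A 1 x = x"
    and "\<And>x y c. \<lbrakk>x \<in> carrier A; y \<in> carrier A\<rbrakk> \<Longrightarrow> cscale A c x \<otimes> y = cscale A c (x \<otimes> y)"
    and "\<And>x y c. \<lbrakk>x \<in> carrier A; y \<in> carrier A\<rbrakk> \<Longrightarrow> x \<otimes> cscale A c y = cscale A c (x \<otimes> y)"
    and "\<And>x. x \<in> carrier A \<Longrightarrow> cadj A x \<in> carrier A"
    and "\<And>x. x \<in> carrier A \<Longrightarrow> cadj A (cadj A x) = x"
    and "\<And>x y. \<lbrakk>x \<in> carrier A; y \<in> carrier A\<rbrakk> \<Longrightarrow> cadj A (x \<oplus> y) = cadj A x \<oplus> cadj A y"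
    and "\<And>x c. x \<in> carrier A \<Longrightarrow> cadj A (cscale A c x) = cscale A (cnj c) (cadj A x)"
    and "\<And>x y. \<lbrakk>x \<in> carrier A; y \<in> carrier A\<rbrakk> \<Longrightarrow> cadj A (x \<otimes> y) = cadj A y \<otimes> cadj A x"
    and nonneg: "\<And>x. x \<in> carrier A \<Longrightarrow> 0 \<le> cnorm A x"
    and eq_0: "\<And>x. x \<in> carrier A \<Longrightarrow> cnorm A x = 0 \<longleftrightarrow> x = \<zero>"
    and triangle: "\<And>x y. \<lbrakk>x \<in> carrier A; y \<in> carrier A\<rbrakk> \<Longrightarrow> cnorm A (x \<oplus> y) \<le> cnorm A x + cnorm A y"
    and norm_scale: "\<And>x c. x \<in> carrier A \<Longrightarrow> cnorm A (cscale A c x) = cmod c * cnorm A x"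
    and "\<And>x y. \<lbrakk>x \<in> carrier A; y \<in> carrier A\<rbrakk> \<Longrightarrow> cnorm A (x \<otimes> y) \<le> cnorm A x * cnorm A y"
    and "\<And>x. x \<in> carrier A \<Longrightarrow> cnorm A (cadj A x \<otimes> x) = (cnorm A x)\<^sup>2"
    and convergent: "\<And>f. cCauchy A f \<Longrightarrow> \<exists>x. clim A f x"
  shows "cstar_algebra A"
proof -
  interpret abelian_group A
    by (rule group)
  have "\<ominus> x = cscale A (-1) x" if x: "x \<in> carrier A" for x
  proof (rule minus_equality)
    have "cnorm A (cscale A 0 x) = 0"
      using norm_scale[OF x, of 0] by simp
    then show "cscale A (-1) x \<oplus> x = \<zero>"
      using add_scale[OF x, of "-1" 1] eq_0[OF scale_closed[OF x]] scale_one[OF x] by simp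
  qed (use x scale_closed in simp_all)
  then have "cnorm A (\<ominus> x) = cnorm A x" if "x \<in> carrier A" for x
    using that norm_scale by simp
  then interpret m: Metric_space "carrier A" "cdist A"
    using group nonneg eq_0 triangle by (intro Metric_space_cdistI)
  have complete: "m.mcomplete"
    unfolding m.mcomplete_def
  proof (intro allI impI)
    fix f assume f: "m.MCauchy f"
    then have f_closed: "f n \<in> carrier A" for n
      by (auto simp: m.MCauchy_def)
    have "cCauchy A f"
      using f f_closed unfolding m.MCauchy_def cCauchy_def by (simp add: cdist_def)
    then obtain x where "clim A f x"
      using convergent by blast
    then show "\<exists>x. limitin m.mtopology f x sequentially"
      by (intro exI[of _ x]) (simp add: m.limitin_metric_dist_null cdist_def clim_def)
  qed
  show ?thesis
    by (intro cstar_algebra.intro cstar_algebra_axioms.intro) (fact assms complete)+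
qed

subsection \<open>Transport along injections\<close>

definition cstar_image :: "'a cstar \<Rightarrow> 'a set \<Rightarrow> ('a \<Rightarrow> 'b) \<Rightarrow> 'b cstar" where
  "cstar_image M S f =
    \<lparr> carrier = f ` S,
      mult = (\<lambda>x y. f (inv_into S f x \<otimes>\<^bsub>M\<^esub> inv_into S f y)),
      one = f \<one>\<^bsub>M\<^esub>,
      zero = f \<zero>\<^bsub>M\<^esub>,
      add = (\<lambda>x y. f (inv_into S f x \<oplus>\<^bsub>M\<^esub> inv_into S f y)),
      cscale = (\<lambda>c x. f (cscale M c (inv_into S f x))),
      cadj = (\<lambda>x. f (cadj M (inv_into S f x))),
      cnorm = (\<lambda>x. cnorm M (inv_into S f x)) \<rparr>"

lemma cstar_image_simps:
  assumes "inj_on f S"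
  shows "carrier (cstar_image M S f) = f ` S"
    "\<zero>\<^bsub>cstar_image M S f\<^esub> = f \<zero>\<^bsub>M\<^esub>"
    "\<lbrakk>x \<in> S; y \<in> S\<rbrakk> \<Longrightarrow> f x \<otimes>\<^bsub>cstar_image M S f\<^esub> f y = f (x \<otimes>\<^bsub>M\<^esub> y)"
    "\<lbrakk>x \<in> S; y \<in> S\<rbrakk> \<Longrightarrow> f x \<oplus>\<^bsub>cstar_image M S f\<^esub> f y = f (x \<oplus>\<^bsub>M\<^esub> y)"
    "x \<in> S \<Longrightarrow> cscale (cstar_image M S f) c (f x) = f (cscale M c x)"
    "x \<in> S \<Longrightarrow> cadj (cstar_image M S f) (f x) = f (cadj M x)"
    "x \<in> S \<Longrightarrow> cnorm (cstar_image M S f) (f x) = cnorm M x"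
  using assms by (auto simp: cstar_image_def)

context cstar_algebra
begin

lemma subalgebraD:
  assumes "cstar_subalgebra A S"
  shows "linear_subspace A S" "closedin (ctopology A) S" "\<And>x y. x \<in> S \<Longrightarrow> y \<in> S \<Longrightarrow> x \<otimes> y \<in> S"
    "\<And>x. x \<in> S \<Longrightarrow> cadj A x \<in> S"
  using assms by (auto simp: cstar_subalgebra_def)

lemma cstar_image_abelian_group:
  assumes S: "linear_subspace A S" and inj: "inj_on f S"
  shows "abelian_group (cstar_image A S f)"
proof (rule abelian_groupI)
  let ?N = "cstar_image A S f"
  note simps = cstar_image_simps[OF inj, where M = A] and S' = subspaceD[OF S]
  have S_subset: "x \<in> carrier A" if "x \<in> S" for x
    using that S'(1) by blast
  show "x \<oplus>\<^bsub>?N\<^esub> y \<in> carrier ?N" "x \<oplus>\<^bsub>?N\<^esub> y = y \<oplus>\<^bsub>?N\<^esub> x" if "x \<in> carrier ?N" "y \<in> carrier ?N" for x y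
    using that S'(3) S_subset a_comm by (auto simp: simps)
  show "(x \<oplus>\<^bsub>?N\<^esub> y) \<oplus>\<^bsub>?N\<^esub> z = x \<oplus>\<^bsub>?N\<^esub> (y \<oplus>\<^bsub>?N\<^esub> z)"
    if "x \<in> carrier ?N" "y \<in> carrier ?N" "z \<in> carrier ?N" for x y z
    using that S'(3) S_subset a_assoc by (auto simp: simps)
  show "\<zero>\<^bsub>?N\<^esub> \<in> carrier ?N"
    using S'(2) by (simp add: simps)
  show "\<zero>\<^bsub>?N\<^esub> \<oplus>\<^bsub>?N\<^esub> x = x" if "x \<in> carrier ?N" for x
    using that S'(2) S_subset by (auto simp: simps)
  show "\<exists>y\<in>carrier ?N. y \<oplus>\<^bsub>?N\<^esub> x = \<zero>\<^bsub>?N\<^esub>" if "x \<in> carrier ?N" for x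
  proof -
    obtain u where u: "u \<in> S" "x = f u"
      using \<open>x \<in> carrier ?N\<close> by (auto simp: simps)
    have closed: "cscale A (-1) u \<in> S" "u \<in> carrier A"
      using u S'(4) S_subset by auto
    then have "f (cscale A (-1) u) \<oplus>\<^bsub>?N\<^esub> x = f (\<ominus> u \<oplus> u)"
      using u by (simp add: simps scale_minus_one)
    then show ?thesis
      using closed by (intro bexI[of _ "f (cscale A (-1) u)"]) (simp_all add: simps l_neg)
  qed
qed

lemma cstar_image_diff:
  assumes S: "linear_subspace A S" and inj: "inj_on f S" and uv: "u \<in> S" "v \<in> S"
  shows "f u \<ominus>\<^bsub>cstar_image A S f\<^esub> f v = f (u \<ominus> v)"
proof -
  let ?N = "cstar_image A S f"
  interpret N: abelian_group ?N
    using S inj by (rule cstar_image_abelian_group)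
  note simps = cstar_image_simps[OF inj, where M = A] and S' = subspaceD[OF S]
  have v: "v \<in> carrier A" "cscale A (-1) v \<in> S"
    using uv(2) S'(1,4) by auto
  have "f (cscale A (-1) v) \<oplus>\<^bsub>?N\<^esub> f v = f (\<ominus> v \<oplus> v)"
    using uv v by (simp add: simps scale_minus_one)
  then have "\<ominus>\<^bsub>?N\<^esub> f v = f (cscale A (-1) v)"
    using uv v by (intro N.minus_equality) (auto simp: simps l_neg)
  then show ?thesis
    using uv v by (simp add: N.minus_eq simps diff_as_scale)
qed

lemma cstar_image_complete:
  assumes S: "linear_subspace A S" "closedin (ctopology A) S" and inj: "inj_on f S"
    and h: "cCauchy (cstar_image A S f) h"
  shows "\<exists>x. clim (cstar_image A S f) h x"
proof -
  let ?N = "cstar_image A S f"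
  note simps = cstar_image_simps[OF inj, where M = A] and S' = subspaceD[OF S(1)]
  have "\<forall>n. \<exists>u. u \<in> S \<and> h n = f u"
    using h by (auto simp: cCauchy_def simps)
  then obtain u where u: "\<And>n. u n \<in> S" "\<And>n. h n = f (u n)"
    by metis
  have norm: "cnorm ?N (f a \<ominus>\<^bsub>?N\<^esub> f b) = cnorm A (a \<ominus> b)" if "a \<in> S" "b \<in> S" for a b
    using that subspace_diff[OF S(1) that] by (simp add: cstar_image_diff[OF S(1) inj] simps)
  have "cCauchy A u"
    using h u S'(1) unfolding cCauchy_def by (simp add: norm subset_iff)
  then obtain x where x: "clim A u x"
    by (rule cCauchy_converges)
  have "x \<in> S"
    using S(2) u(1) x by (rule closedin_clim)
  then have "clim ?N h (f x)"
    using x u by (simp add: clim_def norm simps)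
  then show ?thesis
    by blast
qed

lemma cstar_algebra_image:
  assumes S: "cstar_subalgebra A S" and inj: "inj_on f S"
  shows "cstar_algebra (cstar_image A S f)"
proof -
  note simps = cstar_image_simps[OF inj, where M = A]
  note S' = subspaceD[OF subalgebraD(1)[OF S]] and S'' = subalgebraD[OF S]
  have [simp]: "x \<in> carrier A" if "x \<in> S" for x
    using that S' by blast
  note [simp] = S'(2-4) S''(3,4)
  have zero_iff: "f u = f \<zero> \<longleftrightarrow> u = \<zero>" if "u \<in> S" for u
    using that inj_on_eq_iff[OF inj] by simp
  show ?thesis
    by (rule cstar_algebraI[OF cstar_image_abelian_group[OF S''(1) inj] _ _ _ _ _ _ _ _ _ _ _ _ _ _ _ _ _ _ _ _ _ _
          cstar_image_complete[OF S''(1,2) inj]])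
      (auto simp: simps mult_assoc distrib_left distrib_right scale_add add_scale
        scale_mult_left scale_mult_right adj_add adj_scale adj_mult norm_nonneg norm_triangle norm_scale
        norm_mult norm_adj_mult norm_eq_0 zero_iff)
qed

lemma cstar_embedding_inv_into:
  assumes S: "cstar_subalgebra A S" and inj: "inj_on f S"
  shows "cstar_embedding (cstar_image A S f) A (inv_into S f)"
proof -
  note simps = cstar_image_simps[OF inj, where M = A]
  note S' = subspaceD[OF subalgebraD(1)[OF S]] and S'' = subalgebraD[OF S]
  have "star_hom (cstar_image A S f) A (inv_into S f)"
    unfolding star_hom_def simps using S' S'' inj by (auto simp: simps)
  then show ?thesis
    using cstar_algebra_image[OF S inj] cstar_algebra_axioms inj
    by (auto simp: cstar_embedding_def cstar_embedding_axioms_def cstar_hom_def cstar_hom_axioms_def simps)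
qed

end

section \<open>Multiplier algebras\<close>

context cstar_algebra
begin

subsection \<open>Operator norm\<close>

definition opnorm :: "('a \<Rightarrow> 'a) \<Rightarrow> real" where
  "opnorm T = (SUP a\<in>{a \<in> carrier A. cnorm A a \<le> 1}. cnorm A (T a))"

lemma bounded_operatorI:
  assumes "\<And>x. x \<in> carrier A \<Longrightarrow> T x \<in> carrier A"
    and "\<And>x y. \<lbrakk>x \<in> carrier A; y \<in> carrier A\<rbrakk> \<Longrightarrow> T (x \<oplus> y) = T x \<oplus> T y"
    and "\<And>c x. x \<in> carrier A \<Longrightarrow> T (cscale A c x) = cscale A c (T x)"
    and "\<And>x. x \<in> carrier A \<Longrightarrow> cnorm A (T x) \<le> K * cnorm A x"
  shows "bounded_operator A (\<lambda>x\<in>carrier A. T x)"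
proof -
  have "\<exists>K. \<forall>x\<in>carrier A. cnorm A (T x) \<le> K * cnorm A x"
    using assms(4) by blast
  then show ?thesis
    using assms(1-3) by (simp add: bounded_operator_def)
qed

lemma bounded_operatorD:
  assumes "bounded_operator A T"
  shows "x \<in> carrier A \<Longrightarrow> T x \<in> carrier A"
    "\<lbrakk>x \<in> carrier A; y \<in> carrier A\<rbrakk> \<Longrightarrow> T (x \<oplus> y) = T x \<oplus> T y"
    "x \<in> carrier A \<Longrightarrow> T (cscale A c x) = cscale A c (T x)"
    "T \<in> extensional (carrier A)"
  using assms by (auto simp: bounded_operator_def PiE_def Pi_iff)

lemma norm_le_opnorm:
  assumes T: "bounded_operator A T" and a: "a \<in> carrier A" "cnorm A a \<le> 1"
  shows "cnorm A (T a) \<le> opnorm T"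
  unfolding opnorm_def
proof (rule cSUP_upper)
  obtain K where K: "\<And>x. x \<in> carrier A \<Longrightarrow> cnorm A (T x) \<le> K * cnorm A x"
    using T unfolding bounded_operator_def by blast
  show "bdd_above ((\<lambda>a. cnorm A (T a)) ` {a \<in> carrier A. cnorm A a \<le> 1})"
  proof (rule bdd_aboveI2)
    fix x assume "x \<in> {a \<in> carrier A. cnorm A a \<le> 1}"
    then have x: "x \<in> carrier A" "cnorm A x \<le> 1"
      by auto
    have "K * cnorm A x \<le> \<bar>K\<bar> * 1"
      using x norm_nonneg[OF x(1)] by (intro mult_mono) auto
    then show "cnorm A (T x) \<le> \<bar>K\<bar>"
      using K[OF x(1)] by simp
  qed
qed (use a in simp)

lemma opnorm_bound:
  assumes T: "bounded_operator A T" and x: "x \<in> carrier A"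
  shows "cnorm A (T x) \<le> opnorm T * cnorm A x"
proof (cases "cnorm A x = 0")
  case True
  have "T \<zero> = \<zero>"
    using bounded_operatorD(3)[OF T zero_closed, of 0] bounded_operatorD(1)[OF T zero_closed] by simp
  then show ?thesis
    using True x by (simp add: norm_eq_0)
next
  case False
  then have pos: "cnorm A x > 0"
    using norm_nonneg[OF x] by simp
  let ?u = "cscale A (of_real (1 / cnorm A x)) x"
  have "cnorm A (T ?u) \<le> opnorm T"
    using x pos norm_scale_real[OF x, of "1 / cnorm A x"] by (intro norm_le_opnorm[OF T]) auto
  then have "cnorm A (T x) / cnorm A x \<le> opnorm T"
    using x pos bounded_operatorD(1,3)[OF T x] norm_scale_real[of "T x" "1 / cnorm A x"] by simp
  then show ?thesis
    using pos by (simp add: pos_divide_le_eq)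
qed

lemma opnorm_le:
  assumes "\<And>x. x \<in> carrier A \<Longrightarrow> cnorm A (T x) \<le> K * cnorm A x" "K \<ge> 0"
  shows "opnorm T \<le> K"
  unfolding opnorm_def
proof (rule cSUP_least)
  show "{a \<in> carrier A. cnorm A a \<le> 1} \<noteq> {}"
    by (auto intro: exI[of _ \<zero>])
  fix a assume a: "a \<in> {a \<in> carrier A. cnorm A a \<le> 1}"
  then have "K * cnorm A a \<le> K * 1"
    using assms(2) by (intro mult_left_mono) auto
  then show "cnorm A (T a) \<le> K"
    using assms(1)[of a] a by simp
qed

lemma opnorm_nonneg:
  assumes T: "bounded_operator A T" shows "0 \<le> opnorm T"
  using norm_le_opnorm[OF T zero_closed] norm_nonneg[OF bounded_operatorD(1)[OF T zero_closed]] by simp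

subsection \<open>Double centralisers\<close>

abbreviation MA :: "(('a \<Rightarrow> 'a) \<times> ('a \<Rightarrow> 'a)) cstar" where
  "MA \<equiv> multiplier_algebra A"

lemma multiplier_simps:
  "carrier MA = double_centralisers A"
  "a \<in> carrier A \<Longrightarrow> fst (m \<otimes>\<^bsub>MA\<^esub> n) a = fst m (fst n a)"
  "a \<in> carrier A \<Longrightarrow> snd (m \<otimes>\<^bsub>MA\<^esub> n) a = snd n (snd m a)"
  "a \<in> carrier A \<Longrightarrow> fst \<zero>\<^bsub>MA\<^esub> a = \<zero>"
  "a \<in> carrier A \<Longrightarrow> snd \<zero>\<^bsub>MA\<^esub> a = \<zero>"
  "a \<in> carrier A \<Longrightarrow> fst (m \<oplus>\<^bsub>MA\<^esub> n) a = fst m a \<oplus> fst n a"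
  "a \<in> carrier A \<Longrightarrow> snd (m \<oplus>\<^bsub>MA\<^esub> n) a = snd m a \<oplus> snd n a"
  "a \<in> carrier A \<Longrightarrow> fst (cscale MA c m) a = cscale A c (fst m a)"
  "a \<in> carrier A \<Longrightarrow> snd (cscale MA c m) a = cscale A c (snd m a)"
  "a \<in> carrier A \<Longrightarrow> fst (cadj MA m) a = cadj A (snd m (cadj A a))"
  "a \<in> carrier A \<Longrightarrow> snd (cadj MA m) a = cadj A (fst m (cadj A a))"
  "cnorm MA m = opnorm (fst m)"
  by (simp_all add: multiplier_algebra_def opnorm_def)

lemma centraliserD:
  assumes "m \<in> double_centralisers A"
  shows "bounded_operator A (fst m)" "bounded_operator A (snd m)"
    "\<lbrakk>a \<in> carrier A; b \<in> carrier A\<rbrakk> \<Longrightarrow> fst m (a \<otimes> b) = fst m a \<otimes> b"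
    "\<lbrakk>a \<in> carrier A; b \<in> carrier A\<rbrakk> \<Longrightarrow> snd m (a \<otimes> b) = a \<otimes> snd m b"
    "\<lbrakk>a \<in> carrier A; b \<in> carrier A\<rbrakk> \<Longrightarrow> snd m a \<otimes> b = a \<otimes> fst m b"
  using assms by (auto simp: double_centralisers_def split_beta)

lemma centraliser_linear:
  assumes "m \<in> double_centralisers A"
  shows "a \<in> carrier A \<Longrightarrow> fst m a \<in> carrier A" "a \<in> carrier A \<Longrightarrow> snd m a \<in> carrier A"
    "\<lbrakk>x \<in> carrier A; y \<in> carrier A\<rbrakk> \<Longrightarrow> fst m (x \<oplus> y) = fst m x \<oplus> fst m y"
    "\<lbrakk>x \<in> carrier A; y \<in> carrier A\<rbrakk> \<Longrightarrow> snd m (x \<oplus> y) = snd m x \<oplus> snd m y"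
    "x \<in> carrier A \<Longrightarrow> fst m (cscale A c x) = cscale A c (fst m x)"
    "x \<in> carrier A \<Longrightarrow> snd m (cscale A c x) = cscale A c (snd m x)"
  using bounded_operatorD[OF centraliserD(1)[OF assms]] bounded_operatorD[OF centraliserD(2)[OF assms]]
  by auto

lemma centraliser_eqI:
  assumes "m \<in> double_centralisers A" "n \<in> double_centralisers A"
    and "\<And>a. a \<in> carrier A \<Longrightarrow> fst m a = fst n a" "\<And>a. a \<in> carrier A \<Longrightarrow> snd m a = snd n a"
  shows "m = n"
proof (rule prod_eqI)
  show "fst m = fst n"
    using assms bounded_operatorD(4)[OF centraliserD(1)] by (intro extensionalityI[of _ "carrier A"]) auto
  show "snd m = snd n"
    using assms bounded_operatorD(4)[OF centraliserD(2)] by (intro extensionalityI[of _ "carrier A"]) auto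
qed

lemma opnorm_centraliser_nonneg: "m \<in> double_centralisers A \<Longrightarrow> 0 \<le> opnorm (fst m)"
  using centraliserD(1) by (rule opnorm_nonneg)

lemma centraliser_fst_bound:
  "\<lbrakk>m \<in> double_centralisers A; a \<in> carrier A\<rbrakk> \<Longrightarrow> cnorm A (fst m a) \<le> opnorm (fst m) * cnorm A a"
  using centraliserD(1) by (rule opnorm_bound)

text \<open>\<open>\<parallel>R a\<parallel>\<^sup>2 = \<parallel>(R a) (R a)\<^sup>*\<parallel> = \<parallel>a L ((R a)\<^sup>*)\<parallel>\<close>.\<close>

lemma centraliser_snd_bound:
  assumes m: "m \<in> double_centralisers A" and a: "a \<in> carrier A"
  shows "cnorm A (snd m a) \<le> opnorm (fst m) * cnorm A a"
proof -
  let ?y = "snd m a"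
  have y: "?y \<in> carrier A"
    using centraliser_linear[OF m] a by auto
  have "(cnorm A ?y)\<^sup>2 = cnorm A (?y \<otimes> cadj A ?y)"
    using norm_adj_mult[of "cadj A ?y"] y by simp
  also have "\<dots> = cnorm A (a \<otimes> fst m (cadj A ?y))"
    using centraliserD(5)[OF m, of a "cadj A ?y"] a y by simp
  also have "\<dots> \<le> cnorm A a * cnorm A (fst m (cadj A ?y))"
    using a y centraliser_linear[OF m] by (intro norm_mult) auto
  also have "\<dots> \<le> cnorm A a * (opnorm (fst m) * cnorm A ?y)"
    using centraliser_fst_bound[OF m, of "cadj A ?y"] y a norm_nonneg by (intro mult_left_mono) auto
  finally have "cnorm A ?y * cnorm A ?y \<le> (opnorm (fst m) * cnorm A a) * cnorm A ?y"
    by (simp add: power2_eq_square ac_simps)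
  then show ?thesis
    using norm_nonneg[OF y] opnorm_centraliser_nonneg[OF m] norm_nonneg[OF a]
    by (cases "cnorm A ?y = 0") (auto simp: mult_le_cancel_right)
qed

lemma centraliserI:
  assumes L: "\<And>x. x \<in> carrier A \<Longrightarrow> L x \<in> carrier A"
    "\<And>x y. \<lbrakk>x \<in> carrier A; y \<in> carrier A\<rbrakk> \<Longrightarrow> L (x \<oplus> y) = L x \<oplus> L y"
    "\<And>c x. x \<in> carrier A \<Longrightarrow> L (cscale A c x) = cscale A c (L x)"
    "\<And>x. x \<in> carrier A \<Longrightarrow> cnorm A (L x) \<le> K * cnorm A x"
  and R: "\<And>x. x \<in> carrier A \<Longrightarrow> R x \<in> carrier A"
    "\<And>x y. \<lbrakk>x \<in> carrier A; y \<in> carrier A\<rbrakk> \<Longrightarrow> R (x \<oplus> y) = R x \<oplus> R y"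
    "\<And>c x. x \<in> carrier A \<Longrightarrow> R (cscale A c x) = cscale A c (R x)"
    "\<And>x. x \<in> carrier A \<Longrightarrow> cnorm A (R x) \<le> K' * cnorm A x"
  and "\<And>a b. \<lbrakk>a \<in> carrier A; b \<in> carrier A\<rbrakk> \<Longrightarrow> L (a \<otimes> b) = L a \<otimes> b"
    "\<And>a b. \<lbrakk>a \<in> carrier A; b \<in> carrier A\<rbrakk> \<Longrightarrow> R (a \<otimes> b) = a \<otimes> R b"
    "\<And>a b. \<lbrakk>a \<in> carrier A; b \<in> carrier A\<rbrakk> \<Longrightarrow> R a \<otimes> b = a \<otimes> L b"
  shows "(\<lambda>a\<in>carrier A. L a, \<lambda>a\<in>carrier A. R a) \<in> double_centralisers A"
proof -
  have "bounded_operator A (\<lambda>a\<in>carrier A. L a)"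
    by (rule bounded_operatorI[where K = K, OF L])
  moreover have "bounded_operator A (\<lambda>a\<in>carrier A. R a)"
    by (rule bounded_operatorI[where K = K', OF R])
  ultimately show ?thesis
    using assms(9-11) by (simp add: double_centralisers_def)
qed

lemma centraliser_zero: "\<zero>\<^bsub>MA\<^esub> \<in> double_centralisers A"
  unfolding multiplier_algebra_def by simp (rule centraliserI[where K = 0 and K' = 0], auto)

lemma centraliser_add:
  assumes m: "m \<in> double_centralisers A" and n: "n \<in> double_centralisers A"
  shows "m \<oplus>\<^bsub>MA\<^esub> n \<in> double_centralisers A"
    and "opnorm (fst (m \<oplus>\<^bsub>MA\<^esub> n)) \<le> opnorm (fst m) + opnorm (fst n)"
proof -
  note [simp] = centraliser_linear[OF m] centraliser_linear[OF n]
  have fst_le: "cnorm A (fst m x \<oplus> fst n x) \<le> (opnorm (fst m) + opnorm (fst n)) * cnorm A x"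
    if x: "x \<in> carrier A" for x
    using norm_triangle[of "fst m x" "fst n x"] centraliser_fst_bound[OF m x] centraliser_fst_bound[OF n x] x
    by (simp add: ring_distribs)
  have snd_le: "cnorm A (snd m x \<oplus> snd n x) \<le> (opnorm (fst m) + opnorm (fst n)) * cnorm A x"
    if x: "x \<in> carrier A" for x
    using norm_triangle[of "snd m x" "snd n x"] centraliser_snd_bound[OF m x] centraliser_snd_bound[OF n x] x
    by (simp add: ring_distribs)
  show "m \<oplus>\<^bsub>MA\<^esub> n \<in> double_centralisers A"
    unfolding multiplier_algebra_def
    by simp (rule centraliserI[OF _ _ _ fst_le _ _ _ snd_le],
      auto simp: scale_add centraliserD[OF m] centraliserD[OF n] distrib_left distrib_right a_ac)
  show "opnorm (fst (m \<oplus>\<^bsub>MA\<^esub> n)) \<le> opnorm (fst m) + opnorm (fst n)"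
    using fst_le opnorm_centraliser_nonneg[OF m] opnorm_centraliser_nonneg[OF n]
    by (intro opnorm_le) (auto simp: multiplier_simps)
qed

lemma centraliser_scale_bound:
  assumes m: "m \<in> double_centralisers A" and x: "x \<in> carrier A"
  shows "cnorm A (cscale A c (fst m x)) \<le> (cmod c * opnorm (fst m)) * cnorm A x"
    and "cnorm A (cscale A c (snd m x)) \<le> (cmod c * opnorm (fst m)) * cnorm A x"
  using mult_left_mono[OF centraliser_fst_bound[OF m x], of "cmod c"]
    mult_left_mono[OF centraliser_snd_bound[OF m x], of "cmod c"] x
  by (simp_all add: norm_scale centraliser_linear[OF m] mult.assoc)

lemma centraliser_scale:
  assumes m: "m \<in> double_centralisers A" shows "cscale MA c m \<in> double_centralisers A"
  unfolding multiplier_algebra_def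
  by simp (rule centraliserI[OF _ _ _ centraliser_scale_bound(1)[OF m] _ _ _ centraliser_scale_bound(2)[OF m]],
    auto simp: centraliser_linear[OF m] scale_add centraliserD[OF m] scale_mult_left scale_mult_right mult.commute)

lemma opnorm_scale_le:
  assumes m: "m \<in> double_centralisers A"
  shows "opnorm (fst (cscale MA c m)) \<le> cmod c * opnorm (fst m)"
  using centraliser_scale_bound(1)[OF m] opnorm_centraliser_nonneg[OF m]
  by (intro opnorm_le) (auto simp: multiplier_simps)

lemma opnorm_scale:
  assumes m: "m \<in> double_centralisers A"
  shows "opnorm (fst (cscale MA c m)) = cmod c * opnorm (fst m)"
proof (cases "c = 0")
  case True
  then show ?thesis
    using opnorm_scale_le[OF m, of c] opnorm_centraliser_nonneg[OF centraliser_scale[OF m, of c]] by simp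
next
  case False
  have "cscale MA (1 / c) (cscale MA c m) = m"
    using False m
    by (intro centraliser_eqI centraliser_scale) (simp_all add: multiplier_simps centraliser_linear[OF m])
  then have "opnorm (fst m) \<le> cmod (1 / c) * opnorm (fst (cscale MA c m))"
    using opnorm_scale_le[OF centraliser_scale[OF m], of "1 / c" c] by simp
  then have "cmod c * opnorm (fst m) \<le> opnorm (fst (cscale MA c m))"
    using False by (simp add: norm_divide field_simps)
  then show ?thesis
    using opnorm_scale_le[OF m, of c] by simp
qed

lemma centraliser_adj:
  assumes m: "m \<in> double_centralisers A"
  shows "cadj MA m \<in> double_centralisers A" and "opnorm (fst (cadj MA m)) \<le> opnorm (fst m)"
proof -
  note [simp] = centraliser_linear[OF m]
  have fst_le: "cnorm A (cadj A (snd m (cadj A x))) \<le> opnorm (fst m) * cnorm A x" if x: "x \<in> carrier A" for x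
    using centraliser_snd_bound[OF m, of "cadj A x"] x by simp
  have snd_le: "cnorm A (cadj A (fst m (cadj A x))) \<le> opnorm (fst m) * cnorm A x" if x: "x \<in> carrier A" for x
    using centraliser_fst_bound[OF m, of "cadj A x"] x by simp
  have "cadj A (fst m (cadj A a)) \<otimes> b = a \<otimes> cadj A (snd m (cadj A b))"
    if a: "a \<in> carrier A" and b: "b \<in> carrier A" for a b
    using arg_cong[OF centraliserD(5)[OF m, of "cadj A b" "cadj A a"], of "cadj A"] a b by (simp add: adj_mult)
  then show "cadj MA m \<in> double_centralisers A"
    unfolding multiplier_algebra_def
    by simp (rule centraliserI[OF _ _ _ fst_le _ _ _ snd_le],
      auto simp: adj_add adj_scale adj_mult centraliserD[OF m])
  show "opnorm (fst (cadj MA m)) \<le> opnorm (fst m)"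
    using fst_le opnorm_centraliser_nonneg[OF m] by (intro opnorm_le) (auto simp: multiplier_simps)
qed

lemma centraliser_mult:
  assumes m: "m \<in> double_centralisers A" and n: "n \<in> double_centralisers A"
  shows "m \<otimes>\<^bsub>MA\<^esub> n \<in> double_centralisers A"
    and "opnorm (fst (m \<otimes>\<^bsub>MA\<^esub> n)) \<le> opnorm (fst m) * opnorm (fst n)"
proof -
  note [simp] = centraliser_linear[OF m] centraliser_linear[OF n]
  note nonneg = opnorm_centraliser_nonneg[OF m] opnorm_centraliser_nonneg[OF n]
  have fst_le: "cnorm A (fst m (fst n x)) \<le> (opnorm (fst m) * opnorm (fst n)) * cnorm A x"
    if x: "x \<in> carrier A" for x
    using centraliser_fst_bound[OF m, of "fst n x"] x
      mult_left_mono[OF centraliser_fst_bound[OF n x] nonneg(1)] by (simp add: mult.assoc)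
  have snd_le: "cnorm A (snd n (snd m x)) \<le> (opnorm (fst n) * opnorm (fst m)) * cnorm A x"
    if x: "x \<in> carrier A" for x
    using centraliser_snd_bound[OF n, of "snd m x"] x
      mult_left_mono[OF centraliser_snd_bound[OF m x] nonneg(2)] by (simp add: mult.assoc)
  show "m \<otimes>\<^bsub>MA\<^esub> n \<in> double_centralisers A"
    unfolding multiplier_algebra_def
    by simp (rule centraliserI[OF _ _ _ fst_le _ _ _ snd_le], auto simp: centraliserD[OF m] centraliserD[OF n])
  show "opnorm (fst (m \<otimes>\<^bsub>MA\<^esub> n)) \<le> opnorm (fst m) * opnorm (fst n)"
    using fst_le nonneg by (intro opnorm_le) (auto simp: multiplier_simps)
qed

lemma opnorm_adj_mult:
  assumes m: "m \<in> double_centralisers A"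
  shows "opnorm (fst (cadj MA m \<otimes>\<^bsub>MA\<^esub> m)) = (opnorm (fst m))\<^sup>2"
proof (rule antisym)
  note nonneg = opnorm_centraliser_nonneg[OF m]
  note adj = centraliser_adj[OF m] and prod = centraliser_mult[OF centraliser_adj(1)[OF m] m]
  have "opnorm (fst (cadj MA m)) * opnorm (fst m) \<le> opnorm (fst m) * opnorm (fst m)"
    using adj nonneg by (intro mult_right_mono)
  then show "opnorm (fst (cadj MA m \<otimes>\<^bsub>MA\<^esub> m)) \<le> (opnorm (fst m))\<^sup>2"
    using prod(2) by (simp add: power2_eq_square)
  let ?N = "opnorm (fst (cadj MA m \<otimes>\<^bsub>MA\<^esub> m))"
  have N: "0 \<le> ?N"
    using prod(1) by (rule opnorm_centraliser_nonneg)
  have "cnorm A (fst m x) \<le> sqrt ?N * cnorm A x" if x: "x \<in> carrier A" for x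
  proof (rule power2_le_imp_le)
    let ?y = "fst m x"
    have y: "?y \<in> carrier A"
      using x by (rule centraliser_linear(1)[OF m])
    have "(cnorm A ?y)\<^sup>2 = cnorm A (snd m (cadj A ?y) \<otimes> x)"
      using norm_adj_mult[OF y] centraliserD(5)[OF m, of "cadj A ?y" x] x y by simp
    also have "\<dots> \<le> cnorm A (snd m (cadj A ?y)) * cnorm A x"
      by (rule norm_mult) (simp_all add: x y centraliser_linear[OF m])
    also have "cnorm A (snd m (cadj A ?y)) = cnorm A (fst (cadj MA m \<otimes>\<^bsub>MA\<^esub> m) x)"
      using x y centraliser_linear(2)[OF m, of "cadj A ?y"] by (simp add: multiplier_simps(2,10))
    also have "\<dots> * cnorm A x \<le> (?N * cnorm A x) * cnorm A x"
      by (intro mult_right_mono centraliser_fst_bound[OF prod(1) x] norm_nonneg[OF x])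
    also have "\<dots> = (sqrt ?N * cnorm A x)\<^sup>2"
      using N by (simp add: power_mult_distrib power2_eq_square[of "cnorm A x"])
    finally show "(cnorm A ?y)\<^sup>2 \<le> (sqrt ?N * cnorm A x)\<^sup>2" .
  qed (simp add: N norm_nonneg[OF x])
  then have "opnorm (fst m) \<le> sqrt ?N"
    using N by (intro opnorm_le) auto
  then show "(opnorm (fst m))\<^sup>2 \<le> ?N"
    using power_mono[of "opnorm (fst m)" "sqrt ?N" 2] N nonneg by simp
qed

lemma opnorm_eq_0_iff:
  assumes m: "m \<in> double_centralisers A"
  shows "opnorm (fst m) = 0 \<longleftrightarrow> m = \<zero>\<^bsub>MA\<^esub>"
proof
  assume zero: "opnorm (fst m) = 0"
  show "m = \<zero>\<^bsub>MA\<^esub>"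
  proof (rule centraliser_eqI[OF m centraliser_zero])
    fix a assume a: "a \<in> carrier A"
    have closed: "fst m a \<in> carrier A" "snd m a \<in> carrier A"
      using a centraliser_linear[OF m] by auto
    have "cnorm A (fst m a) = 0" "cnorm A (snd m a) = 0"
      using centraliser_fst_bound[OF m a] centraliser_snd_bound[OF m a] norm_nonneg[OF closed(1)] norm_nonneg[OF closed(2)]
      by (simp_all add: zero)
    then show "fst m a = fst \<zero>\<^bsub>MA\<^esub> a" "snd m a = snd \<zero>\<^bsub>MA\<^esub> a"
      using a closed by (simp_all add: multiplier_simps norm_eq_0)
  qed
next
  assume "m = \<zero>\<^bsub>MA\<^esub>"
  then have "opnorm (fst m) \<le> 0"
    by (intro opnorm_le) (simp_all add: multiplier_simps)
  then show "opnorm (fst m) = 0"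
    using opnorm_centraliser_nonneg[OF m] by simp
qed

subsection \<open>The multiplier algebra is a C*-algebra\<close>

lemma scale_minus_one_add_multiplier:
  assumes m: "m \<in> double_centralisers A"
  shows "cscale MA (-1) m \<oplus>\<^bsub>MA\<^esub> m = \<zero>\<^bsub>MA\<^esub>"
  using m by (intro centraliser_eqI centraliser_add centraliser_scale centraliser_zero)
    (simp_all add: multiplier_simps centraliser_linear[OF m] scale_minus_one l_neg)

lemma multiplier_abelian_group: "abelian_group MA"
proof (rule abelian_groupI)
  note eqs = multiplier_simps centraliser_linear
  show "x \<oplus>\<^bsub>MA\<^esub> y \<in> carrier MA" if "x \<in> carrier MA" "y \<in> carrier MA" for x y
    using that centraliser_add(1) by (simp add: multiplier_simps(1))
  show "\<zero>\<^bsub>MA\<^esub> \<in> carrier MA"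
    using centraliser_zero by (simp add: multiplier_simps(1))
  show "(x \<oplus>\<^bsub>MA\<^esub> y) \<oplus>\<^bsub>MA\<^esub> z = x \<oplus>\<^bsub>MA\<^esub> (y \<oplus>\<^bsub>MA\<^esub> z)"
    if "x \<in> carrier MA" "y \<in> carrier MA" "z \<in> carrier MA" for x y z
    using that unfolding multiplier_simps(1)
    by (intro centraliser_eqI centraliser_add(1)) (simp_all add: eqs a_assoc)
  show "x \<oplus>\<^bsub>MA\<^esub> y = y \<oplus>\<^bsub>MA\<^esub> x" if "x \<in> carrier MA" "y \<in> carrier MA" for x y
    using that unfolding multiplier_simps(1)
    by (intro centraliser_eqI centraliser_add(1)) (simp_all add: eqs a_comm)
  show "\<zero>\<^bsub>MA\<^esub> \<oplus>\<^bsub>MA\<^esub> x = x" if "x \<in> carrier MA" for x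
    using that unfolding multiplier_simps(1)
    by (intro centraliser_eqI centraliser_add(1) centraliser_zero) (simp_all add: eqs)
  show "\<exists>y\<in>carrier MA. y \<oplus>\<^bsub>MA\<^esub> x = \<zero>\<^bsub>MA\<^esub>" if "x \<in> carrier MA" for x
    using that scale_minus_one_add_multiplier[of x] centraliser_scale[of x "-1"]
    by (auto simp: multiplier_simps(1))
qed

lemma multiplier_diff:
  assumes "m \<in> carrier MA" "n \<in> carrier MA" "a \<in> carrier A"
  shows "fst (m \<ominus>\<^bsub>MA\<^esub> n) a = fst m a \<ominus> fst n a" "snd (m \<ominus>\<^bsub>MA\<^esub> n) a = snd m a \<ominus> snd n a"
proof -
  interpret M: abelian_group MA
    by (rule multiplier_abelian_group)
  have "\<ominus>\<^bsub>MA\<^esub> n = cscale MA (-1) n"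
    using assms(2) scale_minus_one_add_multiplier[of n] centraliser_scale[of n "-1"]
    by (intro M.minus_equality) (auto simp: multiplier_simps(1))
  then show "fst (m \<ominus>\<^bsub>MA\<^esub> n) a = fst m a \<ominus> fst n a" "snd (m \<ominus>\<^bsub>MA\<^esub> n) a = snd m a \<ominus> snd n a"
    using assms centraliser_linear[of n] by (simp_all add: M.minus_eq multiplier_simps diff_as_scale)
qed

lemma norm_multiplier_diff_apply:
  assumes m: "m \<in> carrier MA" and n: "n \<in> carrier MA" and a: "a \<in> carrier A"
  shows "cnorm A (fst m a \<ominus> fst n a) \<le> cnorm A a * cnorm MA (m \<ominus>\<^bsub>MA\<^esub> n)"
    and "cnorm A (snd m a \<ominus> snd n a) \<le> cnorm A a * cnorm MA (m \<ominus>\<^bsub>MA\<^esub> n)"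
proof -
  interpret M: abelian_group MA
    by (rule multiplier_abelian_group)
  have "m \<ominus>\<^bsub>MA\<^esub> n \<in> double_centralisers A"
    using M.minus_closed[OF m n] by (simp add: multiplier_simps(1))
  then show "cnorm A (fst m a \<ominus> fst n a) \<le> cnorm A a * cnorm MA (m \<ominus>\<^bsub>MA\<^esub> n)"
    "cnorm A (snd m a \<ominus> snd n a) \<le> cnorm A a * cnorm MA (m \<ominus>\<^bsub>MA\<^esub> n)"
    using centraliser_fst_bound[OF _ a] centraliser_snd_bound[OF _ a]
    by (simp_all add: multiplier_simps(12) mult.commute flip: multiplier_diff[OF m n a])
qed

lemma cCauchy_if_differences_bounded:
  assumes f: "cCauchy B f" and h: "\<And>n. h n \<in> carrier A" and K: "K \<ge> 0"
    and bound: "\<And>m n. cnorm A (h m \<ominus> h n) \<le> K * cnorm B (f m \<ominus>\<^bsub>B\<^esub> f n)"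
  shows "cCauchy A h"
  unfolding cCauchy_def
proof (intro conjI allI impI h)
  fix e :: real assume e: "e > 0"
  then have "e / (K + 1) > 0"
    using K by simp
  then obtain N where N: "\<And>m n. m \<ge> N \<Longrightarrow> n \<ge> N \<Longrightarrow> cnorm B (f m \<ominus>\<^bsub>B\<^esub> f n) < e / (K + 1)"
    using f unfolding cCauchy_def by blast
  have "cnorm A (h m \<ominus> h n) < e" if "m \<ge> N" "n \<ge> N" for m n
  proof -
    have "K * cnorm B (f m \<ominus>\<^bsub>B\<^esub> f n) \<le> K * (e / (K + 1))"
      using K N[OF that] by (intro mult_left_mono) auto
    also have "\<dots> < e"
      using K e by (simp add: field_simps)
    finally show ?thesis
      using bound[of m n] by simp
  qed
  then show "\<exists>N. \<forall>m\<ge>N. \<forall>n\<ge>N. cnorm A (h m \<ominus> h n) < e"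
    by blast
qed

lemma cCauchy_multiplier_bounded:
  assumes f: "cCauchy MA f"
  obtains N K where "\<And>n. n \<ge> N \<Longrightarrow> opnorm (fst (f n)) \<le> K"
proof -
  interpret M: abelian_group MA
    by (rule multiplier_abelian_group)
  have f_closed: "f n \<in> carrier MA" for n
    using f by (simp add: cCauchy_def)
  obtain N where N: "\<And>n. n \<ge> N \<Longrightarrow> cnorm MA (f n \<ominus>\<^bsub>MA\<^esub> f N) < 1"
    using f unfolding cCauchy_def by (meson order_refl zero_less_one)
  have "opnorm (fst (f n)) \<le> opnorm (fst (f N)) + 1" if n: "n \<ge> N" for n
  proof -
    have "f n = (f n \<ominus>\<^bsub>MA\<^esub> f N) \<oplus>\<^bsub>MA\<^esub> f N"
      using f_closed[of n] f_closed[of N] by (simp add: M.minus_eq M.a_assoc M.l_neg)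
    then have "opnorm (fst (f n)) \<le> opnorm (fst (f n \<ominus>\<^bsub>MA\<^esub> f N)) + opnorm (fst (f N))"
      using centraliser_add(2)[of "f n \<ominus>\<^bsub>MA\<^esub> f N" "f N"] M.minus_closed[OF f_closed f_closed] f_closed
      by (simp add: multiplier_simps(1))
    then show ?thesis
      using N[OF n] by (simp add: multiplier_simps(12))
  qed
  then show ?thesis
    using that by blast
qed

lemma pointwise_limit_centraliser:
  assumes f: "\<And>n. f n \<in> double_centralisers A"
    and L: "\<And>a. a \<in> carrier A \<Longrightarrow> clim A (\<lambda>n. fst (f n) a) (L a)"
    and R: "\<And>a. a \<in> carrier A \<Longrightarrow> clim A (\<lambda>n. snd (f n) a) (R a)"
    and K: "\<And>n. n \<ge> N \<Longrightarrow> opnorm (fst (f n)) \<le> K"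
  shows "(\<lambda>a\<in>carrier A. L a, \<lambda>a\<in>carrier A. R a) \<in> double_centralisers A"
proof (rule centraliserI[where K = K and K' = K])
  fix a b c assume a: "a \<in> carrier A"
  note [simp] = centraliser_linear[OF f]
  show "L a \<in> carrier A" "R a \<in> carrier A"
    using climD(2)[OF L[OF a]] climD(2)[OF R[OF a]] .
  have "opnorm (fst (f n)) * cnorm A a \<le> K * cnorm A a" if "n \<ge> N" for n
    using K[OF that] norm_nonneg[OF a] by (rule mult_right_mono)
  then show "cnorm A (L a) \<le> K * cnorm A a" "cnorm A (R a) \<le> K * cnorm A a"
    using centraliser_fst_bound[OF f a] centraliser_snd_bound[OF f a]
    by (blast intro: clim_norm_le[OF L[OF a], of N] clim_norm_le[OF R[OF a], of N] order_trans)+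
  show "L (cscale A c a) = cscale A c (L a)"
    using clim_scale[OF L[OF a], of c] L[of "cscale A c a"] a by (simp add: clim_unique)
  show "R (cscale A c a) = cscale A c (R a)"
    using clim_scale[OF R[OF a], of c] R[of "cscale A c a"] a by (simp add: clim_unique)
  assume b: "b \<in> carrier A"
  show "L (a \<oplus> b) = L a \<oplus> L b"
    using clim_add[OF L[OF a] L[OF b]] L[of "a \<oplus> b"] a b by (simp add: clim_unique)
  show "R (a \<oplus> b) = R a \<oplus> R b"
    using clim_add[OF R[OF a] R[OF b]] R[of "a \<oplus> b"] a b by (simp add: clim_unique)
  show "L (a \<otimes> b) = L a \<otimes> b"
    using clim_mult_right[OF L[OF a] b] L[of "a \<otimes> b"] a b by (simp add: clim_unique centraliserD[OF f])
  show "R (a \<otimes> b) = a \<otimes> R b"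
    using clim_mult_left[OF R[OF b] a] R[of "a \<otimes> b"] a b by (simp add: clim_unique centraliserD[OF f])
  show "R a \<otimes> b = a \<otimes> L b"
    using clim_mult_left[OF L[OF b] a] clim_mult_right[OF R[OF a] b] a b
    by (simp add: clim_unique centraliserD[OF f])
qed

lemma clim_multiplier_if_pointwise:
  assumes f: "cCauchy MA f" and x: "x \<in> carrier MA"
    and lim: "\<And>a. a \<in> carrier A \<Longrightarrow> clim A (\<lambda>n. fst (f n) a) (fst x a)"
  shows "clim MA f x"
proof -
  interpret M: abelian_group MA
    by (rule multiplier_abelian_group)
  have f_closed: "f n \<in> carrier MA" for n
    using f by (simp add: cCauchy_def)
  have "\<exists>N. \<forall>n\<ge>N. cnorm MA (f n \<ominus>\<^bsub>MA\<^esub> x) \<le> e" if e: "e > 0" for e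
  proof -
    obtain N where N: "\<forall>m\<ge>N. \<forall>n\<ge>N. cnorm MA (f m \<ominus>\<^bsub>MA\<^esub> f n) < e"
      using f e unfolding cCauchy_def by blast
    have "opnorm (fst (f n \<ominus>\<^bsub>MA\<^esub> x)) \<le> e" if n: "n \<ge> N" for n
    proof (rule opnorm_le)
      fix a assume a: "a \<in> carrier A"
      have "cnorm A (fst (f n) a \<ominus> fst x a) \<le> cnorm A a * e"
      proof (rule clim_norm_diff_le[OF lim[OF a], where N = N])
        fix k assume "k \<ge> N"
        then have "cnorm A a * cnorm MA (f n \<ominus>\<^bsub>MA\<^esub> f k) \<le> cnorm A a * e"
          using N n norm_nonneg[OF a] by (intro mult_left_mono) (auto intro: less_imp_le)
        then show "cnorm A (fst (f n) a \<ominus> fst (f k) a) \<le> cnorm A a * e"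
          using norm_multiplier_diff_apply(1)[OF f_closed f_closed a, of n k] by linarith
      qed (use climD(1)[OF lim[OF a]] in simp)
      then show "cnorm A (fst (f n \<ominus>\<^bsub>MA\<^esub> x) a) \<le> e * cnorm A a"
        by (simp add: multiplier_diff[OF f_closed x a] mult.commute)
    qed (use e in simp)
    then show ?thesis
      by (auto simp: multiplier_simps(12))
  qed
  moreover have "0 \<le> cnorm MA (f n \<ominus>\<^bsub>MA\<^esub> x)" for n
    using M.minus_closed[OF f_closed x] opnorm_centraliser_nonneg by (simp add: multiplier_simps(1,12))
  ultimately have "\<exists>N. \<forall>n\<ge>N. norm (cnorm MA (f n \<ominus>\<^bsub>MA\<^esub> x) - 0) \<le> e" if "e > 0" for e
    using that by simp
  then have "(\<lambda>n. cnorm MA (f n \<ominus>\<^bsub>MA\<^esub> x)) \<longlonglongrightarrow> 0"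
    by (intro LIMSEQ_I) (meson field_lbound_gt_zero le_less_trans)
  then show ?thesis
    using f_closed x by (simp add: clim_def)
qed

lemma multiplier_complete:
  assumes f: "cCauchy MA f" shows "\<exists>x. clim MA f x"
proof -
  have f_closed: "f n \<in> carrier MA" for n
    using f by (simp add: cCauchy_def)
  then have f_centraliser: "f n \<in> double_centralisers A" for n
    by (simp add: multiplier_simps(1))
  have "\<forall>a\<in>carrier A. \<exists>l. clim A (\<lambda>n. fst (f n) a) l"
    using cCauchy_if_differences_bounded[OF f _ norm_nonneg norm_multiplier_diff_apply(1)[OF f_closed f_closed]]
      cCauchy_converges centraliser_linear(1)[OF f_centraliser] by metis
  then obtain L where L: "\<And>a. a \<in> carrier A \<Longrightarrow> clim A (\<lambda>n. fst (f n) a) (L a)"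
    by metis
  have "\<forall>a\<in>carrier A. \<exists>l. clim A (\<lambda>n. snd (f n) a) l"
    using cCauchy_if_differences_bounded[OF f _ norm_nonneg norm_multiplier_diff_apply(2)[OF f_closed f_closed]]
      cCauchy_converges centraliser_linear(2)[OF f_centraliser] by metis
  then obtain R where R: "\<And>a. a \<in> carrier A \<Longrightarrow> clim A (\<lambda>n. snd (f n) a) (R a)"
    by metis
  obtain N K where K: "\<And>n. n \<ge> N \<Longrightarrow> opnorm (fst (f n)) \<le> K"
    using cCauchy_multiplier_bounded[OF f] by blast
  have "(\<lambda>a\<in>carrier A. L a, \<lambda>a\<in>carrier A. R a) \<in> carrier MA"
    unfolding multiplier_simps(1) by (rule pointwise_limit_centraliser[OF f_centraliser L R K])
  then have "clim MA f (\<lambda>a\<in>carrier A. L a, \<lambda>a\<in>carrier A. R a)"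
    by (rule clim_multiplier_if_pointwise[OF f]) (simp add: L)
  then show ?thesis
    by blast
qed

theorem cstar_algebra_multiplier: "cstar_algebra MA"
proof (rule cstar_algebraI[OF multiplier_abelian_group])
  note closed = centraliser_mult(1) centraliser_add(1) centraliser_scale centraliser_adj(1) centraliser_zero
  note eqs = multiplier_simps centraliser_linear distrib_left distrib_right scale_add add_scale adj_add adj_scale
    a_assoc mult_assoc
  fix x y z b c
  show "cscale MA c x \<in> carrier MA" "cadj MA x \<in> carrier MA" if "x \<in> carrier MA"
    using that centraliser_scale centraliser_adj by (simp_all add: multiplier_simps(1))
  show "x \<otimes>\<^bsub>MA\<^esub> y \<in> carrier MA" if "x \<in> carrier MA" "y \<in> carrier MA"
    using that centraliser_mult by (simp add: multiplier_simps(1))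
  show "(x \<otimes>\<^bsub>MA\<^esub> y) \<otimes>\<^bsub>MA\<^esub> z = x \<otimes>\<^bsub>MA\<^esub> (y \<otimes>\<^bsub>MA\<^esub> z)" "(x \<oplus>\<^bsub>MA\<^esub> y) \<otimes>\<^bsub>MA\<^esub> z = x \<otimes>\<^bsub>MA\<^esub> z \<oplus>\<^bsub>MA\<^esub> y \<otimes>\<^bsub>MA\<^esub> z"
    "z \<otimes>\<^bsub>MA\<^esub> (x \<oplus>\<^bsub>MA\<^esub> y) = z \<otimes>\<^bsub>MA\<^esub> x \<oplus>\<^bsub>MA\<^esub> z \<otimes>\<^bsub>MA\<^esub> y"
    if "x \<in> carrier MA" "y \<in> carrier MA" "z \<in> carrier MA"
    using that unfolding multiplier_simps(1) by - (intro centraliser_eqI closed; simp_all add: eqs)+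
  show "cscale MA c (x \<oplus>\<^bsub>MA\<^esub> y) = cscale MA c x \<oplus>\<^bsub>MA\<^esub> cscale MA c y"
    "cscale MA c x \<otimes>\<^bsub>MA\<^esub> y = cscale MA c (x \<otimes>\<^bsub>MA\<^esub> y)" "x \<otimes>\<^bsub>MA\<^esub> cscale MA c y = cscale MA c (x \<otimes>\<^bsub>MA\<^esub> y)"
    "cadj MA (x \<oplus>\<^bsub>MA\<^esub> y) = cadj MA x \<oplus>\<^bsub>MA\<^esub> cadj MA y" "cadj MA (x \<otimes>\<^bsub>MA\<^esub> y) = cadj MA y \<otimes>\<^bsub>MA\<^esub> cadj MA x"
    if "x \<in> carrier MA" "y \<in> carrier MA"
    using that unfolding multiplier_simps(1) by - (intro centraliser_eqI closed; simp_all add: eqs)+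
  show "cscale MA (b + c) x = cscale MA b x \<oplus>\<^bsub>MA\<^esub> cscale MA c x" "cscale MA b (cscale MA c x) = cscale MA (b * c) x"
    "cscale MA 1 x = x" "cadj MA (cadj MA x) = x" "cadj MA (cscale MA c x) = cscale MA (cnj c) (cadj MA x)"
    if "x \<in> carrier MA"
    using that unfolding multiplier_simps(1) by - (intro centraliser_eqI closed; simp_all add: eqs)+
  show "0 \<le> cnorm MA x" "cnorm MA (cscale MA c x) = cmod c * cnorm MA x"
    "cnorm MA (cadj MA x \<otimes>\<^bsub>MA\<^esub> x) = (cnorm MA x)\<^sup>2" "cnorm MA x = 0 \<longleftrightarrow> x = \<zero>\<^bsub>MA\<^esub>"
    if "x \<in> carrier MA"
    using that unfolding multiplier_simps(1,12)
    by (rule opnorm_centraliser_nonneg opnorm_scale opnorm_adj_mult opnorm_eq_0_iff)+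
  show "cnorm MA (x \<oplus>\<^bsub>MA\<^esub> y) \<le> cnorm MA x + cnorm MA y" "cnorm MA (x \<otimes>\<^bsub>MA\<^esub> y) \<le> cnorm MA x * cnorm MA y"
    if "x \<in> carrier MA" "y \<in> carrier MA"
    using that centraliser_add(2) centraliser_mult(2) by (simp_all add: multiplier_simps(1,12))
qed (rule multiplier_complete)

subsection \<open>The canonical embedding\<close>

definition embed_multiplier :: "'a \<Rightarrow> ('a \<Rightarrow> 'a) \<times> ('a \<Rightarrow> 'a)" where
  "embed_multiplier a = (\<lambda>x\<in>carrier A. a \<otimes> x, \<lambda>x\<in>carrier A. x \<otimes> a)"

lemma embed_multiplier_closed: "a \<in> carrier A \<Longrightarrow> embed_multiplier a \<in> double_centralisers A"
  unfolding embed_multiplier_def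
  by (rule centraliserI[where K = "cnorm A a" and K' = "cnorm A a"])
    (auto simp: distrib_left distrib_right scale_mult_left scale_mult_right mult_assoc norm_mult
      intro: norm_mult order_trans[OF norm_mult])

lemma embed_multiplier_apply:
  "x \<in> carrier A \<Longrightarrow> fst (embed_multiplier a) x = a \<otimes> x"
  "x \<in> carrier A \<Longrightarrow> snd (embed_multiplier a) x = x \<otimes> a"
  by (simp_all add: embed_multiplier_def)

lemma star_hom_embed_multiplier: "star_hom A MA embed_multiplier"
proof -
  note closed = centraliser_mult(1) centraliser_add(1) centraliser_scale centraliser_adj(1) embed_multiplier_closed
  note eqs = multiplier_simps embed_multiplier_apply distrib_left distrib_right scale_mult_left scale_mult_right
    adj_mult mult_assoc
  have "embed_multiplier (x \<oplus> y) = embed_multiplier x \<oplus>\<^bsub>MA\<^esub> embed_multiplier y"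
    "embed_multiplier (x \<otimes> y) = embed_multiplier x \<otimes>\<^bsub>MA\<^esub> embed_multiplier y"
    if "x \<in> carrier A" "y \<in> carrier A" for x y
    using that by - (intro centraliser_eqI closed; simp_all add: eqs)+
  moreover have "embed_multiplier (cscale A c x) = cscale MA c (embed_multiplier x)"
    "embed_multiplier (cadj A x) = cadj MA (embed_multiplier x)" if "x \<in> carrier A" for x c
    using that by - (intro centraliser_eqI closed; simp_all add: eqs)+
  ultimately show ?thesis
    by (simp add: star_hom_def multiplier_simps(1) embed_multiplier_closed)
qed

lemma norm_embed_multiplier:
  assumes a: "a \<in> carrier A" shows "cnorm MA (embed_multiplier a) = cnorm A a"
proof (rule antisym)
  note m = embed_multiplier_closed[OF a]
  show "cnorm MA (embed_multiplier a) \<le> cnorm A a"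
    unfolding multiplier_simps(12) using a norm_nonneg[OF a]
    by (intro opnorm_le) (simp_all add: embed_multiplier_apply norm_mult)
  have "cnorm A (a \<otimes> cadj A a) \<le> cnorm MA (embed_multiplier a) * cnorm A a"
    using centraliser_fst_bound[OF m, of "cadj A a"] a by (simp add: multiplier_simps(12) embed_multiplier_apply)
  then have "cnorm A a * cnorm A a \<le> cnorm MA (embed_multiplier a) * cnorm A a"
    using norm_adj_mult[of "cadj A a"] a by (simp add: power2_eq_square)
  moreover have "0 \<le> cnorm MA (embed_multiplier a)"
    using opnorm_centraliser_nonneg[OF m] by (simp add: multiplier_simps(12))
  ultimately show "cnorm A a \<le> cnorm MA (embed_multiplier a)"
    using norm_nonneg[OF a] by (cases "cnorm A a = 0") (auto simp: mult_le_cancel_right)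
qed

lemma cstar_embedding_multiplier: "cstar_embedding A MA embed_multiplier"
  using cstar_algebra_axioms cstar_algebra_multiplier star_hom_embed_multiplier norm_embed_multiplier
  by (simp add: cstar_embedding_def cstar_embedding_axioms_def cstar_hom_def cstar_hom_axioms_def)

end

section \<open>Fejer means of torus actions\<close>

subsection \<open>Characters at roots of unity\<close>

definition torus_char :: "nat \<Rightarrow> (nat \<Rightarrow> complex) \<Rightarrow> (nat \<Rightarrow> int) \<Rightarrow> complex" where
  "torus_char k z n = (\<Prod>i<k. z i powi n i)"

definition root_of_unity :: "nat \<Rightarrow> nat \<Rightarrow> complex" where
  "root_of_unity N a = cis (2 * pi * real a / real N)"

definition root_indices :: "nat \<Rightarrow> nat \<Rightarrow> (nat \<Rightarrow> nat) set" where
  "root_indices k N = PiE {..<k} (\<lambda>_. {..<N})"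

definition root_point :: "nat \<Rightarrow> nat \<Rightarrow> (nat \<Rightarrow> nat) \<Rightarrow> nat \<Rightarrow> complex" where
  "root_point k N a = (\<lambda>i. if i < k then root_of_unity N (a i) else 1)"

lemma one_in_torus: "(\<lambda>i. 1) \<in> torus k"
  by (simp add: torus_def)

lemma finite_root_indices [simp]: "finite (root_indices k N)"
  by (simp add: root_indices_def finite_PiE)

lemma card_root_indices: "card (root_indices k N) = N ^ k"
  by (simp add: root_indices_def card_PiE)

lemma norm_root_of_unity [simp]: "cmod (root_of_unity N a) = 1"
  by (simp add: root_of_unity_def)

lemma root_point_in_torus [simp]: "root_point k N a \<in> torus k"
  by (simp add: root_point_def torus_def)

lemma norm_torus_char: "z \<in> torus k \<Longrightarrow> cmod (torus_char k z n) = 1"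
  by (simp add: torus_char_def torus_def prod_norm[symmetric] norm_power_int)

lemma torus_char_mult:
  assumes "z \<in> torus k"
  shows "torus_char k z m * torus_char k z n = torus_char k z (\<lambda>i. m i + n i)"
proof -
  have "z i \<noteq> 0" if "i < k" for i
    using assms that unfolding torus_def by force
  then show ?thesis
    by (simp add: torus_char_def prod.distrib[symmetric] power_int_add)
qed

lemma sum_root_of_unity_powi:
  assumes "\<bar>n\<bar> < int N"
  shows "(\<Sum>a<N. root_of_unity N a powi n) = (if n = 0 then of_nat N else 0)"
proof (cases "n = 0")
  case False
  define w where "w = cis (2 * pi * of_int n / real N)"
  have N: "N > 0"
    using assms by linarith
  have "w \<noteq> 1"
  proof
    assume "w = 1"
    then obtain j :: int where "2 * pi * of_int n / real N = of_int j * (2 * pi)"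
      unfolding w_def cis_eq_1_iff by blast
    then have "of_int n = of_int j * real N"
      using N by (simp add: field_simps)
    then have "n = j * int N"
      by (metis of_int_eq_iff of_int_mult of_int_of_nat_eq)
    then have "int N dvd n"
      by simp
    then show False
      using False assms zdvd_imp_le[of "int N" "\<bar>n\<bar>"] by simp
  qed
  have "(\<Sum>a<N. root_of_unity N a powi n) = (\<Sum>a<N. w ^ a)"
    by (intro sum.cong) (auto simp: root_of_unity_def cis_power_int w_def Complex.DeMoivre mult_ac)
  also have "\<dots> = (w ^ N - 1) / (w - 1)"
    using \<open>w \<noteq> 1\<close> by (rule geometric_sum)
  also have "w ^ N = 1"
    using N cis_multiple_2pi[of "of_int n"] by (simp add: w_def Complex.DeMoivre)
  finally show ?thesis
    using False by simp
qed (simp add: root_of_unity_def)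

lemma sum_root_indices_prod:
  fixes f :: "nat \<Rightarrow> nat \<Rightarrow> 'a::comm_semiring_1"
  shows "(\<Sum>a\<in>root_indices k N. \<Prod>i<k. f i (a i)) = (\<Prod>i<k. \<Sum>y<N. f i y)"
  unfolding root_indices_def by (rule prod_sum_PiE[symmetric]) auto

lemma sum_torus_char_root_points:
  assumes "\<And>i. i < k \<Longrightarrow> \<bar>n i\<bar> < int N"
  shows "(\<Sum>a\<in>root_indices k N. torus_char k (root_point k N a) n)
    = (if \<forall>i<k. n i = 0 then of_nat (N ^ k) else 0)"
proof -
  have "(\<Sum>a\<in>root_indices k N. torus_char k (root_point k N a) n)
      = (\<Sum>a\<in>root_indices k N. \<Prod>i<k. root_of_unity N (a i) powi n i)"
    by (simp add: torus_char_def root_point_def)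
  also have "\<dots> = (\<Prod>i<k. \<Sum>y<N. root_of_unity N y powi n i)"
    by (rule sum_root_indices_prod)
  also have "\<dots> = (\<Prod>i<k. if n i = 0 then of_nat N else 0)"
    using assms by (intro prod.cong) (auto simp: sum_root_of_unity_powi)
  also have "\<dots> = (if \<forall>i<k. n i = 0 then of_nat (N ^ k) else 0)"
    by auto
  finally show ?thesis .
qed

subsection \<open>The Fejer kernel\<close>

definition fejer :: "nat \<Rightarrow> complex \<Rightarrow> real" where
  "fejer m w = (cmod (\<Sum>j<m. w ^ j))\<^sup>2 / real m"

definition fejer_weight :: "nat \<Rightarrow> nat \<Rightarrow> nat \<Rightarrow> (nat \<Rightarrow> nat) \<Rightarrow> real" where
  "fejer_weight k m N a = (\<Prod>i<k. fejer m (root_of_unity N (a i))) / real (N ^ k)"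

definition fejer_pairs :: "nat \<Rightarrow> nat \<Rightarrow> (nat \<Rightarrow> nat \<times> nat) set" where
  "fejer_pairs k m = PiE {..<k} (\<lambda>_. {..<m} \<times> {..<m})"

definition fejer_frequency :: "nat \<Rightarrow> (nat \<Rightarrow> nat \<times> nat) \<Rightarrow> nat \<Rightarrow> int" where
  "fejer_frequency k q = (\<lambda>i. if i < k then int (snd (q i)) - int (fst (q i)) else 0)"

lemma fejer_nonneg: "0 \<le> fejer m w"
  by (simp add: fejer_def)

lemma fejer_eq_sum:
  assumes "cmod w = 1"
  shows "complex_of_real (fejer m w)
    = (\<Sum>p\<in>{..<m} \<times> {..<m}. 1 / of_nat m * w powi (int (fst p) - int (snd p)))"
proof -
  have w: "w \<noteq> 0" "cnj w = inverse w"
    using assms complex_norm_square[of w] inverse_unique[of w "cnj w"] by force+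
  let ?S = "\<Sum>j<m. w ^ j"
  have "complex_of_real (fejer m w) = ?S * cnj ?S / of_nat m"
    using complex_norm_square[of ?S] by (simp add: fejer_def del: cnj_sum)
  also have "cnj ?S = (\<Sum>j<m. w powi (- int j))"
    by (simp add: w power_int_minus power_inverse)
  also have "?S * (\<Sum>j<m. w powi (- int j)) = (\<Sum>i<m. \<Sum>j<m. w powi (int i) * w powi (- int j))"
    by (simp add: sum_product)
  also have "\<dots> = (\<Sum>p\<in>{..<m} \<times> {..<m}. w powi (int (fst p) - int (snd p)))"
    unfolding sum.cartesian_product using w
    by (intro sum.cong) (auto simp: power_int_diff power_int_minus field_simps)
  finally show ?thesis
    by (simp add: sum_distrib_left sum_divide_distrib)
qed

lemma sum_fejer_roots_of_unity:
  assumes m: "m > 0" "m \<le> N"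
  shows "(\<Sum>y<N. fejer m (root_of_unity N y)) = real N"
proof -
  have "complex_of_real (\<Sum>y<N. fejer m (root_of_unity N y))
      = (\<Sum>y<N. \<Sum>p\<in>{..<m} \<times> {..<m}. 1 / of_nat m * root_of_unity N y powi (int (fst p) - int (snd p)))"
    by (simp add: fejer_eq_sum)
  also have "\<dots> = (\<Sum>p\<in>{..<m} \<times> {..<m}. \<Sum>y<N. 1 / of_nat m * root_of_unity N y powi (int (fst p) - int (snd p)))"
    by (rule sum.swap)
  also have "\<dots> = (\<Sum>p\<in>{..<m} \<times> {..<m}. 1 / of_nat m * (if int (fst p) - int (snd p) = 0 then of_nat N else 0))"
    unfolding sum_distrib_left[symmetric] using m
    by (intro sum.cong refl arg_cong2[where f = "(*)"] sum_root_of_unity_powi) auto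
  also have "\<dots> = (\<Sum>i<m. \<Sum>j<m. 1 / of_nat m * (if i = j then of_nat N else 0))"
    unfolding sum.cartesian_product by (intro sum.cong) auto
  also have "\<dots> = (\<Sum>i<m. of_nat N / of_nat m)"
    by (intro sum.cong refl) (subst sum_distrib_left[symmetric], simp)
  also have "\<dots> = complex_of_real (real N)"
    using m by simp
  finally show ?thesis
    by (simp only: of_real_eq_iff)
qed

lemma fejer_far_from_1:
  assumes w: "cmod w = 1" "\<delta> \<le> cmod (1 - w)" and \<delta>: "\<delta> > 0"
  shows "fejer m w \<le> 4 / (real m * \<delta>\<^sup>2)"
proof -
  let ?S = "\<Sum>j<m. w ^ j"
  have "?S * (1 - w) = 1 - w ^ m"
    by (simp add: sum_gp_strict)
  then have "cmod ?S * cmod (1 - w) \<le> 2"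
    using norm_triangle_ineq4[of 1 "w ^ m"] w(1) by (simp add: norm_mult[symmetric] norm_power)
  moreover have "cmod ?S * \<delta> \<le> cmod ?S * cmod (1 - w)"
    using w by (intro mult_left_mono) auto
  ultimately have "(cmod ?S * \<delta>)\<^sup>2 \<le> 2\<^sup>2"
    using \<delta> by (intro power_mono) auto
  then have "(cmod ?S)\<^sup>2 \<le> 4 / \<delta>\<^sup>2"
    using \<delta> by (simp add: power_mult_distrib pos_le_divide_eq)
  then have "(cmod ?S)\<^sup>2 / real m \<le> 4 / \<delta>\<^sup>2 / real m"
    by (intro divide_right_mono) auto
  then show ?thesis
    by (simp add: fejer_def mult.commute)
qed

lemma finite_fejer_pairs [simp]: "finite (fejer_pairs k m)"
  by (simp add: fejer_pairs_def finite_PiE)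

lemma card_fejer_pairs: "card (fejer_pairs k m) = m ^ k * m ^ k"
  by (simp add: fejer_pairs_def card_PiE power_mult_distrib)

lemma fejer_weight_nonneg: "0 \<le> fejer_weight k m N a"
  by (simp add: fejer_weight_def fejer_nonneg prod_nonneg)

lemma sum_fejer_weight:
  assumes "m > 0" "m \<le> N" shows "(\<Sum>a\<in>root_indices k N. fejer_weight k m N a) = 1"
  using assms by (simp add: fejer_weight_def sum_divide_distrib[symmetric]
      sum_root_indices_prod[of "\<lambda>_ y. fejer m (root_of_unity N y)"] sum_fejer_roots_of_unity)

lemma fejer_weight_eq_sum_torus_char:
  "complex_of_real (fejer_weight k m N a)
    = (\<Sum>q\<in>fejer_pairs k m. 1 / of_nat (m ^ k)
        * (torus_char k (root_point k N a) (\<lambda>i. - fejer_frequency k q i) / of_nat (N ^ k)))"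
proof -
  have "complex_of_real (\<Prod>i<k. fejer m (root_of_unity N (a i)))
      = (\<Prod>i<k. \<Sum>p\<in>{..<m} \<times> {..<m}. 1 / of_nat m * root_of_unity N (a i) powi (int (fst p) - int (snd p)))"
    by (simp add: fejer_eq_sum)
  also have "\<dots> = (\<Sum>q\<in>fejer_pairs k m. \<Prod>i<k.
      1 / of_nat m * root_of_unity N (a i) powi (int (fst (q i)) - int (snd (q i))))"
    unfolding fejer_pairs_def by (rule prod_sum_PiE) auto
  also have "\<dots> = (\<Sum>q\<in>fejer_pairs k m. 1 / of_nat (m ^ k)
      * torus_char k (root_point k N a) (\<lambda>i. - fejer_frequency k q i))"
    by (simp add: prod.distrib torus_char_def root_point_def fejer_frequency_def power_divide prod_dividef)
  finally show ?thesis
    by (simp add: fejer_weight_def sum_divide_distrib)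
qed

lemma sum_fejer_weight_far:
  assumes m: "m > 0" "m \<le> N" and \<delta>: "\<delta> > 0" and i: "i < k"
  shows "(\<Sum>a\<in>root_indices k N. if \<delta> \<le> cmod (1 - root_point k N a i) then fejer_weight k m N a else 0)
    \<le> 4 / (real m * \<delta>\<^sup>2)"
proof -
  let ?c = "4 / (real m * \<delta>\<^sup>2)"
  define g where "g j y = (if j = i then ?c else fejer m (root_of_unity N y))" for j y
  have "(if \<delta> \<le> cmod (1 - root_point k N a i) then fejer_weight k m N a else 0)
      \<le> (\<Prod>j<k. g j (a j)) / real (N ^ k)" for a
  proof (cases "\<delta> \<le> cmod (1 - root_point k N a i)")
    case True
    have "(\<Prod>j<k. fejer m (root_of_unity N (a j))) \<le> (\<Prod>j<k. g j (a j))"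
      using True i m \<delta>
      by (intro prod_mono) (auto simp: g_def fejer_nonneg root_point_def intro!: fejer_far_from_1)
    then show ?thesis
      using True by (simp add: fejer_weight_def divide_right_mono)
  next
    case False
    have "0 \<le> (\<Prod>j<k. g j (a j))"
      using \<delta> by (intro prod_nonneg) (auto simp: g_def fejer_nonneg)
    then show ?thesis
      using False by simp
  qed
  then have "(\<Sum>a\<in>root_indices k N. if \<delta> \<le> cmod (1 - root_point k N a i) then fejer_weight k m N a else 0)
      \<le> (\<Sum>a\<in>root_indices k N. (\<Prod>j<k. g j (a j)) / real (N ^ k))"
    by (intro sum_mono)
  also have "\<dots> = (\<Prod>j<k. \<Sum>y<N. g j y) / real (N ^ k)"
    by (simp add: sum_divide_distrib[symmetric] sum_root_indices_prod)
  also have "(\<Prod>j<k. \<Sum>y<N. g j y) = (\<Prod>j<k. real N * (if j = i then ?c else 1))"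
    using m by (intro prod.cong) (auto simp: g_def sum_fejer_roots_of_unity)
  also have "\<dots> / real (N ^ k) = ?c"
    using i m by (simp add: prod.distrib prod.delta)
  finally show ?thesis .
qed

lemma sum_fejer_weight_le_near_plus_far:
  assumes m: "m > 0" "m \<le> N" and \<delta>: "\<delta> > 0" and B: "B \<ge> 0"
  shows "(\<Sum>a\<in>root_indices k N. fejer_weight k m N a
      * (\<epsilon> + (\<Sum>i<k. if \<delta> \<le> cmod (1 - root_point k N a i) then B else 0)))
    \<le> \<epsilon> + real k * (B * (4 / (real m * \<delta>\<^sup>2)))"
proof -
  let ?A = "root_indices k N" and ?w = "fejer_weight k m N"
  let ?far = "\<lambda>a i. \<delta> \<le> cmod (1 - root_point k N a i)"
  have "(\<Sum>a\<in>?A. ?w a * (\<Sum>i<k. if ?far a i then B else 0)) = (\<Sum>a\<in>?A. \<Sum>i<k. B * (if ?far a i then ?w a else 0))"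
    unfolding sum_distrib_left by (intro sum.cong) auto
  also have "\<dots> = (\<Sum>i<k. B * (\<Sum>a\<in>?A. if ?far a i then ?w a else 0))"
    unfolding sum_distrib_left by (rule sum.swap)
  also have "\<dots> \<le> (\<Sum>i<k. B * (4 / (real m * \<delta>\<^sup>2)))"
    using sum_fejer_weight_far[OF m \<delta>] B by (intro sum_mono mult_left_mono) auto
  finally have far: "(\<Sum>a\<in>?A. ?w a * (\<Sum>i<k. if ?far a i then B else 0)) \<le> real k * (B * (4 / (real m * \<delta>\<^sup>2)))"
    by simp
  have "(\<Sum>a\<in>?A. ?w a * \<epsilon>) = \<epsilon>"
    using sum_fejer_weight[OF m, of k] by (simp flip: sum_distrib_right)
  with far show ?thesis
    by (simp add: distrib_left sum.distrib)
qed

subsection \<open>Torus actions on C*-algebras\<close>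

definition fourier_coefficient ::
    "nat \<Rightarrow> 'a cstar \<Rightarrow> ((nat \<Rightarrow> complex) \<Rightarrow> 'a \<Rightarrow> 'a) \<Rightarrow> (nat \<Rightarrow> int) \<Rightarrow> nat \<Rightarrow> 'a \<Rightarrow> 'a" where
  "fourier_coefficient k A \<beta> n N x = finsum A
     (\<lambda>a. cscale A (torus_char k (root_point k N a) (\<lambda>i. - n i) / of_nat (N ^ k)) (\<beta> (root_point k N a) x))
     (root_indices k N)"

definition fejer_mean ::
    "nat \<Rightarrow> 'a cstar \<Rightarrow> ((nat \<Rightarrow> complex) \<Rightarrow> 'a \<Rightarrow> 'a) \<Rightarrow> nat \<Rightarrow> nat \<Rightarrow> 'a \<Rightarrow> 'a" where
  "fejer_mean k A \<beta> m N x = finsum A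
     (\<lambda>a. cscale A (of_real (fejer_weight k m N a)) (\<beta> (root_point k N a) x)) (root_indices k N)"

locale torus_cstar_algebra = cstar_algebra A for A :: "'a cstar" (structure) +
  fixes k :: nat and \<beta> :: "(nat \<Rightarrow> complex) \<Rightarrow> 'a \<Rightarrow> 'a"
  assumes action: "torus_action k A \<beta>"
begin

abbreviation coefficient :: "(nat \<Rightarrow> int) \<Rightarrow> nat \<Rightarrow> 'a \<Rightarrow> 'a" where
  "coefficient \<equiv> fourier_coefficient k A \<beta>"

abbreviation mean :: "nat \<Rightarrow> nat \<Rightarrow> 'a \<Rightarrow> 'a" where
  "mean \<equiv> fejer_mean k A \<beta>"

lemma action_hom: "z \<in> torus k \<Longrightarrow> cstar_hom A A (\<beta> z)"
  using action cstar_algebra_axioms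
  by (simp add: cstar_hom_def cstar_hom_axioms_def torus_action_def star_automorphism_def)

lemmas action_closed [simp] = cstar_hom.hom_closed[OF action_hom]
lemmas action_add = cstar_hom.hom_add[OF action_hom]
lemmas action_scale = cstar_hom.hom_scale[OF action_hom]
lemmas action_zero [simp] = cstar_hom.hom_zero[OF action_hom]
lemmas action_diff = cstar_hom.hom_diff[OF action_hom]
lemmas norm_action_le = cstar_hom.contractive[OF action_hom]

lemma action_one:
  assumes x: "x \<in> carrier A" shows "\<beta> (\<lambda>i. 1) x = x"
proof (rule inj_onD)
  show "inj_on (\<beta> (\<lambda>i. 1)) (carrier A)"
    using action one_in_torus by (auto simp: torus_action_def star_automorphism_def bij_betw_def)
  have "\<forall>z\<in>torus k. \<forall>w\<in>torus k. \<beta> (\<lambda>i. z i * w i) x = \<beta> z (\<beta> w x)"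
    using action x unfolding torus_action_def by blast
  from this[rule_format, OF one_in_torus one_in_torus]
  show "\<beta> (\<lambda>i. 1) (\<beta> (\<lambda>i. 1) x) = \<beta> (\<lambda>i. 1) x"
    by simp
qed (use x one_in_torus in simp_all)

lemma coefficient_closed [simp]: "x \<in> carrier A \<Longrightarrow> coefficient n N x \<in> carrier A"
  unfolding fourier_coefficient_def by (intro finsum_closed) auto

lemma coefficient_zero: "coefficient n N \<zero> = \<zero>"
  unfolding fourier_coefficient_def by (intro add.finprod_one_eqI) simp

lemma coefficient_add:
  "\<lbrakk>x \<in> carrier A; y \<in> carrier A\<rbrakk> \<Longrightarrow> coefficient n N (x \<oplus> y) = coefficient n N x \<oplus> coefficient n N y"
  unfolding fourier_coefficient_def
  by (subst finsum_addf[symmetric]) (simp_all add: action_add scale_add Pi_iff)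

lemma coefficient_scale:
  "x \<in> carrier A \<Longrightarrow> coefficient n N (cscale A c x) = cscale A c (coefficient n N x)"
  unfolding fourier_coefficient_def
  by (subst finsum_scale) (simp_all add: action_scale Pi_iff mult.commute)

lemma norm_coefficient_le:
  assumes x: "x \<in> carrier A" and N: "N > 0" shows "cnorm A (coefficient n N x) \<le> cnorm A x"
proof -
  let ?z = "root_point k N" and ?t = "\<lambda>a. torus_char k (root_point k N a) (\<lambda>i. - n i) / of_nat (N ^ k)"
  have "cnorm A (coefficient n N x) \<le> (\<Sum>a\<in>root_indices k N. cnorm A (cscale A (?t a) (\<beta> (?z a) x)))"
    unfolding fourier_coefficient_def using x by (intro norm_finsum) auto
  also have "\<dots> \<le> (\<Sum>a\<in>root_indices k N. 1 / real (N ^ k) * cnorm A x)"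
  proof (rule sum_mono)
    fix a
    have "cmod (?t a) = 1 / real (N ^ k)"
      by (simp add: norm_divide norm_torus_char norm_power)
    then have "cnorm A (cscale A (?t a) (\<beta> (?z a) x)) = 1 / real (N ^ k) * cnorm A (\<beta> (?z a) x)"
      using x by (simp only: norm_scale action_closed root_point_in_torus)
    also have "\<dots> \<le> 1 / real (N ^ k) * cnorm A x"
      using x by (intro mult_left_mono norm_action_le) auto
    finally show "cnorm A (cscale A (?t a) (\<beta> (?z a) x)) \<le> 1 / real (N ^ k) * cnorm A x" .
  qed
  also have "\<dots> = cnorm A x"
    using N by (simp add: card_root_indices)
  finally show ?thesis .
qed

lemma coefficient_homogeneous:
  assumes x: "x \<in> carrier A" and homogeneous: "\<And>z. z \<in> torus k \<Longrightarrow> \<beta> z x = cscale A (torus_char k z m) x"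
    and N: "N > 0" "\<And>i. i < k \<Longrightarrow> \<bar>m i - n i\<bar> < int N"
  shows "coefficient n N x = (if \<forall>i<k. m i = n i then x else \<zero>)"
proof -
  let ?t = "\<lambda>a. torus_char k (root_point k N a) (\<lambda>i. m i - n i) / of_nat (N ^ k)"
  have "coefficient n N x = finsum A (\<lambda>a. cscale A (?t a) x) (root_indices k N)"
    unfolding fourier_coefficient_def using x
    by (intro finsum_cong') (auto simp: homogeneous torus_char_mult)
  also have "\<dots> = cscale A (sum ?t (root_indices k N)) x"
    using x by (intro finsum_scale_sum) auto
  also have "sum ?t (root_indices k N) = (if \<forall>i<k. m i = n i then 1 else 0)"
    using N(1) by (simp only: sum_divide_distrib[symmetric] sum_torus_char_root_points[OF N(2)]) simp
  also have "cscale A \<dots> x = (if \<forall>i<k. m i = n i then x else \<zero>)"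
    using x by (simp only: if_distrib[of "\<lambda>c. cscale A c x"] scale_one scale_zero)
  finally show ?thesis .
qed

lemma mean_closed [simp]: "x \<in> carrier A \<Longrightarrow> mean m N x \<in> carrier A"
  unfolding fejer_mean_def by (intro finsum_closed) auto

lemma mean_diff:
  "\<lbrakk>x \<in> carrier A; y \<in> carrier A\<rbrakk> \<Longrightarrow> mean m N (x \<ominus> y) = mean m N x \<ominus> mean m N y"
  unfolding fejer_mean_def by (subst finsum_diff) (simp_all add: action_diff scale_diff Pi_iff)

lemma norm_mean_le:
  assumes x: "x \<in> carrier A" and m: "m > 0" "m \<le> N" shows "cnorm A (mean m N x) \<le> cnorm A x"
proof -
  let ?z = "root_point k N" and ?w = "fejer_weight k m N"
  have "cnorm A (mean m N x) \<le> (\<Sum>a\<in>root_indices k N. cnorm A (cscale A (of_real (?w a)) (\<beta> (?z a) x)))"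
    unfolding fejer_mean_def using x by (intro norm_finsum) auto
  also have "\<dots> \<le> (\<Sum>a\<in>root_indices k N. ?w a * cnorm A x)"
    using x by (intro sum_mono) (simp add: norm_scale fejer_weight_nonneg mult_left_mono norm_action_le)
  also have "\<dots> = cnorm A x"
    using sum_fejer_weight[OF m, of k] by (simp flip: sum_distrib_right)
  finally show ?thesis .
qed

lemma mean_eq_sum_coefficients:
  assumes x: "x \<in> carrier A"
  shows "mean m N x = finsum A (\<lambda>q. cscale A (1 / of_nat (m ^ k)) (coefficient (fejer_frequency k q) N x))
    (fejer_pairs k m)"
proof -
  let ?c = "\<lambda>q a. torus_char k (root_point k N a) (\<lambda>i. - fejer_frequency k q i) / of_nat (N ^ k)"
  let ?b = "\<lambda>a. \<beta> (root_point k N a) x"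
  have "mean m N x = finsum A (\<lambda>a. finsum A (\<lambda>q. cscale A (1 / of_nat (m ^ k) * ?c q a) (?b a)) (fejer_pairs k m))
      (root_indices k N)"
    unfolding fejer_mean_def fejer_weight_eq_sum_torus_char using x
    by (intro finsum_cong') (simp_all add: finsum_scale_sum)
  also have "\<dots> = finsum A (\<lambda>q. finsum A (\<lambda>a. cscale A (1 / of_nat (m ^ k) * ?c q a) (?b a)) (root_indices k N))
      (fejer_pairs k m)"
    using x by (intro finsum_swap) auto
  also have "\<dots> = finsum A (\<lambda>q. cscale A (1 / of_nat (m ^ k)) (coefficient (fejer_frequency k q) N x)) (fejer_pairs k m)"
  proof (rule finsum_cong')
    show "finsum A (\<lambda>a. cscale A (1 / of_nat (m ^ k) * ?c q a) (?b a)) (root_indices k N)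
        = cscale A (1 / of_nat (m ^ k)) (coefficient (fejer_frequency k q) N x)" for q
      unfolding fourier_coefficient_def using x by (subst finsum_scale) (simp_all add: Pi_iff)
  qed (use x in simp_all)
  finally show ?thesis .
qed

lemma norm_mean_le_coefficients:
  assumes x: "x \<in> carrier A" and m: "m > 0"
    and K: "\<And>q. q \<in> fejer_pairs k m \<Longrightarrow> cnorm A (coefficient (fejer_frequency k q) N x) \<le> K"
  shows "cnorm A (mean m N x) \<le> real (m ^ k) * K"
proof -
  let ?t = "\<lambda>q. cscale A (of_real (1 / real (m ^ k))) (coefficient (fejer_frequency k q) N x)"
  have "cnorm A (mean m N x) \<le> (\<Sum>q\<in>fejer_pairs k m. cnorm A (?t q))"
    unfolding mean_eq_sum_coefficients[OF x] using x by (simp add: norm_finsum)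
  also have "\<dots> \<le> (\<Sum>q\<in>fejer_pairs k m. 1 / real (m ^ k) * K)"
  proof (rule sum_mono)
    fix q assume q: "q \<in> fejer_pairs k m"
    have "cnorm A (?t q) = 1 / real (m ^ k) * cnorm A (coefficient (fejer_frequency k q) N x)"
      using norm_scale_real[OF coefficient_closed[OF x], of "1 / real (m ^ k)"] by simp
    also have "\<dots> \<le> 1 / real (m ^ k) * K"
      using K[OF q] by (intro mult_left_mono) auto
    finally show "cnorm A (?t q) \<le> 1 / real (m ^ k) * K" .
  qed
  also have "\<dots> = real (m ^ k) * K"
    using m by (simp add: card_fejer_pairs)
  finally show ?thesis .
qed

lemma norm_diff_action_le_near_plus_far:
  assumes x: "x \<in> carrier A" and z: "z \<in> torus k" and \<epsilon>: "\<epsilon> \<ge> 0"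
    and near: "(\<forall>i<k. cmod (1 - z i) < \<delta>) \<Longrightarrow> cnorm A (x \<ominus> \<beta> z x) \<le> \<epsilon>"
  shows "cnorm A (x \<ominus> \<beta> z x) \<le> \<epsilon> + (\<Sum>i<k. if \<delta> \<le> cmod (1 - z i) then 2 * cnorm A x else 0)"
proof (cases "\<forall>i<k. cmod (1 - z i) < \<delta>")
  case True
  have "0 \<le> (\<Sum>i<k. if \<delta> \<le> cmod (1 - z i) then 2 * cnorm A x else 0)"
    using norm_nonneg[OF x] by (intro sum_nonneg) auto
  then show ?thesis
    using near[OF True] by linarith
next
  case False
  then obtain i where i: "i < k" "\<delta> \<le> cmod (1 - z i)"
    by (auto simp: not_less)
  have "2 * cnorm A x \<le> (\<Sum>i<k. if \<delta> \<le> cmod (1 - z i) then 2 * cnorm A x else 0)"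
    using member_le_sum[of i "{..<k}" "\<lambda>i. if \<delta> \<le> cmod (1 - z i) then 2 * cnorm A x else 0"] i norm_nonneg[OF x]
    by simp
  moreover have "cnorm A (x \<ominus> \<beta> z x) \<le> 2 * cnorm A x"
    using norm_triangle_diff[OF x, of "\<beta> z x"] norm_action_le[OF z x] x z by simp
  ultimately show ?thesis
    using \<epsilon> by linarith
qed

lemma norm_diff_mean_le:
  assumes x: "x \<in> carrier A" and m: "m > 0" "m \<le> N" and \<delta>: "\<delta> > 0" and \<epsilon>: "\<epsilon> \<ge> 0"
    and near: "\<And>z. \<lbrakk>z \<in> torus k; \<forall>i<k. cmod (1 - z i) < \<delta>\<rbrakk> \<Longrightarrow> cnorm A (x \<ominus> \<beta> z x) \<le> \<epsilon>"
  shows "cnorm A (x \<ominus> mean m N x) \<le> \<epsilon> + real k * (2 * cnorm A x * (4 / (real m * \<delta>\<^sup>2)))"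
proof -
  let ?A = "root_indices k N" and ?z = "root_point k N" and ?w = "fejer_weight k m N"
  have "x \<ominus> mean m N x
      = finsum A (\<lambda>a. cscale A (of_real (?w a)) x) ?A \<ominus> finsum A (\<lambda>a. cscale A (of_real (?w a)) (\<beta> (?z a) x)) ?A"
    using x sum_fejer_weight[OF m, of k] by (simp add: finsum_scale_sum fejer_mean_def flip: of_real_sum)
  also have "\<dots> = finsum A (\<lambda>a. cscale A (of_real (?w a)) x \<ominus> cscale A (of_real (?w a)) (\<beta> (?z a) x)) ?A"
    using x by (intro finsum_diff) auto
  also have "\<dots> = finsum A (\<lambda>a. cscale A (of_real (?w a)) (x \<ominus> \<beta> (?z a) x)) ?A"
    using x by (simp add: scale_diff)
  also have "cnorm A \<dots> \<le> (\<Sum>a\<in>?A. cnorm A (cscale A (of_real (?w a)) (x \<ominus> \<beta> (?z a) x)))"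
    using x by (intro norm_finsum) auto
  also have "\<dots> \<le> (\<Sum>a\<in>?A. ?w a * (\<epsilon> + (\<Sum>i<k. if \<delta> \<le> cmod (1 - ?z a i) then 2 * cnorm A x else 0)))"
  proof (rule sum_mono)
    fix a
    have "cnorm A (cscale A (of_real (?w a)) (x \<ominus> \<beta> (?z a) x)) = ?w a * cnorm A (x \<ominus> \<beta> (?z a) x)"
      using x norm_scale_real[of "x \<ominus> \<beta> (?z a) x" "?w a"] fejer_weight_nonneg[of k m N a] by simp
    also have "\<dots> \<le> ?w a * (\<epsilon> + (\<Sum>i<k. if \<delta> \<le> cmod (1 - ?z a i) then 2 * cnorm A x else 0))"
      using near \<epsilon> by (intro mult_left_mono norm_diff_action_le_near_plus_far[OF x] fejer_weight_nonneg) simp_all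
    finally show "cnorm A (cscale A (of_real (?w a)) (x \<ominus> \<beta> (?z a) x))
        \<le> ?w a * (\<epsilon> + (\<Sum>i<k. if \<delta> \<le> cmod (1 - ?z a i) then 2 * cnorm A x else 0))" .
  qed
  also have "\<dots> \<le> \<epsilon> + real k * (2 * cnorm A x * (4 / (real m * \<delta>\<^sup>2)))"
    using m \<delta> norm_nonneg[OF x] by (intro sum_fejer_weight_le_near_plus_far) auto
  finally show ?thesis .
qed

lemma continuous_near_one:
  assumes cont: "continuous_map (top_of_set (torus k)) (ctopology A) (\<lambda>z. \<beta> z x)"
    and x: "x \<in> carrier A" and e: "e > 0"
  obtains \<delta> where "\<delta> > 0"
    "\<And>z. \<lbrakk>z \<in> torus k; \<forall>i<k. cmod (1 - z i) < \<delta>\<rbrakk> \<Longrightarrow> cnorm A (x \<ominus> \<beta> z x) < e"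
proof (rule ccontr)
  assume "\<not> thesis"
  then have "\<exists>z\<in>torus k. (\<forall>i<k. cmod (1 - z i) < inverse (real (Suc n))) \<and> \<not> cnorm A (x \<ominus> \<beta> z x) < e" for n
    using that[of "inverse (real (Suc n))"] by auto
  then obtain z where z: "\<And>n. z n \<in> torus k" "\<And>n i. i < k \<Longrightarrow> cmod (1 - z n i) < inverse (real (Suc n))"
      "\<And>n. \<not> cnorm A (x \<ominus> \<beta> (z n) x) < e"
    by metis
  have "(\<lambda>n. z n i) \<longlonglongrightarrow> 1" for i
  proof (cases "i < k")
    case True
    then have "(\<lambda>n. 1 - z n i) \<longlonglongrightarrow> 0"
      using z(2) by (intro Lim_null_comparison[OF _ LIMSEQ_inverse_real_of_nat]) (simp add: less_imp_le)
    from tendsto_diff[OF tendsto_const[of 1] this] show ?thesis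
      by simp
  qed (use z(1) in \<open>simp add: torus_def\<close>)
  then have "limitin (top_of_set (torus k)) z (\<lambda>i. 1) sequentially"
    using z(1) one_in_torus
    by (simp add: limitin_subtopology limitin_componentwise flip: euclidean_product_topology)
  from continuous_map_limit[OF cont this] have "limitin (ctopology A) (\<lambda>n. \<beta> (z n) x) x sequentially"
    by (simp add: o_def action_one[OF x])
  then have "clim A (\<lambda>n. \<beta> (z n) x) x"
    using x z(1) by (auto simp: clim_iff_limitin)
  then have "(\<lambda>n. cnorm A (\<beta> (z n) x \<ominus> x)) \<longlonglongrightarrow> 0"
    by (rule climD)
  then obtain n where "cnorm A (\<beta> (z n) x \<ominus> x) < e"
    using order_tendstoD(2)[OF _ e] eventually_happens by force
  then show False
    using z(1) z(3)[of n] x norm_minus_commute[of x "\<beta> (z n) x"] by simp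
qed

theorem fejer_theorem:
  assumes cont: "continuous_map (top_of_set (torus k)) (ctopology A) (\<lambda>z. \<beta> z x)"
    and x: "x \<in> carrier A" and e: "e > 0"
  obtains m where "m > 0" "\<And>N. m \<le> N \<Longrightarrow> cnorm A (x \<ominus> mean m N x) \<le> e"
proof -
  obtain \<delta> where \<delta>: "\<delta> > 0"
    and near: "\<And>z. \<lbrakk>z \<in> torus k; \<forall>i<k. cmod (1 - z i) < \<delta>\<rbrakk> \<Longrightarrow> cnorm A (x \<ominus> \<beta> z x) < e / 2"
    using continuous_near_one[OF cont x, of "e / 2"] e by auto
  let ?c = "real k * (2 * cnorm A x * (4 / \<delta>\<^sup>2))"
  obtain m :: nat where m: "?c / (e / 2) < real m"
    using reals_Archimedean2 by blast
  moreover have "0 \<le> ?c / (e / 2)"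
    using e norm_nonneg[OF x] by simp
  ultimately have m_pos: "m > 0"
    by linarith
  have "?c / real m \<le> e / 2"
    using m m_pos e \<delta> by (simp add: field_simps)
  then have "real k * (2 * cnorm A x * (4 / (real m * \<delta>\<^sup>2))) \<le> e / 2"
    by (simp add: mult_ac)
  moreover have "cnorm A (x \<ominus> mean m N x) \<le> e / 2 + real k * (2 * cnorm A x * (4 / (real m * \<delta>\<^sup>2)))"
    if "m \<le> N" for N
    using e less_imp_le[OF near] by (intro norm_diff_mean_le x m_pos that \<delta>) simp_all
  ultimately have "cnorm A (x \<ominus> mean m N x) \<le> e" if "m \<le> N" for N
    using that by fastforce
  then show ?thesis
    using that m_pos by blast
qed

end

lemma hom_fourier_coefficient:
  assumes A: "torus_cstar_algebra A k \<alpha>" and B: "torus_cstar_algebra B k \<beta>" and f: "cstar_hom A B f"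
    and x: "x \<in> carrier A" and equivariant: "\<And>z. z \<in> torus k \<Longrightarrow> f (\<alpha> z x) = \<beta> z (f x)"
  shows "f (fourier_coefficient k A \<alpha> n N x) = fourier_coefficient k B \<beta> n N (f x)"
proof -
  interpret A: torus_cstar_algebra A k \<alpha>
    by (rule A)
  interpret B: torus_cstar_algebra B k \<beta>
    by (rule B)
  interpret f: cstar_hom A B f
    by (rule f)
  let ?z = "root_point k N" and ?t = "\<lambda>a. torus_char k (root_point k N a) (\<lambda>i. - n i) / of_nat (N ^ k)"
  have "f (fourier_coefficient k A \<alpha> n N x) = finsum B (\<lambda>a. f (cscale A (?t a) (\<alpha> (?z a) x))) (root_indices k N)"
    unfolding fourier_coefficient_def using x by (intro f.hom_finsum) simp_all
  also have "\<dots> = fourier_coefficient k B \<beta> n N (f x)"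
    unfolding fourier_coefficient_def using x
    by (intro B.finsum_cong') (simp_all add: f.hom_scale equivariant)
  finally show ?thesis .
qed

section \<open>Cuntz--Krieger families\<close>

definition degree_gap :: "(nat \<Rightarrow> nat) \<Rightarrow> (nat \<Rightarrow> nat) \<Rightarrow> nat \<Rightarrow> nat" where
  "degree_gap p q = (\<lambda>i. max (p i) (q i) - p i)"

lemma degree_gap_in_degrees: "\<lbrakk>p \<in> degrees k; q \<in> degrees k\<rbrakk> \<Longrightarrow> degree_gap p q \<in> degrees k"
  by (simp add: degree_gap_def degrees_def)

lemma add_degree_gap: "p i + degree_gap p q i = max (p i) (q i)"
  by (simp add: degree_gap_def)

locale ck_family = higher_rank_graph k \<Lambda> + C: cstar_algebra C
  for k :: nat and \<Lambda> :: "'l kgraph" and C :: "'c cstar" (structure) and s :: "'l \<Rightarrow> 'c" +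
  assumes row_finite: "row_finite_no_sources k \<Lambda>" and ck: "cuntz_krieger_family k \<Lambda> C s"
begin

abbreviation monomial :: "'l \<Rightarrow> 'l \<Rightarrow> 'c" where "monomial l m \<equiv> s l \<otimes> cadj C (s m)"

lemma s_closed [simp, intro]: "l \<in> kmor \<Lambda> \<Longrightarrow> s l \<in> carrier C"
  using ck by (auto simp: cuntz_krieger_family_def)

lemma rng_vertex [simp]: "l \<in> kmor \<Lambda> \<Longrightarrow> krng \<Lambda> l \<in> kvertices \<Lambda>"
  by (simp add: kvertices_eq_range)

lemma src_vertex [simp]: "l \<in> kmor \<Lambda> \<Longrightarrow> ksrc \<Lambda> l \<in> kvertices \<Lambda>"
  using rng_vertex[of "ksrc \<Lambda> l"] by (simp add: src_closed rng_src)

lemma vertex_mor [simp]: "v \<in> kvertices \<Lambda> \<Longrightarrow> v \<in> kmor \<Lambda>"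
  by (simp add: kvertices_def)

lemma
  shows vertex_idem: "v \<in> kvertices \<Lambda> \<Longrightarrow> s v \<otimes> s v = s v"
    and vertex_adj: "v \<in> kvertices \<Lambda> \<Longrightarrow> cadj C (s v) = s v"
    and vertex_orthogonal: "\<lbrakk>v \<in> kvertices \<Lambda>; w \<in> kvertices \<Lambda>; v \<noteq> w\<rbrakk> \<Longrightarrow> s v \<otimes> s w = \<zero>"
    and s_comp: "\<lbrakk>l \<in> kmor \<Lambda>; m \<in> kmor \<Lambda>; ksrc \<Lambda> l = krng \<Lambda> m\<rbrakk> \<Longrightarrow> s l \<otimes> s m = s (kcomp \<Lambda> l m)"
    and adj_s_mult_s: "l \<in> kmor \<Lambda> \<Longrightarrow> cadj C (s l) \<otimes> s l = s (ksrc \<Lambda> l)"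
    and vertex_eq_sum: "\<lbrakk>v \<in> kvertices \<Lambda>; n \<in> degrees k\<rbrakk>
        \<Longrightarrow> s v = finsum C (\<lambda>l. monomial l l) (kpaths_to \<Lambda> v n)"
  using ck by (auto simp: cuntz_krieger_family_def)

lemma finite_paths: "\<lbrakk>v \<in> kvertices \<Lambda>; n \<in> degrees k\<rbrakk> \<Longrightarrow> finite (kpaths_to \<Lambda> v n)"
  using row_finite by (simp add: row_finite_no_sources_def)

lemma pathsD: "l \<in> kpaths_to \<Lambda> v n \<Longrightarrow> l \<in> kmor \<Lambda>" "l \<in> kpaths_to \<Lambda> v n \<Longrightarrow> krng \<Lambda> l = v"
  "l \<in> kpaths_to \<Lambda> v n \<Longrightarrow> kdeg \<Lambda> l = n"
  by (auto simp: kpaths_to_def)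

lemma rng_mult_s: "l \<in> kmor \<Lambda> \<Longrightarrow> s (krng \<Lambda> l) \<otimes> s l = s l"
  by (simp add: s_comp rng_closed src_rng comp_id_left)

lemma s_mult_src: "l \<in> kmor \<Lambda> \<Longrightarrow> s l \<otimes> s (ksrc \<Lambda> l) = s l"
  by (simp add: s_comp src_closed rng_src comp_id_right)

lemma src_mult_adj_s: "l \<in> kmor \<Lambda> \<Longrightarrow> s (ksrc \<Lambda> l) \<otimes> cadj C (s l) = cadj C (s l)"
  by (metis C.adj_mult vertex_adj s_closed s_mult_src src_closed src_vertex)

lemma adj_s_mult_rng: "l \<in> kmor \<Lambda> \<Longrightarrow> cadj C (s l) \<otimes> s (krng \<Lambda> l) = cadj C (s l)"
  by (metis C.adj_mult vertex_adj s_closed rng_mult_s rng_closed rng_vertex)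

lemma monomial_closed [simp, intro]: "\<lbrakk>l \<in> kmor \<Lambda>; m \<in> kmor \<Lambda>\<rbrakk> \<Longrightarrow> monomial l m \<in> carrier C"
  by simp

lemma monomial_adj: "\<lbrakk>l \<in> kmor \<Lambda>; m \<in> kmor \<Lambda>\<rbrakk> \<Longrightarrow> cadj C (monomial l m) = monomial m l"
  by (simp add: C.adj_mult)

lemma rng_mult_monomial: "\<lbrakk>l \<in> kmor \<Lambda>; m \<in> kmor \<Lambda>\<rbrakk> \<Longrightarrow> s (krng \<Lambda> l) \<otimes> monomial l m = monomial l m"
  by (simp add: C.mult_assoc[symmetric] rng_mult_s rng_closed)

lemma range_projection_mult_s: "l \<in> kmor \<Lambda> \<Longrightarrow> monomial l l \<otimes> s l = s l"
  by (simp add: C.mult_assoc adj_s_mult_s s_mult_src)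

lemma adj_s_mult_range_projection: "l \<in> kmor \<Lambda> \<Longrightarrow> cadj C (s l) \<otimes> monomial l l = cadj C (s l)"
  by (simp add: C.mult_assoc[symmetric] adj_s_mult_s src_mult_adj_s)

lemma projection_range: "l \<in> kmor \<Lambda> \<Longrightarrow> projection C (monomial l l)"
  unfolding projection_def selfadjoint_def
  using C.mult_assoc[of "monomial l l" "s l" "cadj C (s l)"] by (simp add: monomial_adj range_projection_mult_s)

lemma monomial_eq_zero:
  assumes "l \<in> kmor \<Lambda>" "m \<in> kmor \<Lambda>" "ksrc \<Lambda> l \<noteq> ksrc \<Lambda> m"
  shows "monomial l m = \<zero>"
proof -
  have "monomial l m = (s l \<otimes> s (ksrc \<Lambda> l)) \<otimes> (s (ksrc \<Lambda> m) \<otimes> cadj C (s m))"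
    using assms by (simp add: s_mult_src src_mult_adj_s)
  also have "\<dots> = s l \<otimes> ((s (ksrc \<Lambda> l) \<otimes> s (ksrc \<Lambda> m)) \<otimes> cadj C (s m))"
    using assms by (simp add: C.mult_assoc src_closed)
  finally show ?thesis
    using assms by (simp add: vertex_orthogonal)
qed

lemma range_projections_orthogonal:
  assumes l: "l \<in> kmor \<Lambda>" and m: "m \<in> kmor \<Lambda>" and "kdeg \<Lambda> l = kdeg \<Lambda> m" "krng \<Lambda> l = krng \<Lambda> m" "l \<noteq> m"
  shows "monomial l l \<otimes> monomial m m = \<zero>"
proof (rule C.projections_orthogonal[of "kpaths_to \<Lambda> (krng \<Lambda> l) (kdeg \<Lambda> l)" "\<lambda>j. monomial j j" m l])
  let ?F = "kpaths_to \<Lambda> (krng \<Lambda> l) (kdeg \<Lambda> l)"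
  show "finite ?F"
    using l by (simp add: finite_paths deg_closed)
  show "m \<in> ?F" "l \<in> ?F" "m \<noteq> l"
    using assms by (auto simp: kpaths_to_def)
  fix j assume j: "j \<in> ?F"
  note j' = pathsD[OF j]
  show "projection C (monomial j j)"
    using j'(1) by (rule projection_range)
  have "finsum C (\<lambda>l. monomial l l) ?F = s (krng \<Lambda> j)"
    using vertex_eq_sum[OF rng_vertex[OF l] deg_closed[OF l]] j'(2) by simp
  then show "finsum C (\<lambda>l. monomial l l) ?F \<otimes> monomial j j = monomial j j"
    using rng_mult_monomial[OF j'(1) j'(1)] by simp
qed

lemma adj_s_mult_s_orthogonal:
  assumes l: "l \<in> kmor \<Lambda>" and m: "m \<in> kmor \<Lambda>" and deg: "kdeg \<Lambda> l = kdeg \<Lambda> m" and ne: "l \<noteq> m"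
  shows "cadj C (s l) \<otimes> s m = \<zero>"
proof (cases "krng \<Lambda> l = krng \<Lambda> m")
  case False
  have "cadj C (s l) \<otimes> s m = (cadj C (s l) \<otimes> s (krng \<Lambda> l)) \<otimes> (s (krng \<Lambda> m) \<otimes> s m)"
    using l m by (simp add: adj_s_mult_rng rng_mult_s)
  also have "\<dots> = cadj C (s l) \<otimes> ((s (krng \<Lambda> l) \<otimes> s (krng \<Lambda> m)) \<otimes> s m)"
    using l m by (simp add: C.mult_assoc rng_closed)
  finally show ?thesis
    using l m False by (simp add: vertex_orthogonal)
next
  case True
  have "cadj C (s l) \<otimes> s m = (cadj C (s l) \<otimes> monomial l l) \<otimes> (monomial m m \<otimes> s m)"
    using l m by (simp only: adj_s_mult_range_projection range_projection_mult_s)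
  also have "\<dots> = cadj C (s l) \<otimes> ((monomial l l \<otimes> monomial m m) \<otimes> s m)"
    using l m by (simp add: C.mult_assoc)
  finally show ?thesis
    using range_projections_orthogonal[OF l m deg True ne] l m by simp
qed

lemma monomial_expand:
  assumes l: "l \<in> kmor \<Lambda>" and m: "m \<in> kmor \<Lambda>" and src: "ksrc \<Lambda> l = ksrc \<Lambda> m" and n: "n \<in> degrees k"
  shows "monomial l m = finsum C (\<lambda>a. monomial (kcomp \<Lambda> l a) (kcomp \<Lambda> m a)) (kpaths_to \<Lambda> (ksrc \<Lambda> l) n)"
proof -
  let ?F = "kpaths_to \<Lambda> (ksrc \<Lambda> l) n"
  have F: "finite ?F" "(\<lambda>a. monomial a a) \<in> ?F \<rightarrow> carrier C"
    using finite_paths[OF src_vertex[OF l] n] pathsD by blast+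
  have "monomial l m = s l \<otimes> (s (ksrc \<Lambda> l) \<otimes> cadj C (s m))"
    using l m src by (simp add: src_mult_adj_s)
  also have "s (ksrc \<Lambda> l) = finsum C (\<lambda>a. monomial a a) ?F"
    using src_vertex[OF l] n by (rule vertex_eq_sum)
  also have "\<dots> \<otimes> cadj C (s m) = finsum C (\<lambda>a. monomial a a \<otimes> cadj C (s m)) ?F"
    using F m by (intro C.finsum_mult_right) auto
  also have "s l \<otimes> \<dots> = finsum C (\<lambda>a. s l \<otimes> (monomial a a \<otimes> cadj C (s m))) ?F"
    using F l m pathsD(1) by (intro C.finsum_mult_left) auto
  also have "\<dots> = finsum C (\<lambda>a. monomial (kcomp \<Lambda> l a) (kcomp \<Lambda> m a)) ?F"
  proof (rule C.finsum_cong')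
    show "(\<lambda>a. monomial (kcomp \<Lambda> l a) (kcomp \<Lambda> m a)) \<in> ?F \<rightarrow> carrier C"
      using l m src pathsD(1,2) comp_closed by (intro Pi_I monomial_closed) auto
    fix a assume a: "a \<in> ?F"
    note a' = pathsD[OF a]
    have "s (kcomp \<Lambda> l a) = s l \<otimes> s a" "s (kcomp \<Lambda> m a) = s m \<otimes> s a"
      using l m a' src by (simp_all add: s_comp)
    then show "s l \<otimes> (monomial a a \<otimes> cadj C (s m)) = monomial (kcomp \<Lambda> l a) (kcomp \<Lambda> m a)"
      using l m a' by (simp add: C.adj_mult C.mult_assoc)
  qed simp
  finally show ?thesis .
qed

lemma monomial_mult_same_degree:
  assumes l: "l \<in> kmor \<Lambda>" and m: "m \<in> kmor \<Lambda>" and u: "u \<in> kmor \<Lambda>" and w: "w \<in> kmor \<Lambda>"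
    and deg: "kdeg \<Lambda> m = kdeg \<Lambda> u"
  shows "monomial l m \<otimes> monomial u w = (if m = u \<and> ksrc \<Lambda> l = ksrc \<Lambda> m then monomial l w else \<zero>)"
proof -
  have eq: "monomial l m \<otimes> monomial u w = s l \<otimes> ((cadj C (s m) \<otimes> s u) \<otimes> cadj C (s w))"
    using assms by (simp add: C.mult_assoc)
  consider "m \<noteq> u" | "ksrc \<Lambda> l \<noteq> ksrc \<Lambda> m" | "m = u" "ksrc \<Lambda> l = ksrc \<Lambda> m"
    by blast
  then show ?thesis
  proof cases
    case 1
    then show ?thesis
      using adj_s_mult_s_orthogonal[OF m u deg] eq l w by simp
  next
    case 2
    then show ?thesis
      using monomial_eq_zero assms by simp
  next
    case 3
    then have "monomial l m \<otimes> monomial u w = (s l \<otimes> s (ksrc \<Lambda> l)) \<otimes> cadj C (s w)"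
      unfolding eq using assms by (simp add: adj_s_mult_s C.mult_assoc src_closed)
    then show ?thesis
      using 3 s_mult_src[OF l] by simp
  qed
qed

text \<open>Expanding both factors to the common degree \<open>d(m) \<or> d(u)\<close>.\<close>

lemma monomial_mult_in_subspace:
  assumes l: "l \<in> kmor \<Lambda>" and m: "m \<in> kmor \<Lambda>" and u: "u \<in> kmor \<Lambda>" and w: "w \<in> kmor \<Lambda>"
    and S: "linear_subspace C S"
    and mem: "\<And>a b. \<lbrakk>a \<in> kmor \<Lambda>; b \<in> kmor \<Lambda>; ksrc \<Lambda> l = krng \<Lambda> a; ksrc \<Lambda> m = krng \<Lambda> a;
        ksrc \<Lambda> u = krng \<Lambda> b; ksrc \<Lambda> w = krng \<Lambda> b; kcomp \<Lambda> m a = kcomp \<Lambda> u b\<rbrakk>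
      \<Longrightarrow> monomial (kcomp \<Lambda> l a) (kcomp \<Lambda> w b) \<in> S"
  shows "monomial l m \<otimes> monomial u w \<in> S"
proof (cases "ksrc \<Lambda> l = ksrc \<Lambda> m \<and> ksrc \<Lambda> u = ksrc \<Lambda> w")
  case False
  then have "monomial l m \<otimes> monomial u w = \<zero>"
    using monomial_eq_zero assms by auto
  then show ?thesis
    using C.subspaceD(2)[OF S] by simp
next
  case True
  define p where "p = degree_gap (kdeg \<Lambda> m) (kdeg \<Lambda> u)"
  define q where "q = degree_gap (kdeg \<Lambda> u) (kdeg \<Lambda> m)"
  have pq: "p \<in> degrees k" "q \<in> degrees k"
    using m u by (auto simp: p_def q_def degree_gap_in_degrees deg_closed)
  let ?P = "kpaths_to \<Lambda> (ksrc \<Lambda> l) p" and ?Q = "kpaths_to \<Lambda> (ksrc \<Lambda> u) q"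
  have comp: "kcomp \<Lambda> l a \<in> kmor \<Lambda>" "kcomp \<Lambda> m a \<in> kmor \<Lambda>" if "a \<in> ?P" for a
    using pathsD[OF that] l m True by (auto intro!: comp_closed)
  have comp': "kcomp \<Lambda> u b \<in> kmor \<Lambda>" "kcomp \<Lambda> w b \<in> kmor \<Lambda>" if "b \<in> ?Q" for b
    using pathsD[OF that] u w True by (auto intro!: comp_closed)
  have "finsum C (\<lambda>a. monomial (kcomp \<Lambda> l a) (kcomp \<Lambda> m a)) ?P
      \<otimes> finsum C (\<lambda>b. monomial (kcomp \<Lambda> u b) (kcomp \<Lambda> w b)) ?Q \<in> S"
  proof (rule C.finsum_mult_finsum_in_subspace[OF S])
    show "finite ?P" "finite ?Q"
      using finite_paths pq l u by auto
    fix a b assume a: "a \<in> ?P" and b: "b \<in> ?Q"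
    note a' = pathsD[OF a] and b' = pathsD[OF b]
    have "kdeg \<Lambda> (kcomp \<Lambda> m a) = kdeg \<Lambda> (kcomp \<Lambda> u b)"
      using a' b' m u True by (simp add: deg_comp p_def q_def add_degree_gap max.commute)
    then have "monomial (kcomp \<Lambda> l a) (kcomp \<Lambda> m a) \<otimes> monomial (kcomp \<Lambda> u b) (kcomp \<Lambda> w b)
        = (if kcomp \<Lambda> m a = kcomp \<Lambda> u b \<and> ksrc \<Lambda> (kcomp \<Lambda> l a) = ksrc \<Lambda> (kcomp \<Lambda> m a)
           then monomial (kcomp \<Lambda> l a) (kcomp \<Lambda> w b) else \<zero>)"
      using comp[OF a] comp'[OF b] by (intro monomial_mult_same_degree)
    moreover have "monomial (kcomp \<Lambda> l a) (kcomp \<Lambda> w b) \<in> S" if "kcomp \<Lambda> m a = kcomp \<Lambda> u b"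
      using a' b' True that by (intro mem) auto
    ultimately show "monomial (kcomp \<Lambda> l a) (kcomp \<Lambda> m a) \<otimes> monomial (kcomp \<Lambda> u b) (kcomp \<Lambda> w b) \<in> S"
      using C.subspaceD(2)[OF S] by simp
  qed (use comp comp' in blast)+
  then show ?thesis
    using True monomial_expand[OF l m _ pq(1)] monomial_expand[OF u w _ pq(2)] by simp
qed

definition equal_degree_paths :: "(nat \<Rightarrow> nat) \<Rightarrow> 'l set \<Rightarrow> bool" where
  "equal_degree_paths n F \<longleftrightarrow> n \<in> degrees k \<and> finite F \<and> F \<subseteq> kmor \<Lambda> \<and> (\<forall>l\<in>F. kdeg \<Lambda> l = n)"

definition path_extensions :: "'l set \<Rightarrow> (nat \<Rightarrow> nat) \<Rightarrow> 'l set" where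
  "path_extensions F n = (\<Union>l\<in>F. kcomp \<Lambda> l ` kpaths_to \<Lambda> (ksrc \<Lambda> l) n)"

lemma equal_degree_pathsD:
  assumes "equal_degree_paths n F"
  shows "n \<in> degrees k" "finite F" "F \<subseteq> kmor \<Lambda>" "l \<in> F \<Longrightarrow> l \<in> kmor \<Lambda>" "l \<in> F \<Longrightarrow> kdeg \<Lambda> l = n"
  using assms by (auto simp: equal_degree_paths_def)

lemma equal_degree_paths_extensions:
  assumes F: "equal_degree_paths p F" and q: "q \<in> degrees k"
  shows "equal_degree_paths (\<lambda>i. p i + q i) (path_extensions F q)"
proof -
  note F' = equal_degree_pathsD[OF F]
  have "finite (path_extensions F q)"
    unfolding path_extensions_def using F' q by (intro finite_UN_I finite_imageI finite_paths) auto
  moreover have "l \<in> kmor \<Lambda> \<and> kdeg \<Lambda> l = (\<lambda>i. p i + q i)" if "l \<in> path_extensions F q" for l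
    using that F'(4,5) by (auto simp: path_extensions_def kpaths_to_def deg_comp intro!: comp_closed)
  moreover have "(\<lambda>i. p i + q i) \<in> degrees k"
    using F'(1) q by (simp add: degrees_def)
  ultimately show ?thesis
    unfolding equal_degree_paths_def by blast
qed

end

section \<open>The Fell bundle of a graded higher-rank graph\<close>

locale graded_ck_family = ck_family k \<Lambda> C s + G: group G
  for k :: nat and \<Lambda> :: "'l kgraph" and C :: "'c cstar" (structure) and s :: "'l \<Rightarrow> 'c"
    and G :: "'g monoid" +
  fixes \<eta> :: "'l \<Rightarrow> 'g"
  assumes functor_\<eta>: "functor_to_group \<Lambda> G \<eta>"
begin

definition grade :: "'l \<Rightarrow> 'l \<Rightarrow> 'g" where
  "grade l m = \<eta> l \<otimes>\<^bsub>G\<^esub> inv\<^bsub>G\<^esub> (\<eta> m)"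

definition gauge_degree :: "'l \<Rightarrow> 'l \<Rightarrow> nat \<Rightarrow> int" where
  "gauge_degree l m = (\<lambda>i. int (kdeg \<Lambda> l i) - int (kdeg \<Lambda> m i))"

definition fibre_monomials :: "'g \<Rightarrow> 'c set" where
  "fibre_monomials g = {monomial l m | l m. l \<in> kmor \<Lambda> \<and> m \<in> kmor \<Lambda> \<and> grade l m = g}"

definition homogeneous_monomials :: "'g \<Rightarrow> (nat \<Rightarrow> int) \<Rightarrow> 'c set" where
  "homogeneous_monomials g n =
     {monomial l m | l m. l \<in> kmor \<Lambda> \<and> m \<in> kmor \<Lambda> \<and> grade l m = g \<and> gauge_degree l m = n}"

abbreviation fibre :: "'g \<Rightarrow> 'c set" where
  "fibre g \<equiv> closed_span C (fibre_monomials g)"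

abbreviation graph_bundle :: "('g, 'c) fell_data" where
  "graph_bundle \<equiv> kgraph_bundle \<Lambda> G \<eta> C s"

lemma \<eta>_closed [simp, intro]: "l \<in> kmor \<Lambda> \<Longrightarrow> \<eta> l \<in> carrier G"
  and \<eta>_comp: "\<lbrakk>l \<in> kmor \<Lambda>; m \<in> kmor \<Lambda>; ksrc \<Lambda> l = krng \<Lambda> m\<rbrakk> \<Longrightarrow> \<eta> (kcomp \<Lambda> l m) = \<eta> l \<otimes>\<^bsub>G\<^esub> \<eta> m"
  using functor_\<eta> by (auto simp: functor_to_group_def)

lemma grade_closed [simp, intro]: "\<lbrakk>l \<in> kmor \<Lambda>; m \<in> kmor \<Lambda>\<rbrakk> \<Longrightarrow> grade l m \<in> carrier G"
  by (simp add: grade_def)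

lemma grade_self: "l \<in> kmor \<Lambda> \<Longrightarrow> grade l l = \<one>\<^bsub>G\<^esub>"
  by (simp add: grade_def)

lemma inv_grade: "\<lbrakk>l \<in> kmor \<Lambda>; m \<in> kmor \<Lambda>\<rbrakk> \<Longrightarrow> inv\<^bsub>G\<^esub> (grade l m) = grade m l"
  by (simp add: grade_def G.inv_mult_group)

lemma grade_mult: "\<lbrakk>l \<in> kmor \<Lambda>; m \<in> kmor \<Lambda>; w \<in> kmor \<Lambda>\<rbrakk> \<Longrightarrow> grade l m \<otimes>\<^bsub>G\<^esub> grade m w = grade l w"
  by (simp add: grade_def G.m_assoc) (simp add: G.m_assoc[symmetric])

lemma grade_comp:
  assumes "l \<in> kmor \<Lambda>" "m \<in> kmor \<Lambda>" "a \<in> kmor \<Lambda>" "ksrc \<Lambda> l = krng \<Lambda> a" "ksrc \<Lambda> m = krng \<Lambda> a"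
  shows "grade (kcomp \<Lambda> l a) (kcomp \<Lambda> m a) = grade l m"
  using assms by (simp add: grade_def \<eta>_comp G.inv_mult_group G.m_assoc) (simp add: G.m_assoc[symmetric])

lemma fibre_monomials_closed: "fibre_monomials g \<subseteq> carrier C"
  by (auto simp: fibre_monomials_def)

lemma homogeneous_subset_fibre_monomials: "homogeneous_monomials g n \<subseteq> fibre_monomials g"
  by (auto simp: homogeneous_monomials_def fibre_monomials_def)

lemma monomial_mult_homogeneous:
  assumes l: "l \<in> kmor \<Lambda>" and m: "m \<in> kmor \<Lambda>" and u: "u \<in> kmor \<Lambda>" and w: "w \<in> kmor \<Lambda>"
  shows "monomial l m \<otimes> monomial u w \<in> linear_span C
    (homogeneous_monomials (grade l m \<otimes>\<^bsub>G\<^esub> grade u w) (\<lambda>i. gauge_degree l m i + gauge_degree u w i))"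
    (is "_ \<in> linear_span C ?H")
proof (rule monomial_mult_in_subspace[OF l m u w])
  have "?H \<subseteq> carrier C"
    using homogeneous_subset_fibre_monomials fibre_monomials_closed by blast
  then show "linear_subspace C (linear_span C ?H)"
    by (rule C.linear_span_subspace)
  fix a b assume ab: "a \<in> kmor \<Lambda>" "b \<in> kmor \<Lambda>" "ksrc \<Lambda> l = krng \<Lambda> a" "ksrc \<Lambda> m = krng \<Lambda> a"
    "ksrc \<Lambda> u = krng \<Lambda> b" "ksrc \<Lambda> w = krng \<Lambda> b" "kcomp \<Lambda> m a = kcomp \<Lambda> u b"
  have comp: "kcomp \<Lambda> l a \<in> kmor \<Lambda>" "kcomp \<Lambda> m a \<in> kmor \<Lambda>" "kcomp \<Lambda> w b \<in> kmor \<Lambda>"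
    using comp_closed[OF l ab(1,3)] comp_closed[OF m ab(1,4)] comp_closed[OF w ab(2,6)] .
  have "grade (kcomp \<Lambda> l a) (kcomp \<Lambda> w b)
      = grade (kcomp \<Lambda> l a) (kcomp \<Lambda> m a) \<otimes>\<^bsub>G\<^esub> grade (kcomp \<Lambda> u b) (kcomp \<Lambda> w b)"
    using grade_mult[OF comp] ab(7) by simp
  also have "\<dots> = grade l m \<otimes>\<^bsub>G\<^esub> grade u w"
    using grade_comp[OF l m ab(1,3,4)] grade_comp[OF u w ab(2,5,6)] by simp
  finally have grade: "grade (kcomp \<Lambda> l a) (kcomp \<Lambda> w b) = grade l m \<otimes>\<^bsub>G\<^esub> grade u w" .
  have "gauge_degree (kcomp \<Lambda> l a) (kcomp \<Lambda> w b) i = gauge_degree l m i + gauge_degree u w i" for i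
  proof -
    have "kdeg \<Lambda> m i + kdeg \<Lambda> a i = kdeg \<Lambda> u i + kdeg \<Lambda> b i"
      using fun_cong[OF deg_comp[OF m ab(1,4)], of i] fun_cong[OF deg_comp[OF u ab(2,5)], of i] ab(7) by simp
    then show ?thesis
      using ab l w by (simp add: gauge_degree_def deg_comp)
  qed
  then have "monomial (kcomp \<Lambda> l a) (kcomp \<Lambda> w b) \<in> ?H"
    using grade comp unfolding homogeneous_monomials_def by blast
  then show "monomial (kcomp \<Lambda> l a) (kcomp \<Lambda> w b) \<in> linear_span C ?H"
    using C.subset_linear_span by blast
qed

lemma fibre_monomials_mult:
  assumes "x \<in> fibre_monomials g" "y \<in> fibre_monomials h"
  shows "x \<otimes> y \<in> linear_span C (fibre_monomials (g \<otimes>\<^bsub>G\<^esub> h))"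
proof -
  obtain l m u w where *: "l \<in> kmor \<Lambda>" "m \<in> kmor \<Lambda>" "u \<in> kmor \<Lambda>" "w \<in> kmor \<Lambda>"
    "grade l m = g" "grade u w = h" "x = monomial l m" "y = monomial u w"
    using assms by (auto simp: fibre_monomials_def)
  then show ?thesis
    using monomial_mult_homogeneous[OF *(1-4)] C.linear_span_mono[OF homogeneous_subset_fibre_monomials] by blast
qed

lemma fibre_subspace: "linear_subspace C (fibre g)"
  using fibre_monomials_closed by (rule C.closed_span_subspace)

lemma fibre_in_carrier: "x \<in> fibre g \<Longrightarrow> x \<in> carrier C"
  using C.closed_span_subset_carrier by blast

lemmas fibre_zero = C.subspaceD(2)[OF fibre_subspace]
lemmas fibre_scale = C.subspaceD(4)[OF fibre_subspace]

lemma span_fibre_monomials_in_fibre: "x \<in> linear_span C (fibre_monomials g) \<Longrightarrow> x \<in> fibre g"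
  using C.linear_span_subset_closed_span[OF fibre_monomials_closed] by blast

lemma monomial_in_fibre: "\<lbrakk>l \<in> kmor \<Lambda>; m \<in> kmor \<Lambda>\<rbrakk> \<Longrightarrow> monomial l m \<in> fibre (grade l m)"
  using C.subset_closed_span[OF fibre_monomials_closed] by (auto simp: fibre_monomials_def)

lemma vertex_in_fibre: "v \<in> kvertices \<Lambda> \<Longrightarrow> s v \<in> fibre \<one>\<^bsub>G\<^esub>"
  using monomial_in_fibre[of v v] by (simp add: grade_self vertex_adj vertex_idem)

lemma fibre_mult: "\<lbrakk>x \<in> fibre g; y \<in> fibre h\<rbrakk> \<Longrightarrow> x \<otimes> y \<in> fibre (g \<otimes>\<^bsub>G\<^esub> h)"
  by (rule C.closed_span_mult[OF fibre_monomials_closed fibre_monomials_closed fibre_subspace C.closed_span_closed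
        span_fibre_monomials_in_fibre[OF fibre_monomials_mult]])

lemma fibre_adj: "x \<in> fibre g \<Longrightarrow> cadj C x \<in> fibre (inv\<^bsub>G\<^esub> g)"
proof (rule C.closed_span_adj[OF fibre_monomials_closed fibre_subspace C.closed_span_closed])
  fix x assume "x \<in> fibre_monomials g"
  then obtain l m where "l \<in> kmor \<Lambda>" "m \<in> kmor \<Lambda>" "grade l m = g" "x = monomial l m"
    by (auto simp: fibre_monomials_def)
  then show "cadj C x \<in> fibre (inv\<^bsub>G\<^esub> g)"
    using monomial_in_fibre[of m l] by (auto simp: monomial_adj inv_grade)
qed

lemma adj_mult_in_unit_fibre: "\<lbrakk>g \<in> carrier G; b \<in> fibre g\<rbrakk> \<Longrightarrow> cadj C b \<otimes> b \<in> fibre \<one>\<^bsub>G\<^esub>"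
  using fibre_mult[OF fibre_adj] by fastforce

lemma unit_fibre_subalgebra: "cstar_subalgebra C (fibre \<one>\<^bsub>G\<^esub>)"
  unfolding cstar_subalgebra_def
  using fibre_subspace C.closed_span_closed fibre_mult[of _ "\<one>\<^bsub>G\<^esub>" _ "\<one>\<^bsub>G\<^esub>"] fibre_adj[of _ "\<one>\<^bsub>G\<^esub>"] by auto

lemma bundle_simps:
  "fib graph_bundle g = fibre g"
  "fadd graph_bundle g = add C"
  "fscale graph_bundle g = cscale C"
  "fmult graph_bundle g h = mult C"
  "fadj graph_bundle g = cadj C"
  by (simp_all add: kgraph_bundle_def fibre_monomials_def grade_def)

lemma deformed_bundle_fib: "fib (deformed_bundle G \<sigma> graph_bundle) g = fibre g"
  by (simp add: deformed_bundle_def bundle_simps)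

end

section \<open>Representations of the deformed bundle\<close>

locale twisted_rep = graded_ck_family k \<Lambda> C s G \<eta> + M: cstar_algebra M
  for k :: nat and \<Lambda> :: "'l kgraph" and C :: "'c cstar" (structure) and s :: "'l \<Rightarrow> 'c"
    and G :: "'g monoid" and \<eta> :: "'l \<Rightarrow> 'g" and M :: "'m cstar" +
  fixes \<sigma> :: "'g \<Rightarrow> 'g \<Rightarrow> complex" and \<pi> :: "'g \<Rightarrow> 'c \<Rightarrow> 'm"
  assumes cocycle: "two_cocycle G \<sigma>"
    and maps: "bundle_maps G (deformed_bundle G \<sigma> graph_bundle) M \<pi>"
begin

subsection \<open>Maps on the fibres\<close>

lemma cocycle_unimodular: "\<lbrakk>g \<in> carrier G; h \<in> carrier G\<rbrakk> \<Longrightarrow> cmod (\<sigma> g h) = 1"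
  and cocycle_one: "g \<in> carrier G \<Longrightarrow> \<sigma> \<one>\<^bsub>G\<^esub> g = 1" "g \<in> carrier G \<Longrightarrow> \<sigma> g \<one>\<^bsub>G\<^esub> = 1"
  using cocycle by (auto simp: two_cocycle_def)

lemma cocycle_inv:
  assumes g: "g \<in> carrier G" shows "\<sigma> (inv\<^bsub>G\<^esub> g) g = \<sigma> g (inv\<^bsub>G\<^esub> g)"
proof -
  have "\<sigma> g (inv\<^bsub>G\<^esub> g) * \<sigma> (g \<otimes>\<^bsub>G\<^esub> inv\<^bsub>G\<^esub> g) g = \<sigma> g (inv\<^bsub>G\<^esub> g \<otimes>\<^bsub>G\<^esub> g) * \<sigma> (inv\<^bsub>G\<^esub> g) g"
    using cocycle g unfolding two_cocycle_def by (meson G.inv_closed)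
  then show ?thesis
    using g by (simp add: cocycle_one)
qed

lemma \<pi>_closed: "\<lbrakk>g \<in> carrier G; b \<in> fibre g\<rbrakk> \<Longrightarrow> \<pi> g b \<in> carrier M"
  and \<pi>_add: "\<lbrakk>g \<in> carrier G; b \<in> fibre g; c \<in> fibre g\<rbrakk> \<Longrightarrow> \<pi> g (b \<oplus> c) = \<pi> g b \<oplus>\<^bsub>M\<^esub> \<pi> g c"
  and \<pi>_scale: "\<lbrakk>g \<in> carrier G; b \<in> fibre g\<rbrakk> \<Longrightarrow> \<pi> g (cscale C w b) = cscale M w (\<pi> g b)"
  using maps by (auto simp: bundle_maps_def deformed_bundle_def bundle_simps Pi_iff)

lemma \<pi>_mult:
  assumes "g \<in> carrier G" "h \<in> carrier G" "b \<in> fibre g" "c \<in> fibre h"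
  shows "\<pi> g b \<otimes>\<^bsub>M\<^esub> \<pi> h c = cscale M (\<sigma> g h) (\<pi> (g \<otimes>\<^bsub>G\<^esub> h) (b \<otimes> c))"
proof -
  have "\<pi> g b \<otimes>\<^bsub>M\<^esub> \<pi> h c = \<pi> (g \<otimes>\<^bsub>G\<^esub> h) (cscale C (\<sigma> g h) (b \<otimes> c))"
    using maps assms by (simp add: bundle_maps_def deformed_bundle_def bundle_simps)
  then show ?thesis
    using assms fibre_mult by (simp add: \<pi>_scale)
qed

lemma \<pi>_adj:
  assumes "g \<in> carrier G" "b \<in> fibre g"
  shows "cadj M (\<pi> g b) = cscale M (cnj (\<sigma> g (inv\<^bsub>G\<^esub> g))) (\<pi> (inv\<^bsub>G\<^esub> g) (cadj C b))"
proof -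
  have "cadj M (\<pi> g b) = \<pi> (inv\<^bsub>G\<^esub> g) (cscale C (cnj (\<sigma> g (inv\<^bsub>G\<^esub> g))) (cadj C b))"
    using maps assms by (simp add: bundle_maps_def deformed_bundle_def bundle_simps)
  then show ?thesis
    using assms fibre_adj by (simp add: \<pi>_scale)
qed

lemma \<pi>_zero: "g \<in> carrier G \<Longrightarrow> \<pi> g \<zero> = \<zero>\<^bsub>M\<^esub>"
  using \<pi>_scale[OF _ fibre_zero, of g 0] \<pi>_closed[OF _ fibre_zero] by simp

lemma \<pi>_diff: "\<lbrakk>g \<in> carrier G; b \<in> fibre g; c \<in> fibre g\<rbrakk> \<Longrightarrow> \<pi> g (b \<ominus> c) = \<pi> g b \<ominus>\<^bsub>M\<^esub> \<pi> g c"
  using fibre_scale[of c g] fibre_in_carrier[of c g] \<pi>_closed[of g c]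
  by (simp add: C.diff_as_scale M.diff_as_scale \<pi>_add \<pi>_scale)

lemma \<pi>_finsum:
  assumes g: "g \<in> carrier G" and "finite F" "f \<in> F \<rightarrow> fibre g"
  shows "\<pi> g (finsum C f F) = finsum M (\<lambda>i. \<pi> g (f i)) F"
  using assms(2,3)
proof (induction F rule: finite_induct)
  case (insert i F)
  have "f \<in> F \<rightarrow> carrier C" "f i \<in> carrier C" "finsum C f F \<in> fibre g"
    using insert fibre_in_carrier C.finsum_in_subspace[OF fibre_subspace] by (auto simp: Pi_iff)
  then show ?case
    using insert g \<pi>_closed by (simp add: \<pi>_add Pi_iff)
qed (use g \<pi>_zero in simp)

lemma \<pi>_adj_mult:
  assumes g: "g \<in> carrier G" and b: "b \<in> fibre g"
  shows "cadj M (\<pi> g b) \<otimes>\<^bsub>M\<^esub> \<pi> g b = \<pi> \<one>\<^bsub>G\<^esub> (cadj C b \<otimes> b)"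
proof -
  let ?z = "\<sigma> g (inv\<^bsub>G\<^esub> g)"
  note bb = adj_mult_in_unit_fibre[OF g b]
  have "cnj ?z * ?z = 1"
    using cocycle_unimodular[of g "inv\<^bsub>G\<^esub> g"] g by (simp add: complex_norm_square[symmetric] mult.commute)
  then show ?thesis
    using g b fibre_adj[OF b] bb \<pi>_closed[OF _ bb] \<pi>_closed[OF _ fibre_adj[OF b]]
    by (simp add: \<pi>_adj \<pi>_mult M.scale_mult_left \<pi>_closed cocycle_inv)
qed

lemma norm_\<pi>_unit_fibre_le:
  assumes b: "b \<in> fibre \<one>\<^bsub>G\<^esub>" shows "cnorm M (\<pi> \<one>\<^bsub>G\<^esub> b) \<le> cnorm C b"
proof -
  let ?N = "cstar_image C (fibre \<one>\<^bsub>G\<^esub>) (\<lambda>x. x)"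
  have inj: "inj_on (\<lambda>x. x) (fibre \<one>\<^bsub>G\<^esub>)"
    by (simp add: inj_on_def)
  note simps = cstar_image_simps[OF inj, where M = C]
  have "star_hom ?N M (\<pi> \<one>\<^bsub>G\<^esub>)"
    using \<pi>_mult[of "\<one>\<^bsub>G\<^esub>" "\<one>\<^bsub>G\<^esub>"] \<pi>_adj[of "\<one>\<^bsub>G\<^esub>"] fibre_mult[of _ "\<one>\<^bsub>G\<^esub>" _ "\<one>\<^bsub>G\<^esub>"] fibre_adj[of _ "\<one>\<^bsub>G\<^esub>"]
    by (simp add: star_hom_def simps \<pi>_closed \<pi>_add \<pi>_scale cocycle_one)
  then interpret h: cstar_hom ?N M "\<pi> \<one>\<^bsub>G\<^esub>"
    using C.cstar_algebra_image[OF unit_fibre_subalgebra inj] M.cstar_algebra_axioms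
    by (simp add: cstar_hom_def cstar_hom_axioms_def)
  show ?thesis
    using h.contractive[of b] b by (simp add: simps)
qed

lemma norm_\<pi>_le:
  assumes g: "g \<in> carrier G" and b: "b \<in> fibre g" shows "cnorm M (\<pi> g b) \<le> cnorm C b"
proof (rule power2_le_imp_le)
  have b_closed: "b \<in> carrier C"
    using b by (rule fibre_in_carrier)
  then show "0 \<le> cnorm C b"
    by (rule C.norm_nonneg)
  show "(cnorm M (\<pi> g b))\<^sup>2 \<le> (cnorm C b)\<^sup>2"
    using norm_\<pi>_unit_fibre_le[OF adj_mult_in_unit_fibre[OF g b]]
    by (simp add: M.norm_adj_mult[OF \<pi>_closed[OF g b]] C.norm_adj_mult[OF b_closed] flip: \<pi>_adj_mult[OF g b])
qed

subsection \<open>Images of monomials\<close>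

definition rep_monomial :: "'l \<Rightarrow> 'l \<Rightarrow> 'm" where
  "rep_monomial l m = \<pi> (grade l m) (monomial l m)"

definition rep_monomials :: "'m set" where
  "rep_monomials = {rep_monomial l m | l m. l \<in> kmor \<Lambda> \<and> m \<in> kmor \<Lambda>}"

definition rep_monomials_of_degree :: "(nat \<Rightarrow> int) \<Rightarrow> 'm set" where
  "rep_monomials_of_degree n =
     {rep_monomial l m | l m. l \<in> kmor \<Lambda> \<and> m \<in> kmor \<Lambda> \<and> gauge_degree l m = n}"

abbreviation rep_span :: "'m set" where
  "rep_span \<equiv> linear_span M rep_monomials"

abbreviation rep_algebra :: "'m set" where
  "rep_algebra \<equiv> closed_span M rep_monomials"

abbreviation homogeneous_span :: "(nat \<Rightarrow> int) \<Rightarrow> 'm set" where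
  "homogeneous_span n \<equiv> linear_span M (rep_monomials_of_degree n)"

lemma rep_monomial_closed [simp, intro]: "\<lbrakk>l \<in> kmor \<Lambda>; m \<in> kmor \<Lambda>\<rbrakk> \<Longrightarrow> rep_monomial l m \<in> carrier M"
  unfolding rep_monomial_def by (intro \<pi>_closed grade_closed monomial_in_fibre)

lemma rep_monomials_closed: "rep_monomials \<subseteq> carrier M"
  and rep_monomials_of_degree_closed: "rep_monomials_of_degree n \<subseteq> carrier M"
  and rep_monomials_of_degree_subset: "rep_monomials_of_degree n \<subseteq> rep_monomials"
  by (auto simp: rep_monomials_def rep_monomials_of_degree_def)

lemmas rep_algebra_subspace = M.closed_span_subspace[OF rep_monomials_closed]
lemmas homogeneous_span_subspace = M.linear_span_subspace[OF rep_monomials_of_degree_closed]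

lemma rep_span_in_carrier: "x \<in> rep_span \<Longrightarrow> x \<in> carrier M"
  using M.linear_span_subset_carrier[OF rep_monomials_closed] by blast

lemma rep_span_in_algebra: "x \<in> rep_span \<Longrightarrow> x \<in> rep_algebra"
  using M.linear_span_subset_closed_span[OF rep_monomials_closed] by blast

lemma homogeneous_span_in_span: "x \<in> homogeneous_span n \<Longrightarrow> x \<in> rep_span"
  using M.linear_span_mono[OF rep_monomials_of_degree_subset] by blast

lemma rep_monomial_in_span: "\<lbrakk>l \<in> kmor \<Lambda>; m \<in> kmor \<Lambda>\<rbrakk> \<Longrightarrow> rep_monomial l m \<in> rep_span"
  by (intro subsetD[OF M.subset_linear_span]) (auto simp: rep_monomials_def)

lemma rep_monomial_in_homogeneous_span:
  "\<lbrakk>l \<in> kmor \<Lambda>; m \<in> kmor \<Lambda>\<rbrakk> \<Longrightarrow> rep_monomial l m \<in> homogeneous_span (gauge_degree l m)"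
  by (intro subsetD[OF M.subset_linear_span]) (auto simp: rep_monomials_of_degree_def)

lemma \<pi>_linear_span_in_subspace:
  assumes g: "g \<in> carrier G" and X: "X \<subseteq> fibre_monomials g" and S: "linear_subspace M S"
    and mem: "\<And>x. x \<in> X \<Longrightarrow> \<pi> g x \<in> S" and x: "x \<in> linear_span C X"
  shows "\<pi> g x \<in> S"
proof -
  have X_subset: "X \<subseteq> carrier C"
    using X fibre_monomials_closed by blast
  have in_fibre: "y \<in> fibre g" if "y \<in> linear_span C X" for y
    using that C.linear_span_mono[OF X] span_fibre_monomials_in_fibre by blast
  show ?thesis
    using x X_subset
  proof (induction rule: C.linear_span_induct)
    case (base x) then show ?case using mem by blast
  next
    case zero then show ?case using M.subspaceD(2)[OF S] g by (simp add: \<pi>_zero)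
  next
    case (add x y) then show ?case using M.subspaceD(3)[OF S] g in_fibre by (simp add: \<pi>_add)
  next
    case (scale c x) then show ?case using M.subspaceD(4)[OF S] g in_fibre by (simp add: \<pi>_scale)
  qed
qed

lemma \<pi>_in_homogeneous_span:
  "\<lbrakk>g \<in> carrier G; x \<in> linear_span C (homogeneous_monomials g n)\<rbrakk> \<Longrightarrow> \<pi> g x \<in> homogeneous_span n"
proof (rule \<pi>_linear_span_in_subspace[OF _ homogeneous_subset_fibre_monomials homogeneous_span_subspace])
  fix x assume "x \<in> homogeneous_monomials g n"
  then obtain l m where "l \<in> kmor \<Lambda>" "m \<in> kmor \<Lambda>" "grade l m = g" "gauge_degree l m = n" "x = monomial l m"
    by (auto simp: homogeneous_monomials_def)
  then show "\<pi> g x \<in> homogeneous_span n"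
    using rep_monomial_in_homogeneous_span[of l m] by (simp add: rep_monomial_def)
qed

lemma \<pi>_in_rep_algebra:
  assumes g: "g \<in> carrier G" and x: "x \<in> fibre g" shows "\<pi> g x \<in> rep_algebra"
proof -
  obtain u where u: "\<And>n. u n \<in> linear_span C (fibre_monomials g)" "clim C u x"
    using C.in_closure_obtains_clim[OF C.linear_span_subset_carrier[OF fibre_monomials_closed], of x g] x
    unfolding closed_span_def by blast
  have "\<pi> g (u n) \<in> rep_algebra" for n
  proof (rule \<pi>_linear_span_in_subspace[OF g subset_refl rep_algebra_subspace _ u(1)])
    fix y assume "y \<in> fibre_monomials g"
    then obtain l m where "l \<in> kmor \<Lambda>" "m \<in> kmor \<Lambda>" "grade l m = g" "y = monomial l m"
      by (auto simp: fibre_monomials_def)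
    then show "\<pi> g y \<in> rep_algebra"
      using rep_span_in_algebra[OF rep_monomial_in_span[of l m]] by (simp add: rep_monomial_def)
  qed
  moreover have "clim M (\<lambda>n. \<pi> g (u n)) (\<pi> g x)"
  proof (rule M.climI_bound)
    have uF: "u n \<in> fibre g" for n
      using u(1) by (rule span_fibre_monomials_in_fibre)
    then show "\<pi> g (u n) \<in> carrier M" for n
      using g by (intro \<pi>_closed)
    show "cnorm M (\<pi> g (u n) \<ominus>\<^bsub>M\<^esub> \<pi> g x) \<le> cnorm C (u n \<ominus> x)" for n
      using norm_\<pi>_le[OF g C.subspace_diff[OF fibre_subspace uF x], of n] by (simp add: \<pi>_diff g uF x)
  qed (use climD(3)[OF u(2)] \<pi>_closed[OF g x] in simp_all)
  ultimately show ?thesis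
    by (rule M.closedin_clim[OF M.closed_span_closed])
qed

lemma rep_monomial_mult:
  "\<lbrakk>l \<in> kmor \<Lambda>; m \<in> kmor \<Lambda>; u \<in> kmor \<Lambda>; w \<in> kmor \<Lambda>\<rbrakk> \<Longrightarrow> rep_monomial l m \<otimes>\<^bsub>M\<^esub> rep_monomial u w =
    cscale M (\<sigma> (grade l m) (grade u w)) (\<pi> (grade l m \<otimes>\<^bsub>G\<^esub> grade u w) (monomial l m \<otimes> monomial u w))"
  unfolding rep_monomial_def by (intro \<pi>_mult grade_closed monomial_in_fibre)

lemma rep_monomial_mult_in_homogeneous_span:
  assumes "l \<in> kmor \<Lambda>" "m \<in> kmor \<Lambda>" "u \<in> kmor \<Lambda>" "w \<in> kmor \<Lambda>"
  shows "rep_monomial l m \<otimes>\<^bsub>M\<^esub> rep_monomial u w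
    \<in> homogeneous_span (\<lambda>i. gauge_degree l m i + gauge_degree u w i)"
  unfolding rep_monomial_mult[OF assms]
  using assms by (intro M.subspaceD(4)[OF homogeneous_span_subspace] \<pi>_in_homogeneous_span monomial_mult_homogeneous) auto

lemma rep_monomial_adj:
  "\<lbrakk>l \<in> kmor \<Lambda>; m \<in> kmor \<Lambda>\<rbrakk>
    \<Longrightarrow> cadj M (rep_monomial l m) = cscale M (cnj (\<sigma> (grade l m) (grade m l))) (rep_monomial m l)"
  unfolding rep_monomial_def using \<pi>_adj[OF grade_closed monomial_in_fibre, of l m]
  by (simp add: inv_grade monomial_adj)

lemma homogeneous_span_mult:
  assumes "x \<in> homogeneous_span p" "y \<in> homogeneous_span q"
  shows "x \<otimes>\<^bsub>M\<^esub> y \<in> homogeneous_span (\<lambda>i. p i + q i)"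
proof (rule M.linear_span_mult[OF rep_monomials_of_degree_closed rep_monomials_of_degree_closed
      homogeneous_span_subspace _ assms])
  fix x y assume "x \<in> rep_monomials_of_degree p" "y \<in> rep_monomials_of_degree q"
  then show "x \<otimes>\<^bsub>M\<^esub> y \<in> homogeneous_span (\<lambda>i. p i + q i)"
    using rep_monomial_mult_in_homogeneous_span by (auto simp: rep_monomials_of_degree_def)
qed

lemma homogeneous_span_adj:
  assumes "x \<in> homogeneous_span p" shows "cadj M x \<in> homogeneous_span (\<lambda>i. - p i)"
proof (rule M.linear_span_adj[OF rep_monomials_of_degree_closed homogeneous_span_subspace _ assms])
  fix x assume "x \<in> rep_monomials_of_degree p"
  then obtain l m where lm: "l \<in> kmor \<Lambda>" "m \<in> kmor \<Lambda>" "gauge_degree l m = p" "x = rep_monomial l m"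
    by (auto simp: rep_monomials_of_degree_def)
  then have "gauge_degree m l = (\<lambda>i. - p i)"
    by (auto simp: gauge_degree_def)
  then show "cadj M x \<in> homogeneous_span (\<lambda>i. - p i)"
    using lm rep_monomial_in_homogeneous_span[of m l] M.subspaceD(4)[OF homogeneous_span_subspace]
    by (simp add: rep_monomial_adj)
qed

lemma rep_algebra_subalgebra: "cstar_subalgebra M rep_algebra"
  unfolding cstar_subalgebra_def
proof (intro conjI ballI)
  show sub: "linear_subspace M rep_algebra" and clo: "closedin (ctopology M) rep_algebra"
    using rep_algebra_subspace M.closed_span_closed by auto
  show "x \<otimes>\<^bsub>M\<^esub> y \<in> rep_algebra" if "x \<in> rep_algebra" "y \<in> rep_algebra" for x y
  proof (rule M.closed_span_mult[OF rep_monomials_closed rep_monomials_closed sub clo _ that])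
    show "x \<otimes>\<^bsub>M\<^esub> y \<in> rep_algebra" if "x \<in> rep_monomials" "y \<in> rep_monomials" for x y
      using that rep_span_in_algebra[OF homogeneous_span_in_span[OF rep_monomial_mult_in_homogeneous_span]]
      by (auto simp: rep_monomials_def)
  qed
  show "cadj M x \<in> rep_algebra" if "x \<in> rep_algebra" for x
  proof (rule M.closed_span_adj[OF rep_monomials_closed sub clo _ that])
    show "cadj M x \<in> rep_algebra" if "x \<in> rep_monomials" for x
      using that rep_span_in_algebra[OF rep_monomial_in_span] M.subspaceD(4)[OF sub]
      by (auto simp: rep_monomials_def rep_monomial_adj)
  qed
qed

lemma rep_monomial_eq_zero:
  "\<lbrakk>l \<in> kmor \<Lambda>; m \<in> kmor \<Lambda>; ksrc \<Lambda> l \<noteq> ksrc \<Lambda> m\<rbrakk> \<Longrightarrow> rep_monomial l m = \<zero>\<^bsub>M\<^esub>"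
  by (simp add: rep_monomial_def monomial_eq_zero \<pi>_zero)

lemma rep_monomial_mult_same_degree:
  assumes "l \<in> kmor \<Lambda>" "m \<in> kmor \<Lambda>" "u \<in> kmor \<Lambda>" "w \<in> kmor \<Lambda>" "kdeg \<Lambda> m = kdeg \<Lambda> u"
  shows "rep_monomial l m \<otimes>\<^bsub>M\<^esub> rep_monomial u w =
    (if m = u \<and> ksrc \<Lambda> l = ksrc \<Lambda> m then cscale M (\<sigma> (grade l m) (grade m w)) (rep_monomial l w) else \<zero>\<^bsub>M\<^esub>)"
  using assms unfolding rep_monomial_mult[OF assms(1-4)] monomial_mult_same_degree[OF assms]
  by (auto simp: rep_monomial_def grade_mult \<pi>_zero)

lemma rep_monomial_expand:
  assumes l: "l \<in> kmor \<Lambda>" and m: "m \<in> kmor \<Lambda>" and src: "ksrc \<Lambda> l = ksrc \<Lambda> m" and n: "n \<in> degrees k"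
  shows "rep_monomial l m = finsum M (\<lambda>a. rep_monomial (kcomp \<Lambda> l a) (kcomp \<Lambda> m a)) (kpaths_to \<Lambda> (ksrc \<Lambda> l) n)"
proof -
  let ?F = "kpaths_to \<Lambda> (ksrc \<Lambda> l) n"
  have comp: "grade (kcomp \<Lambda> l a) (kcomp \<Lambda> m a) = grade l m" "kcomp \<Lambda> l a \<in> kmor \<Lambda>" "kcomp \<Lambda> m a \<in> kmor \<Lambda>"
    if "a \<in> ?F" for a
    using that l m src by (auto simp: kpaths_to_def grade_comp intro!: comp_closed)
  have in_fibre: "monomial (kcomp \<Lambda> l a) (kcomp \<Lambda> m a) \<in> fibre (grade l m)" if "a \<in> ?F" for a
    using comp[OF that] monomial_in_fibre[of "kcomp \<Lambda> l a" "kcomp \<Lambda> m a"] by simp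
  have "rep_monomial l m = finsum M (\<lambda>a. \<pi> (grade l m) (monomial (kcomp \<Lambda> l a) (kcomp \<Lambda> m a))) ?F"
    unfolding rep_monomial_def monomial_expand[OF assms]
    using l m in_fibre finite_paths[OF src_vertex[OF l] n] by (intro \<pi>_finsum) auto
  also have "\<dots> = finsum M (\<lambda>a. rep_monomial (kcomp \<Lambda> l a) (kcomp \<Lambda> m a)) ?F"
    using comp l m by (intro M.finsum_cong') (auto simp: rep_monomial_def[of "kcomp \<Lambda> l _"] intro!: \<pi>_closed in_fibre)
  finally show ?thesis .
qed

lemma rep_monomial_vertex: "v \<in> kvertices \<Lambda> \<Longrightarrow> rep_monomial v v = \<pi> \<one>\<^bsub>G\<^esub> (s v)"
  by (simp add: rep_monomial_def grade_self vertex_adj vertex_idem)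

lemma rng_mult_rep_monomial:
  assumes l: "l \<in> kmor \<Lambda>" and m: "m \<in> kmor \<Lambda>"
  shows "\<pi> \<one>\<^bsub>G\<^esub> (s (krng \<Lambda> l)) \<otimes>\<^bsub>M\<^esub> rep_monomial l m = rep_monomial l m"
  unfolding rep_monomial_def
  using \<pi>_mult[OF _ _ vertex_in_fibre[OF rng_vertex[OF l]] monomial_in_fibre[OF l m]] l m
    rng_mult_monomial[OF l m] \<pi>_closed[OF _ monomial_in_fibre[OF l m]] by (simp add: cocycle_one)

lemma rep_monomial_nonzero:
  assumes nonzero: "\<pi> \<one>\<^bsub>G\<^esub> (s (ksrc \<Lambda> l)) \<noteq> \<zero>\<^bsub>M\<^esub>"
    and l: "l \<in> kmor \<Lambda>" and m: "m \<in> kmor \<Lambda>" and src: "ksrc \<Lambda> l = ksrc \<Lambda> m"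
  shows "rep_monomial l m \<noteq> \<zero>\<^bsub>M\<^esub>"
proof
  assume zero: "rep_monomial l m = \<zero>\<^bsub>M\<^esub>"
  define v where "v = ksrc \<Lambda> l"
  have v: "v \<in> kvertices \<Lambda>" "v \<in> kmor \<Lambda>" "ksrc \<Lambda> v = v"
    using l by (simp_all add: v_def src_closed src_src)
  have \<sigma>: "\<sigma> (grade v a) (grade a b) \<noteq> 0" if "a \<in> kmor \<Lambda>" "b \<in> kmor \<Lambda>" for a b
    using cocycle_unimodular[of "grade v a" "grade a b"] v that by auto
  have "cscale M (\<sigma> (grade v l) (grade l m)) (rep_monomial v m) = rep_monomial v l \<otimes>\<^bsub>M\<^esub> rep_monomial l m"
    using rep_monomial_mult_same_degree[OF v(2) l l m] v by (simp add: v_def)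
  then have "rep_monomial v m = \<zero>\<^bsub>M\<^esub>"
    using zero \<sigma>[OF l m] v l m by (simp add: M.scale_eq_zero_iff)
  moreover have "cscale M (\<sigma> (grade v m) (grade m v)) (rep_monomial v v) = rep_monomial v m \<otimes>\<^bsub>M\<^esub> rep_monomial m v"
    using rep_monomial_mult_same_degree[OF v(2) m m v(2)] v src by (simp add: v_def)
  ultimately have "rep_monomial v v = \<zero>\<^bsub>M\<^esub>"
    using \<sigma>[OF m v(2)] v m by (simp add: M.scale_eq_zero_iff)
  then show False
    using nonzero v by (simp add: rep_monomial_vertex v_def)
qed

lemma projection_rep_monomial:
  assumes l: "l \<in> kmor \<Lambda>" shows "projection M (rep_monomial l l)"
  using rep_monomial_mult_same_degree[OF l l l l] l
  by (simp add: projection_def selfadjoint_def rep_monomial_adj grade_self cocycle_one)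

lemma compress_rep_monomial:
  assumes l: "l \<in> kmor \<Lambda>" and m: "m \<in> kmor \<Lambda>" and a: "a \<in> kmor \<Lambda>" "kdeg \<Lambda> a = kdeg \<Lambda> l"
    and b: "b \<in> kmor \<Lambda>" "kdeg \<Lambda> b = kdeg \<Lambda> m"
  shows "rep_monomial l l \<otimes>\<^bsub>M\<^esub> (rep_monomial a b \<otimes>\<^bsub>M\<^esub> rep_monomial m m)
    = (if a = l \<and> b = m then rep_monomial l m else \<zero>\<^bsub>M\<^esub>)"
proof -
  have right: "rep_monomial a b \<otimes>\<^bsub>M\<^esub> rep_monomial m m = (if b = m then rep_monomial a b else \<zero>\<^bsub>M\<^esub>)"
    using rep_monomial_mult_same_degree[OF a(1) b(1) m m b(2)] rep_monomial_eq_zero[OF a(1) b(1)] a b m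
    by (auto simp: grade_self cocycle_one)
  have left: "rep_monomial l l \<otimes>\<^bsub>M\<^esub> rep_monomial a b = (if a = l then rep_monomial a b else \<zero>\<^bsub>M\<^esub>)"
    using rep_monomial_mult_same_degree[OF l l a(1) b(1) a(2)[symmetric]] a b l
    by (auto simp: grade_self cocycle_one)
  show ?thesis
    unfolding right using left l by (cases "b = m"; cases "a = l") auto
qed

subsection \<open>Matrix units\<close>

definition matrix_span :: "'l set \<Rightarrow> 'm set" where
  "matrix_span F = linear_span M ((\<lambda>p. rep_monomial (fst p) (snd p)) ` (F \<times> F))"

lemma norm_coefficient_le_norm_sum:
  assumes F: "equal_degree_paths n F" and l: "l \<in> F" and m: "m \<in> F"
    and y: "y = finsum M (\<lambda>p. cscale M (c p) (rep_monomial (fst p) (snd p))) (F \<times> F)"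
  shows "cmod (c (l, m)) * cnorm M (rep_monomial l m) \<le> cnorm M y"
proof -
  let ?T = "\<lambda>p. rep_monomial (fst p) (snd p)"
  let ?compress = "\<lambda>x. rep_monomial l l \<otimes>\<^bsub>M\<^esub> (x \<otimes>\<^bsub>M\<^esub> rep_monomial m m)"
  note F' = equal_degree_pathsD[OF F]
  have lm: "l \<in> kmor \<Lambda>" "m \<in> kmor \<Lambda>"
    using F'(4) l m by auto
  have car: "(\<lambda>p. cscale M (c p) (?T p)) \<in> F \<times> F \<rightarrow> carrier M"
    using F'(4) by auto
  then have y_closed: "y \<in> carrier M"
    unfolding y by (rule M.finsum_closed)
  have compress: "?compress (cscale M (c p) (?T p)) = (if p = (l, m) then cscale M (c (l, m)) (rep_monomial l m) else \<zero>\<^bsub>M\<^esub>)"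
    if p: "p \<in> F \<times> F" for p
  proof -
    have p': "fst p \<in> kmor \<Lambda>" "snd p \<in> kmor \<Lambda>" "kdeg \<Lambda> (fst p) = kdeg \<Lambda> l" "kdeg \<Lambda> (snd p) = kdeg \<Lambda> m"
      using p F'(4,5) l m by auto
    have "?compress (cscale M (c p) (?T p)) = cscale M (c p) (?compress (?T p))"
      using p' lm by (simp add: M.scale_mult_left M.scale_mult_right)
    then show ?thesis
      unfolding compress_rep_monomial[OF lm p'(1,3,2,4)] by (auto simp: prod_eq_iff)
  qed
  have "y \<otimes>\<^bsub>M\<^esub> rep_monomial m m = finsum M (\<lambda>p. cscale M (c p) (?T p) \<otimes>\<^bsub>M\<^esub> rep_monomial m m) (F \<times> F)"
    unfolding y using F'(2) car lm by (intro M.finsum_mult_right) auto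
  then have "?compress y = finsum M (\<lambda>p. ?compress (cscale M (c p) (?T p))) (F \<times> F)"
    using F'(2) car lm by (simp add: M.finsum_mult_left Pi_iff)
  also have "\<dots> = ?compress (cscale M (c (l, m)) (?T (l, m)))"
    using F'(2) l m lm compress by (intro M.finsum_single) auto
  also have "\<dots> = cscale M (c (l, m)) (rep_monomial l m)"
    using compress[of "(l, m)"] l m by simp
  finally have "cmod (c (l, m)) * cnorm M (rep_monomial l m) = cnorm M (?compress y)"
    using lm by (simp add: M.norm_scale)
  also have "\<dots> \<le> cnorm M y"
    using lm y_closed by (intro M.norm_projection_compression_le projection_rep_monomial)
  finally show ?thesis .
qed

lemma matrix_units_closed: "F \<subseteq> kmor \<Lambda> \<Longrightarrow> (\<lambda>p. rep_monomial (fst p) (snd p)) ` (F \<times> F) \<subseteq> carrier M"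
  by (auto simp: subset_iff)

lemma matrix_span_subspace: "F \<subseteq> kmor \<Lambda> \<Longrightarrow> linear_subspace M (matrix_span F)"
  unfolding matrix_span_def by (intro M.linear_span_subspace matrix_units_closed)

lemma rep_monomial_in_matrix_span: "\<lbrakk>l \<in> F; m \<in> F\<rbrakk> \<Longrightarrow> rep_monomial l m \<in> matrix_span F"
  unfolding matrix_span_def by (intro subsetD[OF M.subset_linear_span]) force

lemma matrix_span_minimal:
  "\<lbrakk>linear_subspace M S; \<And>l m. l \<in> F \<Longrightarrow> m \<in> F \<Longrightarrow> rep_monomial l m \<in> S\<rbrakk> \<Longrightarrow> matrix_span F \<subseteq> S"
  unfolding matrix_span_def by (intro M.linear_span_minimal) auto

lemma matrix_span_mono: "F \<subseteq> F' \<Longrightarrow> matrix_span F \<subseteq> matrix_span F'"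
  unfolding matrix_span_def by (intro M.linear_span_mono image_mono Sigma_mono) auto

lemma matrix_span_mult:
  assumes F: "equal_degree_paths n F" and x: "x \<in> matrix_span F" and y: "y \<in> matrix_span F"
  shows "x \<otimes>\<^bsub>M\<^esub> y \<in> matrix_span F"
proof -
  note F' = equal_degree_pathsD[OF F]
  note units = matrix_units_closed[OF F'(3)] and sub = matrix_span_subspace[OF F'(3)]
  show ?thesis
  proof (rule M.linear_span_mult[OF units units sub _ x[unfolded matrix_span_def] y[unfolded matrix_span_def]])
    fix a b assume "a \<in> (\<lambda>p. rep_monomial (fst p) (snd p)) ` (F \<times> F)" "b \<in> (\<lambda>p. rep_monomial (fst p) (snd p)) ` (F \<times> F)"
    then obtain l m u w where lmuw: "l \<in> F" "m \<in> F" "u \<in> F" "w \<in> F" "a = rep_monomial l m" "b = rep_monomial u w"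
      by auto
    then have "a \<otimes>\<^bsub>M\<^esub> b = (if m = u \<and> ksrc \<Lambda> l = ksrc \<Lambda> m
        then cscale M (\<sigma> (grade l m) (grade m w)) (rep_monomial l w) else \<zero>\<^bsub>M\<^esub>)"
      using F'(4,5) rep_monomial_mult_same_degree[of l m u w] by simp
    then show "a \<otimes>\<^bsub>M\<^esub> b \<in> matrix_span F"
      using M.subspaceD(2,4)[OF sub] rep_monomial_in_matrix_span lmuw by simp
  qed
qed

lemma matrix_span_adj:
  assumes F: "F \<subseteq> kmor \<Lambda>" and x: "x \<in> matrix_span F"
  shows "cadj M x \<in> matrix_span F"
proof (rule M.linear_span_adj[OF matrix_units_closed[OF F] matrix_span_subspace[OF F] _ x[unfolded matrix_span_def]])
  fix a assume "a \<in> (\<lambda>p. rep_monomial (fst p) (snd p)) ` (F \<times> F)"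
  then obtain l m where "l \<in> F" "m \<in> F" "a = rep_monomial l m"
    by auto
  then show "cadj M a \<in> matrix_span F"
    using F M.subspaceD(4)[OF matrix_span_subspace[OF F]] rep_monomial_in_matrix_span
    by (simp add: rep_monomial_adj subset_iff)
qed

lemma matrix_span_subset_extensions:
  assumes F: "equal_degree_paths p F" and q: "q \<in> degrees k"
  shows "matrix_span F \<subseteq> matrix_span (path_extensions F q)"
proof (rule matrix_span_minimal)
  note F' = equal_degree_pathsD[OF F]
  show sub: "linear_subspace M (matrix_span (path_extensions F q))"
    using equal_degree_pathsD(3)[OF equal_degree_paths_extensions[OF F q]] by (rule matrix_span_subspace)
  fix l m assume lm: "l \<in> F" "m \<in> F"
  note mor = F'(4)[OF lm(1)] F'(4)[OF lm(2)]
  show "rep_monomial l m \<in> matrix_span (path_extensions F q)"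
  proof (cases "ksrc \<Lambda> l = ksrc \<Lambda> m")
    case True
    have "kcomp \<Lambda> u a \<in> path_extensions F q"
      if "u \<in> F" "ksrc \<Lambda> u = ksrc \<Lambda> l" "a \<in> kpaths_to \<Lambda> (ksrc \<Lambda> l) q" for u a
      using that unfolding path_extensions_def by (intro UN_I[of u] imageI) auto
    then show ?thesis
      unfolding rep_monomial_expand[OF mor True q] using mor q lm True
      by (intro M.finsum_in_subspace[OF sub] finite_paths Pi_I rep_monomial_in_matrix_span) auto
  next
    case False
    then show ?thesis
      using rep_monomial_eq_zero[OF mor] M.subspaceD(2)[OF sub] by simp
  qed
qed

lemma matrix_spans_directed:
  assumes F: "equal_degree_paths p F" and H: "equal_degree_paths q H"
  obtains n K where "equal_degree_paths n K" "matrix_span F \<subseteq> matrix_span K" "matrix_span H \<subseteq> matrix_span K"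
proof -
  note deg = equal_degree_pathsD(1)[OF F] equal_degree_pathsD(1)[OF H]
  note gap = degree_gap_in_degrees[OF deg] degree_gap_in_degrees[OF deg(2,1)]
  let ?F = "path_extensions F (degree_gap p q)" and ?H = "path_extensions H (degree_gap q p)"
  have "equal_degree_paths (\<lambda>i. max (p i) (q i)) ?F" "equal_degree_paths (\<lambda>i. max (p i) (q i)) ?H"
    using equal_degree_paths_extensions[OF F gap(1)] equal_degree_paths_extensions[OF H gap(2)]
    by (simp_all add: add_degree_gap max.commute)
  then have "equal_degree_paths (\<lambda>i. max (p i) (q i)) (?F \<union> ?H)"
    by (auto simp: equal_degree_paths_def)
  moreover have "matrix_span F \<subseteq> matrix_span (?F \<union> ?H)" "matrix_span H \<subseteq> matrix_span (?F \<union> ?H)"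
    using matrix_span_subset_extensions[OF F gap(1)] matrix_span_subset_extensions[OF H gap(2)]
      matrix_span_mono[of ?F "?F \<union> ?H"] matrix_span_mono[of ?H "?F \<union> ?H"] by blast+
  ultimately show ?thesis
    by (rule that)
qed

lemma degree_zero_in_matrix_span:
  assumes "y \<in> homogeneous_span (\<lambda>i. 0)"
  shows "\<exists>n F. equal_degree_paths n F \<and> y \<in> matrix_span F"
  using assms rep_monomials_of_degree_closed
proof (induction rule: M.linear_span_induct)
  case (base x)
  then obtain l m where lm: "l \<in> kmor \<Lambda>" "m \<in> kmor \<Lambda>" "gauge_degree l m = (\<lambda>i. 0)" "x = rep_monomial l m"
    by (auto simp: rep_monomials_of_degree_def)
  then have "kdeg \<Lambda> l = kdeg \<Lambda> m"
    by (auto simp: gauge_degree_def fun_eq_iff)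
  then have "equal_degree_paths (kdeg \<Lambda> m) {l, m}"
    using lm deg_closed[OF lm(2)] by (simp add: equal_degree_paths_def)
  then show ?case
    using lm(4) rep_monomial_in_matrix_span[of l "{l, m}" m] by blast
next
  case zero
  have "equal_degree_paths (\<lambda>i. 0) {}"
    by (simp add: equal_degree_paths_def degrees_def)
  then show ?case
    using M.subspaceD(2)[OF matrix_span_subspace[of "{}"]] by blast
next
  case (add x y)
  obtain p F where F: "equal_degree_paths p F" "x \<in> matrix_span F"
    using add.IH(1) by blast
  obtain q H where H: "equal_degree_paths q H" "y \<in> matrix_span H"
    using add.IH(2) by blast
  obtain n K where K: "equal_degree_paths n K" "matrix_span F \<subseteq> matrix_span K" "matrix_span H \<subseteq> matrix_span K"
    using matrix_spans_directed[OF F(1) H(1)] by blast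
  then have "x \<oplus>\<^bsub>M\<^esub> y \<in> matrix_span K"
    using F(2) H(2) M.subspaceD(3)[OF matrix_span_subspace[OF equal_degree_pathsD(3)[OF K(1)]]] by blast
  then show ?case
    using K(1) by blast
next
  case (scale c x)
  then show ?case
    using M.subspaceD(4)[OF matrix_span_subspace[OF equal_degree_pathsD(3)]] by blast
qed

end

section \<open>Integration of representations\<close>

lemma integrates_comp:
  "\<lbrakk>integrates G B D \<iota> N \<tau> \<psi>; star_hom N M f\<rbrakk> \<Longrightarrow> integrates G B D \<iota> M (\<lambda>g b. f (\<tau> g b)) (\<lambda>x. f (\<psi> x))"
  by (auto simp: integrates_def intro: star_hom_comp)

lemma bundle_maps_closed: "\<lbrakk>bundle_maps G B M \<pi>; g \<in> carrier G; b \<in> fib B g\<rbrakk> \<Longrightarrow> \<pi> g b \<in> carrier M"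
  by (auto simp: bundle_maps_def)

lemma (in cstar_hom) bundle_maps_comp: "bundle_maps G E A \<pi> \<Longrightarrow> bundle_maps G E B (\<lambda>g b. f (\<pi> g b))"
  unfolding bundle_maps_def by (simp add: Pi_iff flip: hom_add hom_scale hom_mult hom_adj)

lemma (in cstar_embedding) bundle_maps_inv_into:
  assumes \<pi>: "bundle_maps G E B \<pi>"
    and range: "\<And>g b. \<lbrakk>g \<in> carrier G; b \<in> fib E g\<rbrakk> \<Longrightarrow> \<pi> g b \<in> f ` carrier A"
  shows "bundle_maps G E A (\<lambda>g b. inv_into (carrier A) f (\<pi> g b))"
  using \<pi> unfolding bundle_maps_def
  by (simp add: Pi_iff range inv_into_into flip: inv_into_add inv_into_scale inv_into_mult inv_into_adj)

lemma (in cstar_algebra) bundle_multiplier_rep_embed_multiplier: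
  assumes \<tau>: "bundle_rep G E A \<tau>"
  shows "bundle_multiplier_rep G E A (\<lambda>g b. embed_multiplier (\<tau> g b))"
proof -
  interpret embed: cstar_embedding A MA embed_multiplier
    by (rule cstar_embedding_multiplier)
  have maps: "bundle_maps G E A \<tau>"
    using \<tau> by (simp add: bundle_rep_def)
  have "{fst (embed_multiplier (\<tau> \<one>\<^bsub>G\<^esub> b)) a | b a. b \<in> fib E \<one>\<^bsub>G\<^esub> \<and> a \<in> carrier A}
      = {\<tau> \<one>\<^bsub>G\<^esub> b \<otimes> a | b a. b \<in> fib E \<one>\<^bsub>G\<^esub> \<and> a \<in> carrier A}"
    by (intro Collect_cong ex_cong1) (auto simp: embed_multiplier_apply)
  then show ?thesis
    using \<tau> embed.bundle_maps_comp[OF maps] by (simp add: bundle_multiplier_rep_def bundle_rep_def)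
qed

lemma universal_bundle_rep_integrates:
  fixes G :: "'g monoid" and E :: "('g, 'b) fell_data" and T :: "('g \<times> 'b) test cstar"
  assumes univ: "universal_bundle_rep G E D \<iota>" and T: "cstar_algebra T"
    and \<tau>: "bundle_rep G E T \<tau>"
  shows "\<exists>\<phi>. integrates G E D \<iota> T \<tau> \<phi>"
proof -
  interpret T: cstar_algebra T
    by (rule T)
  let ?MT = "multiplier_algebra T"
  interpret embed: cstar_embedding T ?MT T.embed_multiplier
    by (rule T.cstar_embedding_multiplier)
  have D: "cstar_algebra D" "bundle_maps G E D \<iota>"
    and generated: "cstar_generated D (\<Union>g\<in>carrier G. \<iota> g ` fib E g) = carrier D"
    using univ by (auto simp: universal_bundle_rep_def bundle_rep_def)
  have \<tau>_closed: "\<tau> g b \<in> carrier T" if "g \<in> carrier G" "b \<in> fib E g" for g b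
    using \<tau> that by (auto simp: bundle_rep_def intro: bundle_maps_closed)
  obtain \<psi> where "integrates G E D \<iota> ?MT (\<lambda>g b. T.embed_multiplier (\<tau> g b)) \<psi>"
    using univ T T.bundle_multiplier_rep_embed_multiplier[OF \<tau>] unfolding universal_bundle_rep_def by blast
  then have \<psi>: "star_hom D ?MT \<psi>"
    and \<psi>_\<iota>: "\<And>g b. \<lbrakk>g \<in> carrier G; b \<in> fib E g\<rbrakk> \<Longrightarrow> \<psi> (\<iota> g b) = T.embed_multiplier (\<tau> g b)"
    by (auto simp: integrates_def)
  interpret \<psi>: cstar_hom D ?MT \<psi>
    using D(1) \<psi> embed.B.cstar_algebra_axioms by (simp add: cstar_hom_def cstar_hom_axioms_def)
  have "\<psi> ` carrier D \<subseteq> T.embed_multiplier ` carrier T"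
  proof (rule \<psi>.image_generated_subset[OF _ generated embed.range_subalgebra])
    show "(\<Union>g\<in>carrier G. \<iota> g ` fib E g) \<subseteq> carrier D"
      using bundle_maps_closed[OF D(2)] by blast
    show "\<psi> ` (\<Union>g\<in>carrier G. \<iota> g ` fib E g) \<subseteq> T.embed_multiplier ` carrier T"
      using \<psi>_\<iota> \<tau>_closed by auto
  qed
  then have "star_hom D T (\<lambda>x. inv_into (carrier T) T.embed_multiplier (\<psi> x))"
    by (rule embed.star_hom_inv_into[OF \<psi>])
  then show ?thesis
    using \<psi>_\<iota> \<tau>_closed inv_into_f_f[OF embed.inj_on_carrier] by (auto simp: integrates_def)
qed

definition encode_lists :: "(nat \<Rightarrow> 'x list) \<Rightarrow> 'x test" where
  "encode_lists F n = (let (i, j) = prod_decode n in if j < length (F i) then (F i ! j, 1) else (undefined, 0))"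

lemma inj_encode_lists: "inj encode_lists"
proof (rule injI, rule ext)
  fix F H :: "nat \<Rightarrow> 'a list" and i
  assume eq: "encode_lists F = encode_lists H"
  have entry: "(if j < length (F i) then (F i ! j, 1) else (undefined, 0 :: complex))
      = (if j < length (H i) then (H i ! j, 1) else (undefined, 0))" for j
    using fun_cong[OF eq, of "prod_encode (i, j)"] by (simp add: encode_lists_def)
  have "j < length (F i) \<longleftrightarrow> j < length (H i)" for j
    using entry[of j] by (auto split: if_splits)
  then have length: "length (F i) = length (H i)"
    by (metis linorder_neq_iff)
  then show "F i = H i"
  proof (rule nth_equalityI)
    show "F i ! j = H i ! j" if "j < length (F i)" for j
      using entry[of j] that length by simp
  qed
qed

text \<open>An element of the closure is coded by a sequence converging to it.\<close>

lemma (in cstar_algebra) closure_embeds_into_test: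
  fixes sum_of :: "'x list \<Rightarrow> 'a"
  assumes S: "S \<subseteq> carrier A" "S \<subseteq> range sum_of"
  obtains code :: "'a \<Rightarrow> 'x test" where "inj_on code (ctopology A closure_of S)"
proof -
  have "\<exists>F. clim A (\<lambda>n. sum_of (F n)) x" if x: "x \<in> ctopology A closure_of S" for x
  proof -
    obtain u where u: "\<And>n. u n \<in> S" "clim A u x"
      using in_closure_obtains_clim[OF S(1) x] by blast
    have "\<exists>p. u n = sum_of p" for n
      using u(1)[of n] S(2) by blast
    then obtain F where "\<And>n. u n = sum_of (F n)"
      by metis
    then have "u = (\<lambda>n. sum_of (F n))"
      by blast
    then show ?thesis
      using u(2) by auto
  qed
  then obtain lists where lists: "\<And>x. x \<in> ctopology A closure_of S \<Longrightarrow> clim A (\<lambda>n. sum_of (lists x n)) x"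
    by metis
  have "inj_on lists (ctopology A closure_of S)"
  proof (rule inj_onI)
    fix x y assume xy: "x \<in> ctopology A closure_of S" "y \<in> ctopology A closure_of S" "lists x = lists y"
    show "x = y"
      using clim_unique[OF lists[OF xy(1)]] lists[OF xy(2)] xy(3) by simp
  qed
  then have "inj_on (encode_lists \<circ> lists) (ctopology A closure_of S)"
    using inj_encode_lists by (intro comp_inj_on) (auto intro: inj_on_subset)
  then show ?thesis
    by (rule that)
qed

context twisted_rep
begin

definition fibre_lists :: "('g \<times> 'c) list set" where
  "fibre_lists = {ps. \<forall>(g, b)\<in>set ps. g \<in> carrier G \<and> b \<in> fibre g}"

definition rep_sum :: "('g \<times> 'c) list \<Rightarrow> 'm" where
  "rep_sum ps = foldr (\<lambda>(g, b). add M (\<pi> g b)) ps \<zero>\<^bsub>M\<^esub>"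

lemma rep_sum_simps [simp]:
  "rep_sum [] = \<zero>\<^bsub>M\<^esub>" "rep_sum ((g, b) # ps) = \<pi> g b \<oplus>\<^bsub>M\<^esub> rep_sum ps"
  by (simp_all add: rep_sum_def)

lemma fibre_lists_simps [simp]:
  "[] \<in> fibre_lists" "(g, b) # ps \<in> fibre_lists \<longleftrightarrow> g \<in> carrier G \<and> b \<in> fibre g \<and> ps \<in> fibre_lists"
  by (auto simp: fibre_lists_def)

lemma rep_sum_closed: "ps \<in> fibre_lists \<Longrightarrow> rep_sum ps \<in> carrier M"
  by (induction ps) (auto simp: \<pi>_closed)

lemma rep_sum_append:
  "\<lbrakk>ps \<in> fibre_lists; qs \<in> fibre_lists\<rbrakk> \<Longrightarrow> ps @ qs \<in> fibre_lists \<and> rep_sum (ps @ qs) = rep_sum ps \<oplus>\<^bsub>M\<^esub> rep_sum qs"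
  by (induction ps) (auto simp: rep_sum_closed \<pi>_closed M.a_assoc)

lemma rep_sum_scale:
  "ps \<in> fibre_lists \<Longrightarrow> map (apsnd (cscale C c)) ps \<in> fibre_lists \<and>
    rep_sum (map (apsnd (cscale C c)) ps) = cscale M c (rep_sum ps)"
  by (induction ps) (auto simp: rep_sum_closed \<pi>_closed \<pi>_scale M.scale_add fibre_scale)

lemma rep_sums_subspace: "linear_subspace M (rep_sum ` fibre_lists)"
  unfolding linear_subspace_def
proof (intro conjI ballI allI)
  show "\<zero>\<^bsub>M\<^esub> \<in> rep_sum ` fibre_lists"
    by (rule image_eqI[of _ _ "[]"]) simp_all
  fix x c assume "x \<in> rep_sum ` fibre_lists"
  then obtain ps where ps: "ps \<in> fibre_lists" "x = rep_sum ps"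
    by blast
  show "cscale M c x \<in> rep_sum ` fibre_lists"
    using rep_sum_scale[OF ps(1), of c] ps(2) by (intro image_eqI[of _ _ "map (apsnd (cscale C c)) ps"]) simp_all
  fix y assume "y \<in> rep_sum ` fibre_lists"
  then obtain qs where qs: "qs \<in> fibre_lists" "y = rep_sum qs"
    by blast
  show "x \<oplus>\<^bsub>M\<^esub> y \<in> rep_sum ` fibre_lists"
    using rep_sum_append[OF ps(1) qs(1)] ps(2) qs(2) by (intro image_eqI[of _ _ "ps @ qs"]) simp_all
qed (auto intro: rep_sum_closed)

lemma rep_span_subset_rep_sums: "rep_span \<subseteq> rep_sum ` fibre_lists"
proof (rule M.linear_span_minimal[OF rep_sums_subspace], rule subsetI)
  fix x assume "x \<in> rep_monomials"
  then obtain l m where lm: "l \<in> kmor \<Lambda>" "m \<in> kmor \<Lambda>" "x = rep_monomial l m"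
    by (auto simp: rep_monomials_def)
  then show "x \<in> rep_sum ` fibre_lists"
    using rep_monomial_closed[OF lm(1,2)] monomial_in_fibre[OF lm(1,2)]
    by (intro image_eqI[of _ _ "[(grade l m, monomial l m)]"]) (simp_all add: rep_monomial_def)
qed

lemma rep_algebra_embeds_into_test:
  obtains N :: "('g \<times> 'c) test cstar" and j where "cstar_embedding N M j" "j ` carrier N = rep_algebra"
proof -
  obtain code :: "'m \<Rightarrow> ('g \<times> 'c) test" where inj: "inj_on code rep_algebra"
    using M.closure_embeds_into_test[OF M.linear_span_subset_carrier[OF rep_monomials_closed], of rep_sum]
      rep_span_subset_rep_sums unfolding closed_span_def by blast
  show ?thesis
  proof (rule that)
    show "cstar_embedding (cstar_image M rep_algebra code) M (inv_into rep_algebra code)"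
      using rep_algebra_subalgebra inj by (rule M.cstar_embedding_inv_into)
    show "inv_into rep_algebra code ` carrier (cstar_image M rep_algebra code) = rep_algebra"
      by (simp add: cstar_image_simps(1)[OF inj] image_image inv_into_f_f[OF inj])
  qed
qed

lemma rep_monomials_subset_unit_fibre_products:
  "rep_monomials \<subseteq> {\<pi> \<one>\<^bsub>G\<^esub> b \<otimes>\<^bsub>M\<^esub> x | b x. b \<in> fibre \<one>\<^bsub>G\<^esub> \<and> x \<in> rep_algebra}"
proof
  fix x assume "x \<in> rep_monomials"
  then obtain l m where lm: "l \<in> kmor \<Lambda>" "m \<in> kmor \<Lambda>" "x = rep_monomial l m"
    by (auto simp: rep_monomials_def)
  then have "x = \<pi> \<one>\<^bsub>G\<^esub> (s (krng \<Lambda> l)) \<otimes>\<^bsub>M\<^esub> x" "x \<in> rep_algebra"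
    using rng_mult_rep_monomial[OF lm(1,2)] rep_span_in_algebra[OF rep_monomial_in_span[OF lm(1,2)]] by simp_all
  then show "x \<in> {\<pi> \<one>\<^bsub>G\<^esub> b \<otimes>\<^bsub>M\<^esub> x | b x. b \<in> fibre \<one>\<^bsub>G\<^esub> \<and> x \<in> rep_algebra}"
    using vertex_in_fibre[OF rng_vertex[OF lm(1)]] by blast
qed

lemma bundle_rep_inv_into:
  assumes emb: "cstar_embedding N M j" and range: "j ` carrier N = rep_algebra"
  shows "bundle_rep G (deformed_bundle G \<sigma> graph_bundle) N (\<lambda>g b. inv_into (carrier N) j (\<pi> g b))"
proof -
  interpret j: cstar_embedding N M j
    by (rule emb)
  let ?\<tau> = "\<lambda>g b. inv_into (carrier N) j (\<pi> g b)"
  let ?X = "{?\<tau> \<one>\<^bsub>G\<^esub> b \<otimes>\<^bsub>N\<^esub> a | b a. b \<in> fibre \<one>\<^bsub>G\<^esub> \<and> a \<in> carrier N}"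
  have in_range: "\<pi> g b \<in> j ` carrier N" if "g \<in> carrier G" "b \<in> fibre g" for g b
    using \<pi>_in_rep_algebra[OF that] range by simp
  have j\<tau>: "j (?\<tau> g b) = \<pi> g b" "?\<tau> g b \<in> carrier N" if "g \<in> carrier G" "b \<in> fibre g" for g b
    using f_inv_into_f[OF in_range[OF that]] inv_into_into[OF in_range[OF that]] by auto
  have X: "?X \<subseteq> carrier N"
    using j\<tau>(2) by auto
  have products: "{\<pi> \<one>\<^bsub>G\<^esub> b \<otimes>\<^bsub>M\<^esub> x | b x. b \<in> fibre \<one>\<^bsub>G\<^esub> \<and> x \<in> rep_algebra} \<subseteq> j ` ?X"
  proof
    fix y assume "y \<in> {\<pi> \<one>\<^bsub>G\<^esub> b \<otimes>\<^bsub>M\<^esub> x | b x. b \<in> fibre \<one>\<^bsub>G\<^esub> \<and> x \<in> rep_algebra}"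
    then obtain b a where ba: "b \<in> fibre \<one>\<^bsub>G\<^esub>" "a \<in> carrier N" "y = \<pi> \<one>\<^bsub>G\<^esub> b \<otimes>\<^bsub>M\<^esub> j a"
      unfolding range[symmetric] by blast
    then have "y = j (?\<tau> \<one>\<^bsub>G\<^esub> b \<otimes>\<^bsub>N\<^esub> a)"
      using j\<tau> by (simp add: j.hom_mult)
    then show "y \<in> j ` ?X"
      using ba by blast
  qed
  have image_closed: "j ` ?X \<subseteq> carrier M"
    using X by auto
  have "rep_monomials \<subseteq> closed_span M (j ` ?X)"
    using rep_monomials_subset_unit_fibre_products products M.subset_closed_span[OF image_closed] by (rule order_trans[OF order_trans])
  then have "rep_algebra \<subseteq> closed_span M (j ` ?X)"
    by (rule M.closed_span_minimal[OF M.closed_span_subspace[OF image_closed] M.closed_span_closed])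
  then have "closed_span N ?X = carrier N"
    using j.closed_span_eq_carrier[OF X] by (simp add: range)
  then show ?thesis
    using j.bundle_maps_inv_into[OF maps] in_range by (simp add: bundle_rep_def deformed_bundle_fib)
qed

theorem universal_integrates:
  assumes univ: "universal_bundle_rep G (deformed_bundle G \<sigma> graph_bundle) D \<iota>"
  shows "\<exists>\<phi>. integrates G (deformed_bundle G \<sigma> graph_bundle) D \<iota> M \<pi> \<phi>"
proof -
  obtain N :: "('g \<times> 'c) test cstar" and j where j: "cstar_embedding N M j" "j ` carrier N = rep_algebra"
    by (rule rep_algebra_embeds_into_test)
  interpret j: cstar_embedding N M j
    by (rule j)
  let ?\<tau> = "\<lambda>g b. inv_into (carrier N) j (\<pi> g b)"
  obtain \<psi> where "integrates G (deformed_bundle G \<sigma> graph_bundle) D \<iota> N ?\<tau> \<psi>"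
    using universal_bundle_rep_integrates[OF univ j.A.cstar_algebra_axioms bundle_rep_inv_into[OF j]] by blast
  from integrates_comp[OF this j.hom]
  have "integrates G (deformed_bundle G \<sigma> graph_bundle) D \<iota> M (\<lambda>g b. j (?\<tau> g b)) (\<lambda>x. j (\<psi> x))" .
  moreover have "j (?\<tau> g b) = \<pi> g b" if "g \<in> carrier G" "b \<in> fibre g" for g b
    using \<pi>_in_rep_algebra[OF that] j(2) by (simp add: f_inv_into_f)
  ultimately have "integrates G (deformed_bundle G \<sigma> graph_bundle) D \<iota> M \<pi> (\<lambda>x. j (\<psi> x))"
    by (simp add: integrates_def deformed_bundle_fib)
  then show ?thesis
    by blast
qed

end

section \<open>Injectivity on homogeneous parts\<close>

locale intertwined_reps =
  I: twisted_rep k \<Lambda> C s G \<eta> D \<sigma> \<iota> + R: twisted_rep k \<Lambda> C s G \<eta> M \<sigma> \<rho> + h: cstar_hom D M \<phi>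
  for k :: nat and \<Lambda> :: "'l kgraph" and C :: "'c cstar" and s :: "'l \<Rightarrow> 'c"
    and G :: "'g monoid" and \<eta> :: "'l \<Rightarrow> 'g" and \<sigma> :: "'g \<Rightarrow> 'g \<Rightarrow> complex"
    and D :: "'d cstar" and \<iota> :: "'g \<Rightarrow> 'c \<Rightarrow> 'd" and M :: "'m cstar" and \<rho> :: "'g \<Rightarrow> 'c \<Rightarrow> 'm"
    and \<phi> :: "'d \<Rightarrow> 'm" +
  assumes intertwines: "\<lbrakk>g \<in> carrier G; b \<in> I.fibre g\<rbrakk> \<Longrightarrow> \<phi> (\<iota> g b) = \<rho> g b"
    and nonzero: "v \<in> kvertices \<Lambda> \<Longrightarrow> \<rho> \<one>\<^bsub>G\<^esub> (s v) \<noteq> \<zero>\<^bsub>M\<^esub>"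
begin

lemma \<phi>_rep_monomial: "\<lbrakk>l \<in> kmor \<Lambda>; m \<in> kmor \<Lambda>\<rbrakk> \<Longrightarrow> \<phi> (I.rep_monomial l m) = R.rep_monomial l m"
  by (simp add: I.rep_monomial_def R.rep_monomial_def intertwines I.monomial_in_fibre)

lemma norm_scaled_rep_monomial_le:
  assumes F: "I.equal_degree_paths n F" and p: "p \<in> F \<times> F"
    and y: "y = finsum M (\<lambda>p. cscale M (c p) (R.rep_monomial (fst p) (snd p))) (F \<times> F)"
  shows "cnorm D (cscale D (c p) (I.rep_monomial (fst p) (snd p)))
    \<le> cnorm D (I.rep_monomial (fst p) (snd p)) / cnorm M (R.rep_monomial (fst p) (snd p)) * cnorm M y"
proof -
  obtain l m where lm: "p = (l, m)" "l \<in> F" "m \<in> F"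
    using p by auto
  note mor = I.equal_degree_pathsD(4)[OF F lm(2)] I.equal_degree_pathsD(4)[OF F lm(3)]
  show ?thesis
  proof (cases "ksrc \<Lambda> l = ksrc \<Lambda> m")
    case True
    have "R.rep_monomial l m \<noteq> \<zero>\<^bsub>M\<^esub>"
      using nonzero mor True by (intro R.rep_monomial_nonzero) auto
    then have pos: "cnorm M (R.rep_monomial l m) > 0"
      using R.M.norm_nonneg[of "R.rep_monomial l m"] R.M.norm_eq_0[of "R.rep_monomial l m"] mor by force
    have "cmod (c (l, m)) \<le> cnorm M y / cnorm M (R.rep_monomial l m)"
      using R.norm_coefficient_le_norm_sum[OF F lm(2,3) y] pos by (simp add: pos_le_divide_eq)
    then have "cmod (c (l, m)) * cnorm D (I.rep_monomial l m)
        \<le> cnorm M y / cnorm M (R.rep_monomial l m) * cnorm D (I.rep_monomial l m)"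
      using I.M.norm_nonneg[of "I.rep_monomial l m"] mor by (intro mult_right_mono) auto
    then show ?thesis
      using lm mor by (simp add: I.M.norm_scale mult.commute)
  qed (use lm mor I.rep_monomial_eq_zero[OF mor] in simp)
qed

lemma matrix_span_bounded_below:
  assumes F: "I.equal_degree_paths n F"
  obtains K where "\<And>y. y \<in> I.matrix_span F \<Longrightarrow> cnorm D y \<le> K * cnorm M (\<phi> y)"
proof
  let ?I = "\<lambda>p. I.rep_monomial (fst p) (snd p)" and ?R = "\<lambda>p. R.rep_monomial (fst p) (snd p)"
  fix y assume y: "y \<in> I.matrix_span F"
  have mor: "fst p \<in> kmor \<Lambda>" "snd p \<in> kmor \<Lambda>" if "p \<in> F \<times> F" for p
    using that I.equal_degree_pathsD(4)[OF F] by auto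
  have fin: "finite (F \<times> F)"
    using I.equal_degree_pathsD(2)[OF F] by simp
  have units: "?I \<in> F \<times> F \<rightarrow> carrier D"
    using mor by blast
  obtain c where c: "y = finsum D (\<lambda>p. cscale D (c p) (?I p)) (F \<times> F)"
    using I.M.in_linear_span_finite_image[OF fin units] y unfolding I.matrix_span_def by blast
  have summands: "(\<lambda>p. cscale D (c p) (?I p)) \<in> F \<times> F \<rightarrow> carrier D"
    using units by (auto simp: Pi_iff)
  have "\<phi> y = finsum M (\<lambda>p. \<phi> (cscale D (c p) (?I p))) (F \<times> F)"
    unfolding c using fin summands by (rule h.hom_finsum)
  also have "\<dots> = finsum M (\<lambda>p. cscale M (c p) (?R p)) (F \<times> F)"
    using mor by (intro R.M.finsum_cong') (auto simp: h.hom_scale \<phi>_rep_monomial Pi_iff)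
  finally have \<phi>y: "\<phi> y = finsum M (\<lambda>p. cscale M (c p) (?R p)) (F \<times> F)" .
  have "cnorm D y \<le> (\<Sum>p\<in>F \<times> F. cnorm D (cscale D (c p) (?I p)))"
    unfolding c using fin summands by (rule I.M.norm_finsum)
  also have "\<dots> \<le> (\<Sum>p\<in>F \<times> F. cnorm D (?I p) / cnorm M (?R p) * cnorm M (\<phi> y))"
    by (intro sum_mono norm_scaled_rep_monomial_le[OF F _ \<phi>y])
  finally show "cnorm D y \<le> (\<Sum>p\<in>F \<times> F. cnorm D (?I p) / cnorm M (?R p)) * cnorm M (\<phi> y)"
    by (simp add: sum_distrib_right)
qed

lemma matrix_span_norm_le:
  assumes F: "I.equal_degree_paths n F" and y: "y \<in> I.matrix_span F"
  shows "cnorm D y \<le> cnorm M (\<phi> y)"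
proof -
  note mor = I.equal_degree_pathsD(3)[OF F]
  obtain K where K: "\<And>y. y \<in> I.matrix_span F \<Longrightarrow> cnorm D y \<le> K * cnorm M (\<phi> y)"
    using matrix_span_bounded_below[OF F] by blast
  show ?thesis
    by (rule h.norm_le_if_bounded_below[OF I.M.subspaceD(1)[OF I.matrix_span_subspace[OF mor]]
          I.matrix_span_mult[OF F] I.matrix_span_adj[OF mor] K y])
qed

lemma homogeneous_span_norm_le:
  assumes y: "y \<in> I.homogeneous_span n" shows "cnorm D y \<le> cnorm M (\<phi> y)"
proof (rule power2_le_imp_le)
  have y_closed: "y \<in> carrier D"
    using y by (intro I.rep_span_in_carrier I.homogeneous_span_in_span)
  then show "0 \<le> cnorm M (\<phi> y)"
    by (simp add: R.M.norm_nonneg)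
  have "cadj D y \<otimes>\<^bsub>D\<^esub> y \<in> I.homogeneous_span (\<lambda>i. 0)"
    using I.homogeneous_span_mult[OF I.homogeneous_span_adj[OF y] y] by simp
  then obtain p F where "I.equal_degree_paths p F" "cadj D y \<otimes>\<^bsub>D\<^esub> y \<in> I.matrix_span F"
    using I.degree_zero_in_matrix_span by blast
  then have "cnorm D (cadj D y \<otimes>\<^bsub>D\<^esub> y) \<le> cnorm M (\<phi> (cadj D y \<otimes>\<^bsub>D\<^esub> y))"
    by (rule matrix_span_norm_le)
  then show "(cnorm D y)\<^sup>2 \<le> (cnorm M (\<phi> y))\<^sup>2"
    using y_closed by (simp add: I.M.norm_adj_mult h.hom_mult h.hom_adj R.M.norm_adj_mult)
qed

end

section \<open>Injectivity of equivariant representations\<close>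

locale equivariant_reps = intertwined_reps k \<Lambda> C s G \<eta> \<sigma> D \<iota> M \<rho> \<phi>
  for k :: nat and \<Lambda> :: "'l kgraph" and C :: "'c cstar" and s :: "'l \<Rightarrow> 'c"
    and G :: "'g monoid" and \<eta> :: "'l \<Rightarrow> 'g" and \<sigma> :: "'g \<Rightarrow> 'g \<Rightarrow> complex"
    and D :: "'d cstar" and \<iota> :: "'g \<Rightarrow> 'c \<Rightarrow> 'd" and M :: "'m cstar" and \<rho> :: "'g \<Rightarrow> 'c \<Rightarrow> 'm"
    and \<phi> :: "'d \<Rightarrow> 'm" +
  fixes \<beta> :: "(nat \<Rightarrow> complex) \<Rightarrow> 'd \<Rightarrow> 'd" and \<alpha> :: "(nat \<Rightarrow> complex) \<Rightarrow> 'm \<Rightarrow> 'm"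
  assumes generated: "cstar_generated D (\<Union>g\<in>carrier G. \<iota> g ` I.fibre g) = carrier D"
    and gauge: "gauge_action k \<Lambda> G \<eta> C s D \<iota> \<beta>"
    and \<alpha>_action: "torus_action k M \<alpha>"
    and equivariant: "\<lbrakk>z \<in> torus k; g \<in> carrier G; b \<in> I.fibre g\<rbrakk>
      \<Longrightarrow> \<rho> g (on_fibre I.graph_bundle \<iota> (\<beta> z) g b) = \<alpha> z (\<rho> g b)"
begin

sublocale \<beta>: torus_cstar_algebra D k \<beta>
  using gauge by unfold_locales (simp add: gauge_action_def continuous_torus_action_def)

sublocale \<alpha>: torus_cstar_algebra M k \<alpha>
  by unfold_locales (rule \<alpha>_action)

lemma \<beta>_continuous:
  "x \<in> carrier D \<Longrightarrow> continuous_map (top_of_set (torus k)) (ctopology D) (\<lambda>z. \<beta> z x)"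
  using gauge by (simp add: gauge_action_def continuous_torus_action_def)

lemma rep_algebra_eq_carrier: "I.rep_algebra = carrier D"
proof
  show "I.rep_algebra \<subseteq> carrier D"
    by (rule I.M.closed_span_subset_carrier)
  have "(\<Union>g\<in>carrier G. \<iota> g ` I.fibre g) \<subseteq> I.rep_algebra"
    using I.\<pi>_in_rep_algebra by blast
  then have "cstar_generated D (\<Union>g\<in>carrier G. \<iota> g ` I.fibre g) \<subseteq> I.rep_algebra"
    unfolding cstar_generated_def using I.rep_algebra_subalgebra by blast
  then show "carrier D \<subseteq> I.rep_algebra"
    using generated by simp
qed

lemma \<beta>_rep_monomial:
  "\<lbrakk>z \<in> torus k; l \<in> kmor \<Lambda>; m \<in> kmor \<Lambda>\<rbrakk>
    \<Longrightarrow> \<beta> z (I.rep_monomial l m) = cscale D (torus_char k z (I.gauge_degree l m)) (I.rep_monomial l m)"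
  using gauge unfolding gauge_action_def
  by (simp add: I.rep_monomial_def I.grade_def I.gauge_degree_def torus_char_def gauge_character_def)

lemma \<phi>_equivariant_rep_monomial:
  assumes z: "z \<in> torus k" and l: "l \<in> kmor \<Lambda>" and m: "m \<in> kmor \<Lambda>"
  shows "\<phi> (\<beta> z (I.rep_monomial l m)) = \<alpha> z (R.rep_monomial l m)"
proof -
  let ?g = "I.grade l m" and ?x = "I.monomial l m"
  let ?b = "on_fibre I.graph_bundle \<iota> (\<beta> z) ?g ?x"
  note g = I.grade_closed[OF l m] and x = I.monomial_in_fibre[OF l m]
  have "\<beta> z (\<iota> ?g ?x) = \<iota> ?g (cscale C (torus_char k z (I.gauge_degree l m)) ?x)"
    using \<beta>_rep_monomial[OF z l m] I.\<pi>_scale[OF g x] by (simp add: I.rep_monomial_def)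
  then have image: "\<beta> z (\<iota> ?g ?x) \<in> \<iota> ?g ` I.fibre ?g"
    using I.fibre_scale[OF x] by simp
  have b: "?b \<in> I.fibre ?g" "\<iota> ?g ?b = \<beta> z (\<iota> ?g ?x)"
    using inv_into_into[OF image] f_inv_into_f[OF image] by (simp_all add: on_fibre_def I.bundle_simps)
  have "\<phi> (\<beta> z (I.rep_monomial l m)) = \<rho> ?g ?b"
    using intertwines[OF g b(1)] b(2) by (simp add: I.rep_monomial_def)
  also have "\<dots> = \<alpha> z (R.rep_monomial l m)"
    unfolding R.rep_monomial_def using z g x by (rule equivariant)
  finally show ?thesis .
qed

lemma \<phi>_equivariant:
  assumes z: "z \<in> torus k" and y: "y \<in> I.rep_span" shows "\<phi> (\<beta> z y) = \<alpha> z (\<phi> y)"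
  using y I.rep_monomials_closed
proof (induction rule: I.M.linear_span_induct)
  case (base x)
  then show ?case
    using \<phi>_equivariant_rep_monomial[OF z] \<phi>_rep_monomial by (auto simp: I.rep_monomials_def)
next
  case zero
  show ?case
    using z by simp
next
  case (add x y)
  then show ?case
    using z I.rep_span_in_carrier by (simp add: \<beta>.action_add \<alpha>.action_add h.hom_add)
next
  case (scale c x)
  then show ?case
    using z I.rep_span_in_carrier by (simp add: \<beta>.action_scale \<alpha>.action_scale h.hom_scale)
qed

lemma coefficient_rep_monomial_in_homogeneous_span:
  assumes l: "l \<in> kmor \<Lambda>" and m: "m \<in> kmor \<Lambda>"
    and N: "N > 0" "\<And>i. i < k \<Longrightarrow> \<bar>I.gauge_degree l m i - n i\<bar> < int N" and n: "\<And>i. i \<ge> k \<Longrightarrow> n i = 0"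
  shows "\<beta>.coefficient n N (I.rep_monomial l m) \<in> I.homogeneous_span n"
proof -
  have coeff: "\<beta>.coefficient n N (I.rep_monomial l m)
      = (if \<forall>i<k. I.gauge_degree l m i = n i then I.rep_monomial l m else \<zero>\<^bsub>D\<^esub>)"
    using l m \<beta>_rep_monomial[OF _ l m] N by (intro \<beta>.coefficient_homogeneous) auto
  show ?thesis
  proof (cases "\<forall>i<k. I.gauge_degree l m i = n i")
    case True
    moreover have "I.gauge_degree l m i = n i" if "i \<ge> k" for i
      using that n[OF that] I.deg_closed[OF l] I.deg_closed[OF m] by (simp add: I.gauge_degree_def degrees_def)
    ultimately have "I.gauge_degree l m = n"
      by (metis ext not_less)
    then show ?thesis
      using True I.rep_monomial_in_homogeneous_span[OF l m] by (simp add: coeff)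
  next
    case False
    show ?thesis
      unfolding coeff if_not_P[OF False] by (rule I.M.subspaceD(2)[OF I.homogeneous_span_subspace])
  qed
qed

lemma eventually_coefficient_homogeneous:
  assumes y: "y \<in> I.rep_span" and n: "\<And>i. i \<ge> k \<Longrightarrow> n i = 0"
  shows "\<forall>\<^sub>F N in sequentially. \<beta>.coefficient n N y \<in> I.homogeneous_span n"
  using y I.rep_monomials_closed
proof (induction rule: I.M.linear_span_induct)
  case (base x)
  then obtain l m where lm: "l \<in> kmor \<Lambda>" "m \<in> kmor \<Lambda>" "x = I.rep_monomial l m"
    by (auto simp: I.rep_monomials_def)
  let ?d = "\<lambda>i. \<bar>I.gauge_degree l m i - n i\<bar>"
  have "?d i < int N" if "nat (\<Sum>i<k. ?d i) < N" "i < k" for i N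
    using member_le_sum[of i "{..<k}" ?d] that by simp
  then have "\<beta>.coefficient n N x \<in> I.homogeneous_span n" if "nat (\<Sum>i<k. ?d i) < N" for N
    unfolding lm(3) using that by (intro coefficient_rep_monomial_in_homogeneous_span lm n) auto
  then show ?case
    using eventually_gt_at_top by (rule eventually_mono[rotated])
next
  case zero
  show ?case
    using I.M.subspaceD(2)[OF I.homogeneous_span_subspace] by (simp add: \<beta>.coefficient_zero)
next
  case (add x y)
  from add.IH show ?case
    by eventually_elim
      (use add.hyps I.rep_span_in_carrier I.M.subspaceD(3)[OF I.homogeneous_span_subspace] in \<open>simp add: \<beta>.coefficient_add\<close>)
next
  case (scale c x)
  from scale.IH show ?case
    by eventually_elim
      (use scale.hyps I.rep_span_in_carrier I.M.subspaceD(4)[OF I.homogeneous_span_subspace] in \<open>simp add: \<beta>.coefficient_scale\<close>)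
qed

lemma eventually_norm_coefficient_le:
  assumes y: "y \<in> I.rep_span" and n: "\<And>i. i \<ge> k \<Longrightarrow> n i = 0"
  shows "\<forall>\<^sub>F N in sequentially. cnorm D (\<beta>.coefficient n N y) \<le> cnorm M (\<phi> y)"
proof -
  have "\<forall>\<^sub>F N in sequentially. \<beta>.coefficient n N y \<in> I.homogeneous_span n"
    using y n by (rule eventually_coefficient_homogeneous)
  then show ?thesis
    using eventually_gt_at_top[of 0]
  proof eventually_elim
    case (elim N)
    have y_closed: "y \<in> carrier D"
      using y by (rule I.rep_span_in_carrier)
    have "cnorm D (\<beta>.coefficient n N y) \<le> cnorm M (\<phi> (\<beta>.coefficient n N y))"
      using elim(1) by (rule homogeneous_span_norm_le)
    also have "\<phi> (\<beta>.coefficient n N y) = \<alpha>.coefficient n N (\<phi> y)"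
      by (rule hom_fourier_coefficient[OF \<beta>.torus_cstar_algebra_axioms \<alpha>.torus_cstar_algebra_axioms
            h.cstar_hom_axioms y_closed \<phi>_equivariant[OF _ y]])
    also have "cnorm M \<dots> \<le> cnorm M (\<phi> y)"
      using h.hom_closed[OF y_closed] elim(2) by (rule \<alpha>.norm_coefficient_le)
    finally show ?case .
  qed
qed

lemma eventually_norm_mean_le:
  assumes y: "y \<in> I.rep_span" and m: "m > 0"
  shows "\<forall>\<^sub>F N in sequentially. cnorm D (\<beta>.mean m N y) \<le> real (m ^ k) * cnorm M (\<phi> y)"
proof -
  have "\<forall>\<^sub>F N in sequentially. \<forall>q\<in>fejer_pairs k m.
      cnorm D (\<beta>.coefficient (fejer_frequency k q) N y) \<le> cnorm M (\<phi> y)"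
    using y by (intro eventually_ball_finite ballI eventually_norm_coefficient_le)
      (simp_all add: fejer_frequency_def)
  then show ?thesis
    by eventually_elim (use y m in \<open>intro \<beta>.norm_mean_le_coefficients I.rep_span_in_carrier; simp\<close>)
qed

lemma kernel_trivial:
  assumes x: "x \<in> carrier D" and \<phi>x: "\<phi> x = \<zero>\<^bsub>M\<^esub>"
  shows "x = \<zero>\<^bsub>D\<^esub>"
proof (rule I.M.eq_zero_if_norm_le_all[OF x])
  fix e :: real assume e: "e > 0"
  obtain m where m: "m > 0" and approx: "\<And>N. m \<le> N \<Longrightarrow> cnorm D (x \<ominus>\<^bsub>D\<^esub> \<beta>.mean m N x) \<le> e / 3"
    using \<beta>.fejer_theorem[OF \<beta>_continuous[OF x] x, of "e / 3"] e by auto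
  define \<gamma> where "\<gamma> = e / 3 / real (m ^ k)"
  have \<gamma>: "\<gamma> > 0" "real (m ^ k) * \<gamma> = e / 3"
    using e m by (simp_all add: \<gamma>_def)
  then have "1 * \<gamma> \<le> real (m ^ k) * \<gamma>"
    using m by (intro mult_right_mono) (simp_all add: Suc_le_eq)
  then have \<gamma>_le: "\<gamma> \<le> e / 3"
    using \<gamma>(2) by simp
  obtain y where y: "y \<in> I.rep_span" "cnorm D (x \<ominus>\<^bsub>D\<^esub> y) < \<gamma>"
    using I.M.closed_span_approx[OF _ I.rep_monomials_closed \<gamma>(1), of x] x rep_algebra_eq_carrier by blast
  have y_closed: "y \<in> carrier D"
    using y(1) by (rule I.rep_span_in_carrier)
  obtain N where N: "m \<le> N" "cnorm D (\<beta>.mean m N y) \<le> real (m ^ k) * cnorm M (\<phi> y)"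
    using eventually_happens[OF eventually_conj[OF eventually_norm_mean_le[OF y(1) m] eventually_ge_at_top[of m]]]
    by auto
  have "cnorm M (\<phi> y) = cnorm M (\<phi> (x \<ominus>\<^bsub>D\<^esub> y))"
    using x y_closed \<phi>x by (simp add: h.hom_diff R.M.diff_as_scale R.M.scale_closed R.M.norm_scale)
  also have "\<dots> \<le> \<gamma>"
    using h.contractive[of "x \<ominus>\<^bsub>D\<^esub> y"] x y_closed y(2) by simp
  finally have "cnorm D (\<beta>.mean m N y) \<le> e / 3"
    using N(2) \<gamma>(2) mult_left_mono[of "cnorm M (\<phi> y)" \<gamma> "real (m ^ k)"] by simp
  moreover have "cnorm D (\<beta>.mean m N x \<ominus>\<^bsub>D\<^esub> \<beta>.mean m N y) \<le> e / 3"
    using \<beta>.norm_mean_le[of "x \<ominus>\<^bsub>D\<^esub> y", OF _ m N(1)] x y_closed y(2) \<gamma>_le by (simp add: \<beta>.mean_diff)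
  ultimately show "cnorm D x \<le> e"
    using approx[OF N(1)] I.M.norm_le_add_diff[of x "\<beta>.mean m N x"]
      I.M.norm_le_add_diff[of "\<beta>.mean m N x" "\<beta>.mean m N y"] x y_closed by simp
qed

lemma inj_on_\<phi>: "inj_on \<phi> (carrier D)"
proof (rule inj_onI)
  fix x y assume xy: "x \<in> carrier D" "y \<in> carrier D" "\<phi> x = \<phi> y"
  then have "x \<ominus>\<^bsub>D\<^esub> y = \<zero>\<^bsub>D\<^esub>"
    by (intro kernel_trivial) (simp_all add: h.hom_diff)
  then show "x = y"
    using xy by (simp add: I.M.diff_eq_zero_iff)
qed

end

theorem theorem5p1:
  fixes k :: nat
    and \<Lambda> :: "'l kgraph"
    and G :: "'g monoid"
    and \<eta> :: "'l \<Rightarrow> 'g"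
    and C :: "'c cstar" and s :: "'l \<Rightarrow> 'c"
    and B :: "('g, 'c) fell_data"
    and \<sigma> :: "'g \<Rightarrow> 'g \<Rightarrow> complex"
    and D :: "'d cstar" and \<iota> :: "'g \<Rightarrow> 'c \<Rightarrow> 'd"
    and \<beta> :: "(nat \<Rightarrow> complex) \<Rightarrow> 'd \<Rightarrow> 'd"
    and A :: "'a cstar"
    and \<rho> :: "'g \<Rightarrow> 'c \<Rightarrow> ('a \<Rightarrow> 'a) \<times> ('a \<Rightarrow> 'a)"
    and \<alpha> :: "(nat \<Rightarrow> complex) \<Rightarrow> ('a \<Rightarrow> 'a) \<times> ('a \<Rightarrow> 'a) \<Rightarrow> ('a \<Rightarrow> 'a) \<times> ('a \<Rightarrow> 'a)"
  assumes "higher_rank_graph k \<Lambda>"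
    and "row_finite_no_sources k \<Lambda>"
    and "group G"
    and "functor_to_group \<Lambda> G \<eta>"
    and "universal_cuntz_krieger_family k \<Lambda> C s"
    and "B = kgraph_bundle \<Lambda> G \<eta> C s"
    and "two_cocycle G \<sigma>"
    and "universal_bundle_rep G (deformed_bundle G \<sigma> B) D \<iota>"
    and "gauge_action k \<Lambda> G \<eta> C s D \<iota> \<beta>"
    and "cstar_algebra A"
    and "bundle_multiplier_rep G (deformed_bundle G \<sigma> B) A \<rho>"
    and "strictly_continuous_torus_action k A \<alpha>"
    and "\<forall>z\<in>torus k. \<forall>g\<in>carrier G. \<forall>b\<in>fib B g. \<rho> g (on_fibre B \<iota> (\<beta> z) g b) = \<alpha> z (\<rho> g b)"
    and "\<forall>v\<in>kvertices \<Lambda>. \<rho> \<one>\<^bsub>G\<^esub> (s v) \<noteq> \<zero>\<^bsub>multiplier_algebra A\<^esub>"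
  shows "\<exists>\<phi>. integrates G (deformed_bundle G \<sigma> B) D \<iota> (multiplier_algebra A) \<rho> \<phi> \<and> inj_on \<phi> (carrier D)"
proof -
  let ?M = "multiplier_algebra A"
  have "ck_family k \<Lambda> C s"
    using assms(1,2,5) by (simp add: ck_family_def ck_family_axioms_def universal_cuntz_krieger_family_def)
  then interpret graded_ck_family k \<Lambda> C s G \<eta>
    using assms(3,4) by (simp add: graded_ck_family_def graded_ck_family_axioms_def)
  have D: "cstar_algebra D" "bundle_maps G (deformed_bundle G \<sigma> graph_bundle) D \<iota>"
    "cstar_generated D (\<Union>g\<in>carrier G. \<iota> g ` fibre g) = carrier D"
    using assms(6,8) by (simp_all add: universal_bundle_rep_def bundle_rep_def deformed_bundle_fib)
  interpret I: twisted_rep k \<Lambda> C s G \<eta> D \<sigma> \<iota>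
    using D assms(7) graded_ck_family_axioms by (simp add: twisted_rep_def twisted_rep_axioms_def)
  interpret R: twisted_rep k \<Lambda> C s G \<eta> ?M \<sigma> \<rho>
    using assms(6,7,10,11) graded_ck_family_axioms cstar_algebra.cstar_algebra_multiplier
    by (simp add: twisted_rep_def twisted_rep_axioms_def bundle_multiplier_rep_def)
  obtain \<phi> where \<phi>: "integrates G (deformed_bundle G \<sigma> graph_bundle) D \<iota> ?M \<rho> \<phi>"
    using R.universal_integrates assms(6,8) by blast
  interpret equivariant_reps k \<Lambda> C s G \<eta> \<sigma> D \<iota> ?M \<rho> \<phi> \<beta> \<alpha>
    using \<phi> D(3) assms(6,9,12-14)
    by unfold_locales (auto simp: integrates_def deformed_bundle_fib bundle_simps strictly_continuous_torus_action_def)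
  show ?thesis
    using \<phi> inj_on_\<phi> assms(6) by blast
qed

end
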